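(* As $n\to \infty$, we have $$a_3(n)\sim \frac{3^{1/4}}{3\pi n^{1/4}} e^{\pi\sqrt{\frac{n}{3}}}\qquad\text{and}\qquad b_3(n)\sim \left( \log(2)-\frac{1}{8}\right)\frac{3^{1/4}}{2\pi n^{1/4}}e^{\pi\sqrt{\frac{n}{3}}}.$$
   Context: A partition $\lambda=(\lambda_1,\dots,\lambda_\ell)$ of $n$ is a non-increasing sequence of positive integers (parts) with sum $n$. Its Young diagram is the left-justified array of boxes with $\lambda_i$ boxes in row $i$; the conjugate $\lambda'$ is the partition whose diagram has the columns of $\lambda$ as rows. The hook length of the box in row $i$ and column $j$ is $h(i,j)=\lambda_i+\lambda'_j-i-j+1$; the number of hooks of length $t$ in $\lambda$ is the number of boxes with hook length exactly $t$. $a_3(n)$ (respectively $b_3(n)$) is the total number of hooks of length $3$ in all partitions of $n$ into odd parts (respectively into distinct parts). $f(n)\sim g(n)$ as $n\to\infty$ means $f(n)/g(n)\to1$; $\log$ is the natural logarithm. *)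

theory Defs
  imports "HOL-Analysis.Analysis" "HOL-Library.Landau_Symbols"
begin

text \<open>A partition is the list of its parts in non-increasing order. Rows and columns of Young
  diagrams are numbered from \<open>1\<close>, whereas list indices start at \<open>0\<close>.\<close>

definition partition_of :: "nat list \<Rightarrow> nat \<Rightarrow> bool" where
  "partition_of p n \<longleftrightarrow> sorted_wrt (\<ge>) p \<and> (\<forall>x\<in>set p. 0 < x) \<and> sum_list p = n"

definition part :: "nat list \<Rightarrow> nat \<Rightarrow> nat" where
  "part p i = p ! (i - 1)"

definition young_diagram :: "nat list \<Rightarrow> (nat \<times> nat) set" where
  "young_diagram p = {(i, j). 1 \<le> i \<and> i \<le> length p \<and> 1 \<le> j \<and> j \<le> part p i}"

text \<open>The first part of a partition is its largest, hence the number of columns.\<close>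

definition conjugate :: "nat list \<Rightarrow> nat list" where
  "conjugate p = (case p of [] \<Rightarrow> []
     | m # _ \<Rightarrow> map (\<lambda>j. card {i. (i, j) \<in> young_diagram p}) [1..<Suc m])"

text \<open>Integer-valued, so that the subtractions are not truncated.\<close>

definition hook_length :: "nat list \<Rightarrow> nat \<Rightarrow> nat \<Rightarrow> int" where
  "hook_length p i j = int (part p i) + int (part (conjugate p) j) - int i - int j + 1"

definition num_hooks :: "nat \<Rightarrow> nat list \<Rightarrow> nat" where
  "num_hooks t p = card {(i, j) \<in> young_diagram p. hook_length p i j = int t}"

definition odd_partitions :: "nat \<Rightarrow> nat list set" where
  "odd_partitions n = {p. partition_of p n \<and> (\<forall>x\<in>set p. odd x)}"

definition distinct_partitions :: "nat \<Rightarrow> nat list set" where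
  "distinct_partitions n = {p. partition_of p n \<and> distinct p}"

definition a_hooks :: "nat \<Rightarrow> nat \<Rightarrow> nat" where
  "a_hooks t n = (\<Sum>p\<in>odd_partitions n. num_hooks t p)"

definition b_hooks :: "nat \<Rightarrow> nat \<Rightarrow> nat" where
  "b_hooks t n = (\<Sum>p\<in>distinct_partitions n. num_hooks t p)"

text \<open>The sets counted and summed over above are finite.\<close>

lemma finite_young_diagram: "finite (young_diagram p)"
proof (rule finite_subset)
  show "young_diagram p \<subseteq> (SIGMA i:{1..length p}. {1..part p i})"
    by (auto simp: young_diagram_def)
qed auto

lemma finite_partitions_of: "finite {p. partition_of p n}"
proof (rule finite_subset)
  have "length p \<le> sum_list p" if "\<forall>x\<in>set p. 0 < x" for p :: "nat list"
    using that by (induction p) auto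
  then show "{p. partition_of p n} \<subseteq> {p. set p \<subseteq> {..n} \<and> length p \<le> n}"
    by (auto simp: partition_of_def dest: member_le_sum_list)
  show "finite {p. set p \<subseteq> {..n} \<and> length p \<le> n}"
    by (rule finite_lists_length_le) simp
qed

lemma finite_odd_partitions: "finite (odd_partitions n)"
  by (rule finite_subset[OF _ finite_partitions_of[of n]]) (auto simp: odd_partitions_def)

lemma finite_distinct_partitions: "finite (distinct_partitions n)"
  by (rule finite_subset[OF _ finite_partitions_of[of n]]) (auto simp: distinct_partitions_def)

end

theory Submission
  imports Defs "HOL-Computational_Algebra.Formal_Power_Series" "HOL-Probability.Distributions" "HOL-Real_Asymp.Real_Asymp"
begin

text \<open>Let \<open>m j\<close> be the number of parts equal to \<open>j\<close>. A box in column \<open>j\<close> with hook length three is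
  visible in \<open>m j\<close>, \<open>m (j + 1)\<close> and \<open>m (j + 2)\<close> alone (\<open>num_hooks_3\<close>), so both hook totals are sums over
  \<open>j\<close> of numbers of partitions with a few parts prescribed or forbidden. Let \<open>Q(q)\<close> be the product of
  all \<open>1 + q ^ k\<close>, the generating function of partitions into distinct parts and, by Euler, of
  partitions into odd parts. Prescribing or forbidding parts multiplies \<open>Q\<close> by a rational function.
  Hence the hook totals at \<open>n\<close> are the coefficients of \<open>q ^ n\<close> in \<open>Q(q) * W(q)\<close>, where \<open>W\<close> is a sum of
  explicit rational functions over \<open>k \<le> n\<close> (\<open>a_hooks_3_eq\<close>, \<open>b_hooks_3_eq\<close>, \<open>a_weight\<close>, \<open>b_weight\<close>).

  Put \<open>q = exp (- z)\<close>. For small \<open>z\<close> near the positive axis, \<open>Q(exp (- z))\<close> is asymptotic to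
  \<open>exp (pi\<^sup>2 / (12 * z)) / sqrt 2\<close> (\<open>distinct_gf_asymptotics\<close>), by the trapezoidal rule for the
  logarithm of the product. The coefficient of \<open>q ^ n\<close> is an integral over the circle \<open>Re z = t\<close>, where
  \<open>t = pi / sqrt (12 * n)\<close> is the saddle point of \<open>pi\<^sup>2 / (12 * z) + n * z\<close>. There the integrand has a
  Gaussian peak of width \<open>t powr (3/2)\<close> and a height proportional to \<open>exp (2 * n * t) = exp (pi * sqrt (n / 3))\<close>, apart from the factor \<open>W\<close>. At
  angles larger than \<open>t\<close> the modulus of \<open>Q\<close> is smaller than at the saddle point by a factor \<open>exp (- c / t)\<close>
  (\<open>norm_distinct_gf_away_from_axis\<close>), which beats the polynomial growth of \<open>W\<close> in \<open>1 / t\<close>.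

  On the peak, \<open>t * W\<close> is a Riemann sum of mesh \<open>t\<close> and converges to the integral \<open>L\<close> of a function of
  \<open>x = k * t\<close> over the half-line (\<open>saddle_riemann_sum_tendsto\<close>). Dominated convergence then gives the
  asymptotics for any such weight (\<open>saddle_point_asymptotics\<close>), with constant proportional to \<open>L\<close>. The
  two limits are \<open>L = 2 / 3\<close> for odd parts and \<open>L = ln 2 - 1 / 8\<close> for distinct parts.\<close>

section \<open>Hooks of length three through multiplicities\<close>

text \<open>The number of parts that are at least \<open>j\<close> is the length of column \<open>j\<close>, but unlike
  \<open>conjugate\<close> it makes sense for every \<open>j\<close>, including columns beyond the diagram.\<close>

definition parts_ge :: "nat list \<Rightarrow> nat \<Rightarrow> nat" where
  "parts_ge p j = card {i. 1 \<le> i \<and> i \<le> length p \<and> j \<le> part p i}"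

text \<open>Both sides say that the box in row \<open>i\<close> and column \<open>j\<close> belongs to the diagram, read once
  along the row and once down the column.\<close>

lemma le_part_iff_le_parts_ge:
  assumes "sorted_wrt (\<ge>) p" "1 \<le> i" "i \<le> length p"
  shows "j \<le> part p i \<longleftrightarrow> i \<le> parts_ge p j"
proof
  let ?S = "{i. 1 \<le> i \<and> i \<le> length p \<and> j \<le> part p i}"
  have mono: "part p k \<le> part p i" if "1 \<le> i" "i \<le> k" "k \<le> length p" for i k
    using that assms(1) by (cases "i = k") (auto simp: part_def sorted_wrt_iff_nth_less)
  have fin: "finite ?S" by (rule finite_subset[of _ "{..length p}"]) auto
  {
    assume "j \<le> part p i"
    then have "{1..i} \<subseteq> ?S" using mono[of _ i] assms(3) by (auto intro: order_trans)
    from card_mono[OF fin this] show "i \<le> parts_ge p j" by (simp add: parts_ge_def)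
  next
    assume *: "i \<le> parts_ge p j"
    show "j \<le> part p i"
    proof (rule ccontr)
      assume "\<not> j \<le> part p i"
      then have "\<not> i \<le> k" if "k \<in> ?S" for k
        using that mono[of i k] assms(2) by auto
      then have "?S \<subseteq> {1..<i}" by (force simp: not_le)
      from card_mono[OF _ this] * assms(2) show False by (simp add: parts_ge_def)
    qed
  }
qed

lemma parts_ge_eq_count_plus: "parts_ge p j = count (mset p) j + parts_ge p (Suc j)"
proof -
  have eq: "parts_ge p j = size (filter_mset (\<lambda>x. j \<le> x) (mset p))" for j
  proof -
    have "parts_ge p j = card {i. i < length p \<and> j \<le> p ! i}"
      unfolding parts_ge_def
      by (rule bij_betw_same_card[of "\<lambda>i. i - 1"], rule bij_betw_byWitness[where f' = Suc])
         (auto simp: part_def)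
    then show ?thesis
      by (simp only: length_filter_conv_card mset_filter[symmetric] size_mset)
  qed
  have "filter_mset (\<lambda>x. j \<le> x) (mset p) =
      filter_mset (\<lambda>x. x = j) (mset p) + filter_mset (\<lambda>x. Suc j \<le> x) (mset p)"
    by (rule multiset_eqI) auto
  then show ?thesis
    unfolding eq by (simp add: filter_eq_replicate_mset)
qed

lemma part_conjugate:
  assumes "(i, j) \<in> young_diagram p" "sorted_wrt (\<ge>) p"
  shows "part (conjugate p) j = parts_ge p j"
proof -
  obtain m p' where p: "p = m # p'"
    using assms(1) by (cases p) (auto simp: young_diagram_def)
  have ij: "1 \<le> i" "i \<le> length p" "1 \<le> j" "j \<le> p ! (i - 1)"
    using assms(1) by (auto simp: young_diagram_def part_def)
  have "p ! (i - 1) \<in> set p" using ij by (intro nth_mem) auto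
  then have "p ! (i - 1) \<le> m" using assms(2) p by auto
  then have "j \<le> m" using ij by simp
  then have "[1..<Suc m] ! (j - 1) = j" using ij(3) by (subst nth_upt) auto
  with \<open>j \<le> m\<close> have "part (conjugate p) j = card {i. (i, j) \<in> young_diagram p}"
    using ij by (simp add: part_def conjugate_def p del: upt_Suc)
  also have "\<dots> = parts_ge p j"
    using ij(3) by (simp add: parts_ge_def young_diagram_def)
  finally show ?thesis .
qed

text \<open>A hook of length \<open>t\<close> with arm \<open>a\<close> has leg \<open>t - 1 - a\<close>, so its column \<open>j\<close> determines
  its row as the column length minus the leg. The only remaining condition is that this row has
  length exactly \<open>j + a\<close>, which by the previous equivalence is a pair of inequalities between the
  lengths of the columns \<open>j\<close>, \<open>j + a\<close> and \<open>j + a + 1\<close>.\<close>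

lemma num_hooks_eq_card_arm_column:
  assumes p: "sorted_wrt (\<ge>) p"
  shows "num_hooks t p = card {(a, j). a < t \<and> 1 \<le> j \<and>
    parts_ge p (j + a + 1) + (t - 1 - a) < parts_ge p j \<and>
    parts_ge p j \<le> parts_ge p (j + a) + (t - 1 - a)}"
  unfolding num_hooks_def
proof (rule bij_betw_same_card[of "\<lambda>(i, j). (part p i - j, j)"],
       rule bij_betw_byWitness[where f' = "\<lambda>(a, j). (parts_ge p j - (t - 1 - a), j)"])
  let ?H = "{(i, j) \<in> young_diagram p. hook_length p i j = int t}"
  let ?K = "{(a, j). a < t \<and> 1 \<le> j \<and>
    parts_ge p (j + a + 1) + (t - 1 - a) < parts_ge p j \<and>
    parts_ge p j \<le> parts_ge p (j + a) + (t - 1 - a)}"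
  have len: "parts_ge p j \<le> length p" for j
    unfolding parts_ge_def by (rule order_trans[OF card_mono[of "{1..length p}"]]) auto
  have H: "1 \<le> i \<and> i \<le> length p \<and> 1 \<le> j \<and> j \<le> part p i \<and> i \<le> parts_ge p j \<and>
      part p i + parts_ge p j + 1 = t + i + j"
    if "(i, j) \<in> ?H" for i j
  proof -
    from that have Y: "(i, j) \<in> young_diagram p" and h: "hook_length p i j = int t" by auto
    from Y have ij: "1 \<le> i" "i \<le> length p" "1 \<le> j" "j \<le> part p i"
      by (auto simp: young_diagram_def)
    with le_part_iff_le_parts_ge[OF p, of i j] have "i \<le> parts_ge p j" by simp
    moreover have "part p i + parts_ge p j + 1 = t + i + j"
      using h part_conjugate[OF Y p] by (simp add: hook_length_def)
    ultimately show ?thesis using ij by blast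
  qed
  show "\<forall>x\<in>?H. (\<lambda>(a, j). (parts_ge p j - (t - 1 - a), j)) ((\<lambda>(i, j). (part p i - j, j)) x) = x"
  proof
    fix x assume "x \<in> ?H"
    then show "(\<lambda>(a, j). (parts_ge p j - (t - 1 - a), j)) ((\<lambda>(i, j). (part p i - j, j)) x) = x"
      using H[of "fst x" "snd x"] by (cases x) auto
  qed
  have K: "1 \<le> parts_ge p j - (t - 1 - a) \<and> parts_ge p j - (t - 1 - a) \<le> length p \<and>
      part p (parts_ge p j - (t - 1 - a)) = j + a" if "(a, j) \<in> ?K" for a j
  proof -
    define i where "i = parts_ge p j - (t - 1 - a)"
    have i: "1 \<le> i" "i \<le> length p" using that len[of j] by (auto simp: i_def)
    have "j + a \<le> part p i" "\<not> j + a + 1 \<le> part p i"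
      unfolding le_part_iff_le_parts_ge[OF p i] using that by (auto simp: i_def)
    with i show ?thesis unfolding i_def by auto
  qed
  show "\<forall>x\<in>?K. (\<lambda>(i, j). (part p i - j, j)) ((\<lambda>(a, j). (parts_ge p j - (t - 1 - a), j)) x) = x"
  proof
    fix x assume "x \<in> ?K"
    then show "(\<lambda>(i, j). (part p i - j, j)) ((\<lambda>(a, j). (parts_ge p j - (t - 1 - a), j)) x) = x"
      using K[of "fst x" "snd x"] by (cases x) auto
  qed
  show "(\<lambda>(i, j). (part p i - j, j)) ` ?H \<subseteq> ?K"
  proof clarify
    fix i j assume ij: "(i, j) \<in> young_diagram p" "hook_length p i j = int t"
    then have h: "1 \<le> i" "i \<le> length p" "1 \<le> j" "j \<le> part p i" "i \<le> parts_ge p j"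
      "part p i + parts_ge p j + 1 = t + i + j" using H[of i j] by auto
    have "i \<le> parts_ge p (part p i)" "\<not> i \<le> parts_ge p (part p i + 1)"
      unfolding le_part_iff_le_parts_ge[OF p h(1,2), symmetric] by auto
    then show "part p i - j < t \<and> 1 \<le> j \<and>
       parts_ge p (j + (part p i - j) + 1) + (t - 1 - (part p i - j)) < parts_ge p j \<and>
       parts_ge p j \<le> parts_ge p (j + (part p i - j)) + (t - 1 - (part p i - j))"
      using h by auto
  qed
  show "(\<lambda>(a, j). (parts_ge p j - (t - 1 - a), j)) ` ?K \<subseteq> ?H"
  proof clarify
    fix a j assume aj: "a < t" "1 \<le> j" "parts_ge p (j + a + 1) + (t - 1 - a) < parts_ge p j"
      "parts_ge p j \<le> parts_ge p (j + a) + (t - 1 - a)"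
    then have k: "1 \<le> parts_ge p j - (t - 1 - a)" "parts_ge p j - (t - 1 - a) \<le> length p"
      "part p (parts_ge p j - (t - 1 - a)) = j + a" using K[of a j] by auto
    then have Y: "(parts_ge p j - (t - 1 - a), j) \<in> young_diagram p"
      using aj by (auto simp: young_diagram_def)
    show "(parts_ge p j - (t - 1 - a), j) \<in> young_diagram p \<and>
      hook_length p (parts_ge p j - (t - 1 - a)) j = int t"
      using Y part_conjugate[OF Y p] k aj by (auto simp: hook_length_def)
  qed
qed

text \<open>For a partition with multiplicities \<open>m\<close>, the three summands record the hooks in column \<open>j\<close>
  with arm \<open>0\<close>, \<open>1\<close> and \<open>2\<close>.\<close>

definition hooks3 :: "(nat \<Rightarrow> nat) \<Rightarrow> nat \<Rightarrow> nat" where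
  "hooks3 m j = of_bool (3 \<le> m j) + of_bool (m j \<le> 1 \<and> 2 \<le> m j + m (j + 1))
     + of_bool (m j = 0 \<and> m (j + 1) = 0 \<and> 1 \<le> m (j + 2))"

text \<open>Consecutive column lengths differ by multiplicities, so the inequalities that describe
  a hook turn into local conditions on three consecutive multiplicities. Columns beyond the largest
  part contribute nothing, which leaves the upper limit of the sum free.\<close>

lemma num_hooks_3:
  assumes p: "partition_of p n" and N: "n \<le> N"
  shows "num_hooks 3 p = (\<Sum>j=1..N. hooks3 (count (mset p)) j)"
proof -
  let ?m = "count (mset p)" and ?c = "parts_ge p"
  have c: "?c j = ?m j + ?m (j + 1) + ?m (j + 2) + ?c (j + 3)"
       "?c (j + 1) = ?m (j + 1) + ?m (j + 2) + ?c (j + 3)"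
       "?c (j + 2) = ?m (j + 2) + ?c (j + 3)" for j
    using parts_ge_eq_count_plus[of p j] parts_ge_eq_count_plus[of p "j + 1"]
      parts_ge_eq_count_plus[of p "j + 2"] by (simp_all add: numeral_3_eq_3)
  have m0: "?m j = 0" if "j > N" for j
  proof (rule ccontr)
    assume "?m j \<noteq> 0"
    then have "j \<in> set p" by (simp add: count_eq_zero_iff)
    then have "j \<le> n" using p member_le_sum_list[of j p] by (simp add: partition_of_def)
    then show False using that N by simp
  qed
  let ?K0 = "{j\<in>{1..N}. 3 \<le> ?m j}"
  let ?K1 = "{j\<in>{1..N}. ?m j \<le> 1 \<and> 2 \<le> ?m j + ?m (j + 1)}"
  let ?K2 = "{j\<in>{1..N}. ?m j = 0 \<and> ?m (j + 1) = 0 \<and> 1 \<le> ?m (j + 2)}"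
  have "{(a, j). a < 3 \<and> 1 \<le> j \<and> ?c (j + a + 1) + (3 - 1 - a) < ?c j \<and>
      ?c j \<le> ?c (j + a) + (3 - 1 - a)} = {0} \<times> ?K0 \<union> {1} \<times> ?K1 \<union> {2} \<times> ?K2" (is "?L = ?R")
  proof (rule set_eqI, clarify)
    fix a j :: nat
    have L0: "?c (j + 1) + 2 < ?c j \<and> ?c j \<le> ?c j + 2 \<longleftrightarrow> 3 \<le> ?m j"
      using c(1,2)[of j] by arith
    have L1: "?c (j + 2) + 1 < ?c j \<and> ?c j \<le> ?c (j + 1) + 1 \<longleftrightarrow>
        ?m j \<le> 1 \<and> 2 \<le> ?m j + ?m (j + 1)"
      using c[of j] by arith
    have L2: "?c (j + 3) < ?c j \<and> ?c j \<le> ?c (j + 2) \<longleftrightarrow>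
        ?m j = 0 \<and> ?m (j + 1) = 0 \<and> 1 \<le> ?m (j + 2)"
      using c[of j] by arith
    have z: "N < j \<Longrightarrow> ?m j = 0 \<and> ?m (j + 1) = 0 \<and> ?m (j + 2) = 0"
      using m0[of j] m0[of "j + 1"] m0[of "j + 2"] by linarith
    have N: "3 \<le> ?m j \<Longrightarrow> j \<le> N" "2 \<le> ?m j + ?m (j + 1) \<Longrightarrow> j \<le> N" "1 \<le> ?m (j + 2) \<Longrightarrow> j \<le> N"
      using z by linarith+
    consider "a = 0" | "a = 1" | "a = 2" | "\<not> a < 3" by linarith
    then show "(a, j) \<in> ?L \<longleftrightarrow> (a, j) \<in> ?R"
    proof cases
      case 1
      show ?thesis using L0 N(1) by (simp add: 1) blast
    next
      case 2
      show ?thesis using L1 N(2) by (simp add: 2) blast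
    next
      case 3
      show ?thesis using L2 N(3) by (simp add: 3 numeral_eq_Suc) blast
    qed auto
  qed
  moreover have "card ({0::nat} \<times> ?K0 \<union> {1} \<times> ?K1 \<union> {2} \<times> ?K2) = card ?K0 + card ?K1 + card ?K2"
  proof -
    have "card ({0::nat} \<times> ?K0 \<union> {1} \<times> ?K1 \<union> {2} \<times> ?K2) =
        card ({0::nat} \<times> ?K0 \<union> {1} \<times> ?K1) + card ({2::nat} \<times> ?K2)"
      by (rule card_Un_disjoint) auto
    also have "card ({0::nat} \<times> ?K0 \<union> {1} \<times> ?K1) = card ({0::nat} \<times> ?K0) + card ({1::nat} \<times> ?K1)"
      by (rule card_Un_disjoint) auto
    finally show ?thesis by (simp add: card_cartesian_product)
  qed
  ultimately have "num_hooks 3 p = card ?K0 + card ?K1 + card ?K2"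
    using num_hooks_eq_card_arm_column[of p 3] p unfolding partition_of_def by metis
  moreover have "card {j\<in>{1..N}. P j} = (\<Sum>j=1..N. of_bool (P j))" for P
    by (simp add: sum_of_bool_eq Int_def)
  ultimately show ?thesis
    by (simp only: hooks3_def sum.distrib)
qed

section \<open>Counting finite sets and multisets by their sum\<close>

definition subset_count :: "nat set \<Rightarrow> nat \<Rightarrow> nat" where
  "subset_count A n = card {S. finite S \<and> S \<subseteq> A \<and> \<Sum>S = n}"

definition multiset_count :: "nat set \<Rightarrow> nat \<Rightarrow> nat" where
  "multiset_count A n = card {M. set_mset M \<subseteq> A \<and> \<Sum>\<^sub># M = n}"

text \<open>The coefficients of a power series after multiplication by the power \<open>s\<close> of the variable.\<close>

definition shifted :: "nat \<Rightarrow> (nat \<Rightarrow> nat) \<Rightarrow> nat \<Rightarrow> nat" where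
  "shifted s c n = (if s \<le> n then c (n - s) else 0)"

lemma finite_subsets_sum_eq: "finite {S. finite S \<and> S \<subseteq> A \<and> \<Sum>S = (n::nat)}"
proof (rule finite_subset)
  have "x \<le> \<Sum>S" if "finite S" "x \<in> S" for S :: "nat set" and x
    using member_le_sum[of x S "\<lambda>x. x"] that by auto
  then show "{S. finite S \<and> S \<subseteq> A \<and> \<Sum>S = n} \<subseteq> Pow {..n}" by auto
qed simp

text \<open>Removing \<open>K\<close> leaves an arbitrary subset of \<open>A - K\<close> with a smaller sum.\<close>

lemma card_subsets_containing:
  assumes "finite K" "K \<subseteq> A"
  shows "card {S. finite S \<and> S \<subseteq> A \<and> \<Sum>S = n \<and> K \<subseteq> S} = shifted (\<Sum>K) (subset_count (A - K)) n"
proof -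
  have sum: "\<Sum>S = \<Sum>(S - K) + \<Sum>K" if "finite S" "K \<subseteq> S" for S
    using that by (simp add: sum.subset_diff)
  show ?thesis
  proof (cases "\<Sum>K \<le> n")
    case True
    have "bij_betw (\<lambda>S. S - K) {S. finite S \<and> S \<subseteq> A \<and> \<Sum>S = n \<and> K \<subseteq> S}
        {S. finite S \<and> S \<subseteq> A - K \<and> \<Sum>S = n - \<Sum>K}"
    proof (rule bij_betw_byWitness[where f' = "\<lambda>S. S \<union> K"])
      show "(\<lambda>S. S - K) ` {S. finite S \<and> S \<subseteq> A \<and> \<Sum>S = n \<and> K \<subseteq> S} \<subseteq>
          {S. finite S \<and> S \<subseteq> A - K \<and> \<Sum>S = n - \<Sum>K}"
        using sum by fastforce
      have "\<Sum>(S \<union> K) = n" if "finite S" "S \<subseteq> A - K" "\<Sum>S = n - \<Sum>K" for S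
      proof -
        have "\<Sum>(S \<union> K) = \<Sum>S + \<Sum>K" using that assms by (intro sum.union_disjoint) auto
        then show ?thesis using that True by simp
      qed
      then show "(\<lambda>S. S \<union> K) ` {S. finite S \<and> S \<subseteq> A - K \<and> \<Sum>S = n - \<Sum>K} \<subseteq>
          {S. finite S \<and> S \<subseteq> A \<and> \<Sum>S = n \<and> K \<subseteq> S}"
        using assms by auto
    qed (use assms in auto)
    then show ?thesis using True by (simp add: shifted_def subset_count_def bij_betw_same_card)
  next
    case False
    then have "{S. finite S \<and> S \<subseteq> A \<and> \<Sum>S = n \<and> K \<subseteq> S} = {}" using sum by fastforce
    then show ?thesis using False by (simp only: shifted_def) simp
  qed
qed

lemma subset_count_remove:
  assumes "s \<in> A"
  shows "subset_count A n = subset_count (A - {s}) n + shifted s (subset_count (A - {s})) n"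
proof -
  have "{S. finite S \<and> S \<subseteq> A \<and> \<Sum>S = n} = {S. finite S \<and> S \<subseteq> A - {s} \<and> \<Sum>S = n} \<union>
      {S. finite S \<and> S \<subseteq> A \<and> \<Sum>S = n \<and> {s} \<subseteq> S}" by auto
  moreover have "card ({S. finite S \<and> S \<subseteq> A - {s} \<and> \<Sum>S = n} \<union>
      {S. finite S \<and> S \<subseteq> A \<and> \<Sum>S = n \<and> {s} \<subseteq> S}) = card {S. finite S \<and> S \<subseteq> A - {s} \<and> \<Sum>S = n} +
      card {S. finite S \<and> S \<subseteq> A \<and> \<Sum>S = n \<and> {s} \<subseteq> S}"
    by (rule card_Un_disjoint[OF finite_subsets_sum_eq])
       (auto intro: finite_subset[OF _ finite_subsets_sum_eq[of A n]])
  ultimately show ?thesis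
    using card_subsets_containing[of "{s}" A n] assms by (simp add: subset_count_def)
qed

lemma subset_count_mono: "A \<subseteq> B \<Longrightarrow> subset_count A n \<le> subset_count B n"
  unfolding subset_count_def by (rule card_mono[OF finite_subsets_sum_eq]) auto

lemma subset_count_empty: "subset_count {} n = of_bool (n = 0)"
proof -
  have "{S. finite S \<and> S \<subseteq> {} \<and> \<Sum>S = n} = (if n = 0 then {{}} else {})" by auto
  then show ?thesis by (simp only: subset_count_def) simp
qed

lemma subset_count_truncate:
  assumes "n \<le> N"
  shows "subset_count {1..N} n = subset_count {1..} n"
proof -
  have "x \<le> \<Sum>S" if "finite S" "x \<in> S" for S :: "nat set" and x
    using member_le_sum[of x S "\<lambda>x. x"] that by auto
  then have "{S. finite S \<and> S \<subseteq> {1..N} \<and> \<Sum>S = n} = {S. finite S \<and> S \<subseteq> {1..} \<and> \<Sum>S = n}"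
    using assms by (fastforce simp: subset_iff)
  then show ?thesis by (simp only: subset_count_def)
qed

lemma finite_multisets_sum_eq:
  assumes "0 \<notin> A"
  shows "finite {M. set_mset M \<subseteq> A \<and> \<Sum>\<^sub># M = (n::nat)}"
proof (rule finite_subset)
  have "M \<in> mset ` {p. partition_of p n}" if "set_mset M \<subseteq> A" "\<Sum>\<^sub># M = n" for M
  proof
    show "M = mset (rev (sorted_list_of_multiset M))" by simp
    show "rev (sorted_list_of_multiset M) \<in> {p. partition_of p n}"
      using that assms sum_mset_sum_list[of "sorted_list_of_multiset M"]
      by (auto simp: partition_of_def sorted_wrt_rev intro!: gr0I)
  qed
  then show "{M. set_mset M \<subseteq> A \<and> \<Sum>\<^sub># M = n} \<subseteq> mset ` {p. partition_of p n}" by blast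
qed (simp add: finite_partitions_of)

text \<open>Removing \<open>K\<close> leaves an arbitrary multiset over the same \<open>A\<close>, since repetition is
  allowed. This is why all hook counts for odd parts reduce to the same counting function.\<close>

lemma card_multisets_containing:
  assumes "set_mset K \<subseteq> A"
  shows "card {M. set_mset M \<subseteq> A \<and> \<Sum>\<^sub># M = n \<and> K \<subseteq># M} = shifted (\<Sum>\<^sub># K) (multiset_count A) n"
proof (cases "\<Sum>\<^sub># K \<le> n")
  case True
  have "bij_betw (\<lambda>M. M - K) {M. set_mset M \<subseteq> A \<and> \<Sum>\<^sub># M = n \<and> K \<subseteq># M}
      {M. set_mset M \<subseteq> A \<and> \<Sum>\<^sub># M = n - \<Sum>\<^sub># K}"
    using assms True
    by (intro bij_betw_byWitness[where f' = "\<lambda>M. M + K"])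
       (auto simp: sum_mset_diff dest: in_diffD)
  then show ?thesis using True by (simp add: shifted_def multiset_count_def bij_betw_same_card)
next
  case False
  have "\<Sum>\<^sub># K \<le> \<Sum>\<^sub># M" if "K \<subseteq># M" for M
    using that by (metis le_add1 subset_mset.add_diff_inverse sum_mset.union)
  then have "{M. set_mset M \<subseteq> A \<and> \<Sum>\<^sub># M = n \<and> K \<subseteq># M} = {}" using False by auto
  then show ?thesis using False by (simp only: shifted_def) simp
qed

lemma multiset_count_insert:
  assumes "s \<notin> A" "0 \<notin> insert s A"
  shows "multiset_count (insert s A) n = multiset_count A n + shifted s (multiset_count (insert s A)) n"
proof -
  let ?B = "insert s A"
  have "{M. set_mset M \<subseteq> ?B \<and> \<Sum>\<^sub># M = n} = {M. set_mset M \<subseteq> A \<and> \<Sum>\<^sub># M = n} \<union>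
      {M. set_mset M \<subseteq> ?B \<and> \<Sum>\<^sub># M = n \<and> {#s#} \<subseteq># M}" by auto
  moreover have "card ({M. set_mset M \<subseteq> A \<and> \<Sum>\<^sub># M = n} \<union>
      {M. set_mset M \<subseteq> ?B \<and> \<Sum>\<^sub># M = n \<and> {#s#} \<subseteq># M}) = card {M. set_mset M \<subseteq> A \<and> \<Sum>\<^sub># M = n} +
      card {M. set_mset M \<subseteq> ?B \<and> \<Sum>\<^sub># M = n \<and> {#s#} \<subseteq># M}"
    using assms
    by (intro card_Un_disjoint)
       (auto intro: finite_subset[OF _ finite_multisets_sum_eq[of ?B n]])
  ultimately show ?thesis
    using card_multisets_containing[of "{#s#}" ?B n] by (simp add: multiset_count_def)
qed

lemma multiset_count_empty: "multiset_count {} n = of_bool (n = 0)"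
proof -
  have "{M. set_mset M \<subseteq> {} \<and> \<Sum>\<^sub># M = n} = (if n = 0 then {{#}} else {})" by auto
  then show ?thesis by (simp only: multiset_count_def) simp
qed

section \<open>Euler's theorem on odd and distinct parts\<close>

definition count_fps :: "(nat \<Rightarrow> nat) \<Rightarrow> int fps" where
  "count_fps c = Abs_fps (\<lambda>n. int (c n))"

lemma count_fps_shifted: "count_fps (shifted s c) = fps_X ^ s * count_fps c"
  by (rule fps_ext) (simp add: count_fps_def shifted_def fps_X_power_mult_nth)

lemma count_fps_subset_count: "count_fps (subset_count {1..N}) = (\<Prod>k=1..N. 1 + fps_X ^ k)"
proof (induction N)
  case 0
  show ?case by (rule fps_ext) (simp add: count_fps_def subset_count_empty fps_one_nth)
next
  case (Suc N)
  have "{1..Suc N} - {Suc N} = {1..N}" by auto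
  then have "count_fps (subset_count {1..Suc N}) =
      count_fps (subset_count {1..N}) + count_fps (shifted (Suc N) (subset_count {1..N}))"
    using subset_count_remove[of "Suc N" "{1..Suc N}"]
    by (intro fps_ext) (simp add: count_fps_def)
  with Suc.IH show ?case by (simp add: count_fps_shifted algebra_simps)
qed

lemma count_fps_multiset_count:
  "count_fps (multiset_count ((\<lambda>k. 2 * k - 1) ` {1..N})) * (\<Prod>k=1..N. 1 - fps_X ^ (2 * k - 1)) = 1"
proof (induction N)
  case 0
  show ?case by (rule fps_ext) (simp add: count_fps_def multiset_count_empty fps_one_nth)
next
  case (Suc N)
  let ?A = "(\<lambda>k. 2 * k - 1) ` {1..N}"
  let ?s = "2 * Suc N - 1"
  have B: "(\<lambda>k. 2 * k - 1) ` {1..Suc N} = insert ?s ?A" by (simp add: atLeastAtMostSuc_conv)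
  have "?s \<notin> ?A" "0 \<notin> insert ?s ?A" by auto
  then have "count_fps (multiset_count (insert ?s ?A)) =
      count_fps (multiset_count ?A) + count_fps (shifted ?s (multiset_count (insert ?s ?A)))"
    using multiset_count_insert[of ?s ?A] by (intro fps_ext) (simp add: count_fps_def)
  then have "count_fps (multiset_count (insert ?s ?A)) * (1 - fps_X ^ ?s) = count_fps (multiset_count ?A)"
    unfolding count_fps_shifted by (simp add: algebra_simps)
  moreover have "(\<Prod>k=1..Suc N. 1 - fps_X ^ (2 * k - 1)) =
      (1 - fps_X ^ ?s) * (\<Prod>k=1..N. 1 - fps_X ^ (2 * k - 1) :: int fps)" by simp
  ultimately show ?case unfolding B using Suc.IH by (simp only: mult.assoc[symmetric])
qed

text \<open>After multiplication by the product of all \<open>1 - X ^ k\<close> with \<open>k \<le> N\<close>, the left side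
  collects the even and the odd exponents up to \<open>2 * N\<close>. What remains after cancelling has no terms
  of degree between \<open>1\<close> and \<open>N\<close>, so the truncated identity decides all coefficients up to \<open>N\<close>.\<close>

lemma euler_product_truncated:
  "(\<Prod>k=1..N. 1 + fps_X ^ k) * (\<Prod>k=1..N. 1 - fps_X ^ (2 * k - 1)) = (\<Prod>k=Suc N..2*N. 1 - fps_X ^ k :: int fps)"
proof -
  have "(\<Prod>k=1..N. 1 + fps_X ^ k) * (\<Prod>k=1..N. 1 - fps_X ^ (2 * k - 1)) * (\<Prod>k=1..N. 1 - fps_X ^ k)
      = (\<Prod>k=1..2*N. 1 - fps_X ^ k :: int fps)"
  proof (induction N)
    case (Suc N)
    have "(1 + fps_X ^ Suc N) * (1 - fps_X ^ Suc N) = 1 - (fps_X :: int fps) ^ (2 * N + 2)"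
      by (simp add: algebra_simps flip: power_add)
    with Suc.IH show ?case
      by (simp add: mult_ac)
  qed simp
  also have "\<dots> = (\<Prod>k=Suc N..2*N. 1 - fps_X ^ k) * (\<Prod>k=1..N. 1 - fps_X ^ k)"
    unfolding mult_2 using prod.ub_add_nat[of 1 N "\<lambda>k. 1 - (fps_X :: int fps) ^ k" N]
    by (simp add: mult.commute)
  finally show ?thesis
  proof (rule mult_right_cancel[THEN iffD1, rotated])
    have "1 - (fps_X :: int fps) ^ k \<noteq> 0" if "k \<in> {1..N}" for k
    proof -
      have "fps_nth (1 - (fps_X :: int fps) ^ k) 0 = 1"
        using that by (simp only: fps_sub_nth fps_one_nth fps_X_power_nth) simp
      then show ?thesis by (metis fps_zero_nth zero_neq_one)
    qed
    then show "(\<Prod>k=1..N. 1 - (fps_X :: int fps) ^ k) \<noteq> 0" by simp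
  qed
qed

text \<open>Every factor is \<open>1\<close> up to terms of degree larger than \<open>i\<close>.\<close>

lemma fps_nth_mult_prod_high:
  fixes f :: "int fps"
  assumes "finite B" "\<And>k. k \<in> B \<Longrightarrow> i < k"
  shows "fps_nth (f * (\<Prod>k\<in>B. 1 - fps_X ^ k)) i = fps_nth f i"
  using assms
proof (induction B rule: finite_induct)
  case (insert x F)
  have "f * (\<Prod>k\<in>insert x F. 1 - fps_X ^ k) =
      f * (\<Prod>k\<in>F. 1 - fps_X ^ k) - fps_X ^ x * (f * (\<Prod>k\<in>F. 1 - fps_X ^ k))"
    using insert by (simp add: algebra_simps)
  then show ?case using insert by (simp add: fps_X_power_mult_nth)
qed simp

text \<open>Partitions of \<open>n\<close> use only parts up to \<open>n\<close>, so both counts are coefficients of finite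
  products, and these products differ only by a factor that is \<open>1\<close> up to degree \<open>n\<close>.\<close>

theorem euler_odd_distinct: "multiset_count {x. odd x} n = subset_count {1..} n"
proof -
  let ?A = "(\<lambda>k. 2 * k - 1) ` {1..n}"
  have "{M. set_mset M \<subseteq> {x. odd x} \<and> \<Sum>\<^sub># M = n} = {M. set_mset M \<subseteq> ?A \<and> \<Sum>\<^sub># M = n}"
  proof -
    have "x \<in> ?A" if "x \<in># M" "odd x" "\<Sum>\<^sub># M = n" for x M
    proof -
      have "x \<le> n" using that by (metis le_add1 multi_member_split sum_mset.add_mset)
      with \<open>odd x\<close> show ?thesis by (intro image_eqI[of _ _ "(x + 1) div 2"]) (auto elim!: oddE)
    qed
    moreover have "odd x" if "x \<in> ?A" for x using that by auto
    ultimately have "set_mset M \<subseteq> {x. odd x} \<longleftrightarrow> set_mset M \<subseteq> ?A" if "\<Sum>\<^sub># M = n" for M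
      using that by blast
    then show ?thesis by blast
  qed
  then have "multiset_count {x. odd x} n = multiset_count ?A n"
    by (simp only: multiset_count_def)
  also have "int \<dots> = fps_nth (count_fps (multiset_count ?A)) n"
    by (simp add: count_fps_def)
  also have "\<dots> = fps_nth (count_fps (multiset_count ?A) * (\<Prod>k=Suc n..2*n. 1 - fps_X ^ k)) n"
    by (rule fps_nth_mult_prod_high[symmetric]) auto
  also have "count_fps (multiset_count ?A) * (\<Prod>k=Suc n..2*n. 1 - fps_X ^ k)
      = count_fps (subset_count {1..n})"
  proof -
    let ?M = "count_fps (multiset_count ?A)" and ?D = "\<Prod>k=1..n. 1 + fps_X ^ k :: int fps"
      and ?P = "\<Prod>k=1..n. 1 - fps_X ^ (2 * k - 1) :: int fps"
    have "?M * (\<Prod>k=Suc n..2*n. 1 - fps_X ^ k) = ?M * (?D * ?P)"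
      by (simp only: euler_product_truncated)
    also have "\<dots> = (?M * ?P) * ?D" by (simp only: mult_ac)
    also have "\<dots> = ?D" by (simp only: count_fps_multiset_count mult_1_left)
    finally show ?thesis by (simp only: count_fps_subset_count)
  qed
  also have "fps_nth \<dots> n = int (subset_count {1..} n)"
    using subset_count_truncate[of n n] by (simp add: count_fps_def)
  finally show ?thesis by simp
qed

section \<open>Hook totals as sums of shifted counts\<close>

lemma bij_betw_mset_odd_partitions:
  "bij_betw mset (odd_partitions n) {M. set_mset M \<subseteq> {x. odd x} \<and> \<Sum>\<^sub># M = n}"
proof (rule bij_betw_byWitness[where f' = "\<lambda>M. rev (sorted_list_of_multiset M)"])
  show "\<forall>p\<in>odd_partitions n. rev (sorted_list_of_multiset (mset p)) = p"
  proof
    fix p assume "p \<in> odd_partitions n"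
    then have "sorted (rev p)"
      by (simp add: odd_partitions_def partition_of_def sorted_wrt_rev)
    then have "sort p = rev p" by (intro properties_for_sort) auto
    then show "rev (sorted_list_of_multiset (mset p)) = p" by simp
  qed
  show "mset ` odd_partitions n \<subseteq> {M. set_mset M \<subseteq> {x. odd x} \<and> \<Sum>\<^sub># M = n}"
    by (auto simp: odd_partitions_def partition_of_def sum_mset_sum_list)
  show "(\<lambda>M. rev (sorted_list_of_multiset M)) ` {M. set_mset M \<subseteq> {x. odd x} \<and> \<Sum>\<^sub># M = n} \<subseteq> odd_partitions n"
  proof clarify
    fix M :: "nat multiset" assume M: "set_mset M \<subseteq> {x. odd x}" "n = \<Sum>\<^sub># M"
    then show "rev (sorted_list_of_multiset M) \<in> odd_partitions (\<Sum>\<^sub># M)"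
      using sum_mset_sum_list[of "sorted_list_of_multiset M"]
      by (auto simp: odd_partitions_def partition_of_def sorted_wrt_rev intro!: gr0I)
  qed
qed simp

lemma bij_betw_set_distinct_partitions:
  "bij_betw set (distinct_partitions n) {S. finite S \<and> S \<subseteq> {1..} \<and> \<Sum>S = n}"
proof (rule bij_betw_byWitness[where f' = "\<lambda>S. rev (sorted_list_of_set S)"])
  show "\<forall>p\<in>distinct_partitions n. rev (sorted_list_of_set (set p)) = p"
  proof
    fix p assume "p \<in> distinct_partitions n"
    then have "sorted (rev p)" "distinct (rev p)"
      by (simp_all add: distinct_partitions_def partition_of_def sorted_wrt_rev)
    then have "sorted_list_of_set (set (rev p)) = rev p"
      by (rule sorted_list_of_set.idem_if_sorted_distinct)
    then show "rev (sorted_list_of_set (set p)) = p" by simp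
  qed
  show "set ` distinct_partitions n \<subseteq> {S. finite S \<and> S \<subseteq> {1..} \<and> \<Sum>S = n}"
    by (auto simp: distinct_partitions_def partition_of_def distinct_sum_list_conv_Sum)
  show "(\<lambda>S. rev (sorted_list_of_set S)) ` {S. finite S \<and> S \<subseteq> {1..} \<and> \<Sum>S = n} \<subseteq> distinct_partitions n"
  proof clarify
    fix S :: "nat set" assume S: "finite S" "S \<subseteq> {1..}" "n = \<Sum>S"
    then have "sum_list (rev (sorted_list_of_set S)) = \<Sum>S"
      by (simp add: distinct_sum_list_conv_Sum)
    with S show "rev (sorted_list_of_set S) \<in> distinct_partitions (\<Sum>S)"
      by (auto simp: distinct_partitions_def partition_of_def sorted_wrt_rev)
  qed
qed simp

lemma sum_of_bool_eq_card: "finite A \<Longrightarrow> (\<Sum>x\<in>A. of_bool (P x)) = real (card {x\<in>A. P x})"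
  by (simp add: sum_of_bool_eq Int_def)

lemma sum_pairs:
  fixes n :: nat
  shows "(\<Sum>j=1..2*n. f j) = (\<Sum>k=1..n. f (2*k-1) + f (2*k) :: real)"
  by (induction n) (auto simp: add_ac)

text \<open>Among odd parts, the multiplicities at even positions vanish. The columns \<open>2 * k - 1\<close>
  and \<open>2 * k\<close> together then only involve the two multiplicities of \<open>2 * k - 1\<close> and \<open>2 * k + 1\<close>; the
  absence of \<open>2 * k - 1\<close> is expressed by inclusion-exclusion, so that only conditions of the form
  ``contains a given multiset'' occur.\<close>

lemma hooks3_odd_multiset:
  assumes M: "set_mset M \<subseteq> {x. odd x}" and k: "1 \<le> k"
  shows "real (hooks3 (count M) (2*k-1) + hooks3 (count M) (2*k)) =
    of_bool (replicate_mset 3 (2*k-1) \<subseteq># M) + of_bool ({#2*k+1#} \<subseteq># M)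
     - of_bool ({#2*k-1, 2*k+1#} \<subseteq># M) + of_bool (replicate_mset 2 (2*k+1) \<subseteq># M)"
proof -
  have ev: "count M (2*k) = 0" "count M (2*k+2) = 0"
    using M by (auto simp: count_eq_zero_iff)
  have idx: "2*k-1+1 = 2*k" "2*k-1+2 = 2*k+1" using k by auto
  have pair: "{#2*k-1, 2*k+1#} \<subseteq># M \<longleftrightarrow> 1 \<le> count M (2*k-1) \<and> 1 \<le> count M (2*k+1)"
    using k by (auto simp: insert_subset_eq_iff count_eq_zero_iff Suc_le_eq in_diff_count)
  have single: "{#2*k+1#} \<subseteq># M \<longleftrightarrow> 1 \<le> count M (2*k+1)"
    by (simp add: Suc_le_eq)
  show ?thesis
    unfolding hooks3_def idx ev pair single count_le_replicate_mset_subset_eq[symmetric]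
    by (cases "count M (2*k-1)"; cases "count M (2*k+1)") (auto simp: of_bool_def)
qed

lemma a_hooks_3_eq:
  "real (a_hooks 3 n) = (\<Sum>k=1..n.
      real (shifted (6*k-3) (subset_count {1..}) n) + real (shifted (2*k+1) (subset_count {1..}) n)
      - real (shifted (4*k) (subset_count {1..}) n) + real (shifted (4*k+2) (subset_count {1..}) n))"
proof -
  let ?O = "{M. set_mset M \<subseteq> {x. odd x} \<and> \<Sum>\<^sub># M = n}"
  have fin: "finite ?O" by (rule finite_multisets_sum_eq) simp
  have card: "(\<Sum>M\<in>?O. of_bool (K \<subseteq># M)) = real (shifted (\<Sum>\<^sub># K) (subset_count {1..}) n)"
    if "set_mset K \<subseteq> {x. odd x}" for K
  proof -
    have "(\<Sum>M\<in>?O. of_bool (K \<subseteq># M)) = real (card {M\<in>?O. K \<subseteq># M})"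
      by (rule sum_of_bool_eq_card[OF fin])
    also have "{M\<in>?O. K \<subseteq># M} = {M. set_mset M \<subseteq> {x. odd x} \<and> \<Sum>\<^sub># M = n \<and> K \<subseteq># M}"
      by auto
    also have "card \<dots> = shifted (\<Sum>\<^sub># K) (multiset_count {x. odd x}) n"
      by (rule card_multisets_containing[OF that])
    finally show ?thesis by (simp add: shifted_def euler_odd_distinct)
  qed
  have "real (a_hooks 3 n) = (\<Sum>p\<in>odd_partitions n. \<Sum>j=1..2*n. real (hooks3 (count (mset p)) j))"
    unfolding a_hooks_def of_nat_sum
    by (intro sum.cong refl, subst num_hooks_3[of _ n "2*n"]) (auto simp: odd_partitions_def)
  also have "\<dots> = (\<Sum>M\<in>?O. \<Sum>j=1..2*n. real (hooks3 (count M) j))"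
    by (rule sum.reindex_bij_betw[OF bij_betw_mset_odd_partitions])
  also have "\<dots> = (\<Sum>M\<in>?O. \<Sum>k=1..n. of_bool (replicate_mset 3 (2*k-1) \<subseteq># M) + of_bool ({#2*k+1#} \<subseteq># M)
     - of_bool ({#2*k-1, 2*k+1#} \<subseteq># M) + of_bool (replicate_mset 2 (2*k+1) \<subseteq># M))"
    unfolding sum_pairs using hooks3_odd_multiset by (intro sum.cong refl) (auto simp flip: of_nat_add)
  also have "\<dots> = (\<Sum>k=1..n. \<Sum>M\<in>?O. of_bool (replicate_mset 3 (2*k-1) \<subseteq># M) + of_bool ({#2*k+1#} \<subseteq># M)
     - of_bool ({#2*k-1, 2*k+1#} \<subseteq># M) + of_bool (replicate_mset 2 (2*k+1) \<subseteq># M))"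
    by (rule sum.swap)
  also have "\<dots> = (\<Sum>k=1..n.
      real (shifted (6*k-3) (subset_count {1..}) n) + real (shifted (2*k+1) (subset_count {1..}) n)
      - real (shifted (4*k) (subset_count {1..}) n) + real (shifted (4*k+2) (subset_count {1..}) n))"
  proof (rule sum.cong[OF refl])
    fix k assume "k \<in> {1..n}"
    then have k: "odd (2*k-1)" "2*k-1 + (2*k+1) = 4*k" "3*(2*k-1) = 6*k-3" by auto
    show "(\<Sum>M\<in>?O. of_bool (replicate_mset 3 (2*k-1) \<subseteq># M) + of_bool ({#2*k+1#} \<subseteq># M)
     - of_bool ({#2*k-1, 2*k+1#} \<subseteq># M) + of_bool (replicate_mset 2 (2*k+1) \<subseteq># M)) =
      real (shifted (6*k-3) (subset_count {1..}) n) + real (shifted (2*k+1) (subset_count {1..}) n)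
      - real (shifted (4*k) (subset_count {1..}) n) + real (shifted (4*k+2) (subset_count {1..}) n)"
      unfolding sum.distrib sum_subtractf
      using card[of "replicate_mset 3 (2*k-1)"] card[of "{#2*k+1#}"] card[of "{#2*k-1, 2*k+1#}"]
        card[of "replicate_mset 2 (2*k+1)"] k
      by (simp add: sum_mset_replicate_mset)
  qed
  finally show ?thesis .
qed

lemma b_hooks_3_eq:
  "b_hooks 3 n = (\<Sum>j=1..n. shifted (j+2) (subset_count ({1..} - {j,j+1} - {j+2})) n
      + shifted (2*j+1) (subset_count ({1..} - {j,j+1})) n)"
proof -
  let ?D = "{S. finite S \<and> S \<subseteq> {1..} \<and> \<Sum>S = n}"
  have "b_hooks 3 n = (\<Sum>p\<in>distinct_partitions n. \<Sum>j=1..n. hooks3 (\<lambda>s. of_bool (s \<in> set p)) j)"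
    unfolding b_hooks_def
  proof (intro sum.cong refl)
    fix p assume p: "p \<in> distinct_partitions n"
    have "count (mset p) = (\<lambda>s. of_bool (s \<in> set p))"
      using p by (auto simp: distinct_partitions_def distinct_count_atmost_1 fun_eq_iff)
    with p show "num_hooks 3 p = (\<Sum>j=1..n. hooks3 (\<lambda>s. of_bool (s \<in> set p)) j)"
      by (subst num_hooks_3[of _ n n]) (auto simp: distinct_partitions_def)
  qed
  also have "\<dots> = (\<Sum>S\<in>?D. \<Sum>j=1..n. hooks3 (\<lambda>s. of_bool (s \<in> S)) j)"
    by (rule sum.reindex_bij_betw[OF bij_betw_set_distinct_partitions])
  also have "\<dots> = (\<Sum>j=1..n. \<Sum>S\<in>?D. hooks3 (\<lambda>s. of_bool (s \<in> S)) j)"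
    by (rule sum.swap)
  also have "\<dots> = (\<Sum>j=1..n. shifted (j+2) (subset_count ({1..} - {j,j+1} - {j+2})) n
      + shifted (2*j+1) (subset_count ({1..} - {j,j+1})) n)"
  proof (rule sum.cong[OF refl])
    fix j assume j: "j \<in> {1..n}"
    have "(\<Sum>S\<in>?D. hooks3 (\<lambda>s. of_bool (s \<in> S)) j) =
        (\<Sum>S\<in>?D. of_bool (j + 2 \<in> S \<and> j \<notin> S \<and> j + 1 \<notin> S) + of_bool (j \<in> S \<and> j + 1 \<in> S))"
      by (intro sum.cong refl) (auto simp: hooks3_def)
    also have "\<dots> = card {S\<in>?D. j + 2 \<in> S \<and> j \<notin> S \<and> j + 1 \<notin> S} + card {S\<in>?D. j \<in> S \<and> j + 1 \<in> S}"
      using finite_subsets_sum_eq[of "{1..}" n] by (simp add: sum.distrib sum_of_bool_eq Int_def)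
    also have "{S\<in>?D. j + 2 \<in> S \<and> j \<notin> S \<and> j + 1 \<notin> S} =
        {S. finite S \<and> S \<subseteq> {1..} - {j,j+1} \<and> \<Sum>S = n \<and> {j+2} \<subseteq> S}" by auto
    also have "{S\<in>?D. j \<in> S \<and> j + 1 \<in> S} =
        {S. finite S \<and> S \<subseteq> {1..} \<and> \<Sum>S = n \<and> {j, j+1} \<subseteq> S}" by auto
    finally show "(\<Sum>S\<in>?D. hooks3 (\<lambda>s. of_bool (s \<in> S)) j) =
        shifted (j+2) (subset_count ({1..} - {j,j+1} - {j+2})) n
      + shifted (2*j+1) (subset_count ({1..} - {j,j+1})) n"
      using j card_subsets_containing[of "{j+2}" "{1..} - {j,j+1}" n]
        card_subsets_containing[of "{j,j+1}" "{1..}" n]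
      by (simp add: mult_2)
  qed
  finally show ?thesis .
qed

section \<open>The generating function of partitions into distinct parts\<close>

definition gf :: "(nat \<Rightarrow> nat) \<Rightarrow> complex \<Rightarrow> complex" where
  "gf c q = (\<Sum>n. of_nat (c n) * q ^ n)"

lemma sums_shifted:
  fixes q :: "'a :: {real_normed_field}"
  assumes "(\<lambda>n. of_nat (c n) * q ^ n) sums L"
  shows "(\<lambda>n. of_nat (shifted s c n) * q ^ n) sums (q ^ s * L)"
proof -
  have "(\<lambda>n. of_nat (shifted s c (n + s)) * q ^ (n + s)) sums (q ^ s * L)"
    using sums_mult[OF assms, of "q ^ s"] by (simp add: shifted_def power_add mult_ac)
  then show ?thesis
    by (subst (asm) sums_zero_iff_shift) (auto simp: shifted_def)
qed

lemma subset_count_prod_sums: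
  fixes q :: "'a :: {real_normed_field}"
  shows "(\<lambda>n. of_nat (subset_count {1..N} n) * q ^ n) sums (\<Prod>k=1..N. 1 + q ^ k)"
proof (induction N)
  case 0
  have "(\<lambda>n. of_nat (subset_count {1..0} n) * q ^ n) = (\<lambda>n. if n = 0 then 1 else 0)"
    by (auto simp: subset_count_empty)
  then show ?case using sums_single[of 0 "\<lambda>_. 1::'a"] by simp
next
  case (Suc N)
  have A: "{1..Suc N} - {Suc N} = {1..N}" by auto
  have "(\<lambda>n. of_nat (subset_count {1..N} n) * q ^ n + of_nat (shifted (Suc N) (subset_count {1..N}) n) * q ^ n)
      sums ((\<Prod>k=1..N. 1 + q ^ k) + q ^ Suc N * (\<Prod>k=1..N. 1 + q ^ k))"
    by (intro sums_add sums_shifted Suc.IH)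
  also have "(\<lambda>n. of_nat (subset_count {1..N} n) * q ^ n + of_nat (shifted (Suc N) (subset_count {1..N}) n) * q ^ n)
      = (\<lambda>n. of_nat (subset_count {1..Suc N} n) * q ^ n)"
    using subset_count_remove[of "Suc N" "{1..Suc N}"] A by (simp add: algebra_simps)
  finally show ?case by (simp add: algebra_simps)
qed

text \<open>Partial sums are dominated by the finite products, and these are bounded by the exponential
  of a geometric series.\<close>

lemma summable_subset_count_real:
  fixes r :: real
  assumes r: "0 \<le> r" "r < 1"
  shows "summable (\<lambda>n. real (subset_count {1..} n) * r ^ n)"
proof (rule summableI_nonneg_bounded)
  fix N
  have "(\<Sum>n<N. real (subset_count {1..} n) * r ^ n) = (\<Sum>n<N. real (subset_count {1..N} n) * r ^ n)"
    by (intro sum.cong refl) (simp add: subset_count_truncate del: One_nat_def)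
  also have "\<dots> \<le> (\<Prod>k=1..N. 1 + r ^ k)"
    unfolding sums_unique[OF subset_count_prod_sums[of N r]]
    using r by (intro sum_le_suminf sums_summable[OF subset_count_prod_sums[of N r]]) auto
  also have "\<dots> \<le> (\<Prod>k=1..N. exp (r ^ k))"
    using r by (intro prod_mono) (auto intro: add_nonneg_nonneg)
  also have "\<dots> = exp (\<Sum>k=1..N. r ^ k)" by (simp add: exp_sum)
  also have "(\<Sum>k=1..N. r ^ k) \<le> (\<Sum>k. r ^ k)"
    using r by (intro sum_le_suminf) auto
  finally show "(\<Sum>n<N. real (subset_count {1..} n) * r ^ n) \<le> exp (\<Sum>k. r ^ k)" by simp
qed (use r in auto)

lemma summable_norm_subset_count:
  fixes q :: complex
  assumes "norm q < 1" "A \<subseteq> {1..}"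
  shows "summable (\<lambda>n. norm (of_nat (subset_count A n) * q ^ n))"
  using summable_subset_count_real[of "norm q"]
proof (rule summable_comparison_test'[of _ 0])
  show "norm (norm (of_nat (subset_count A n) * q ^ n)) \<le> real (subset_count {1..} n) * norm q ^ n" for n
    using subset_count_mono[OF assms(2), of n] by (simp add: norm_mult norm_power mult_right_mono)
qed (use assms in auto)

lemma gf_subset_count_sums:
  assumes "norm q < 1" "A \<subseteq> {1..}"
  shows "(\<lambda>n. of_nat (subset_count A n) * q ^ n) sums gf (subset_count A) q"
  unfolding gf_def by (rule summable_sums[OF summable_norm_cancel[OF summable_norm_subset_count[OF assms]]])

text \<open>A subset of \<open>A\<close> either avoids \<open>s\<close> or consists of \<open>s\<close> and a subset of \<open>A - {s}\<close>. Read
  backwards, forbidding the part \<open>s\<close> divides the generating function by \<open>1 + q ^ s\<close>.\<close>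

lemma gf_subset_count_remove:
  assumes "norm q < 1" "A \<subseteq> {1..}" "s \<in> A"
  shows "gf (subset_count A) q = (1 + q ^ s) * gf (subset_count (A - {s})) q"
proof -
  have A: "A - {s} \<subseteq> {1..}" using assms by auto
  have "(\<lambda>n. of_nat (subset_count (A - {s}) n) * q ^ n + of_nat (shifted s (subset_count (A - {s})) n) * q ^ n)
      sums (gf (subset_count (A - {s})) q + q ^ s * gf (subset_count (A - {s})) q)"
    by (intro sums_add sums_shifted gf_subset_count_sums assms A)
  also have "(\<lambda>n. of_nat (subset_count (A - {s}) n) * q ^ n + of_nat (shifted s (subset_count (A - {s})) n) * q ^ n)
      = (\<lambda>n. of_nat (subset_count A n) * q ^ n)"
    by (simp add: subset_count_remove[OF assms(3)] algebra_simps)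
  finally show ?thesis
    using sums_unique2[OF gf_subset_count_sums[OF assms(1,2)]] by (simp add: algebra_simps)
qed

abbreviation distinct_gf :: "complex \<Rightarrow> complex" where
  "distinct_gf \<equiv> gf (subset_count {1..})"

lemma prod_tendsto_distinct_gf:
  assumes "norm q < 1"
  shows "(\<lambda>N. \<Prod>k=1..N. 1 + q ^ k) \<longlonglongrightarrow> distinct_gf q"
proof -
  have "(\<lambda>N. \<Sum>n. of_nat (subset_count {1..N} n) * q ^ n) \<longlonglongrightarrow> (\<Sum>n. of_nat (subset_count {1..} n) * q ^ n)"
  proof (rule tannerys_theorem[THEN conjunct2, THEN conjunct2])
    show "(\<lambda>N. of_nat (subset_count {1..N} n) * q ^ n) \<longlonglongrightarrow> of_nat (subset_count {1..} n) * q ^ n" for n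
      by (rule tendsto_eventually, rule eventually_sequentiallyI[of n]) (simp add: subset_count_truncate del: One_nat_def)
    have "norm (of_nat (subset_count {1..N} n) * q ^ n) \<le> real (subset_count {1..} n) * norm q ^ n" for n N
      using subset_count_mono[of "{1..N}" "{1..}" n] by (simp add: norm_mult norm_power mult_right_mono)
    then show "\<forall>\<^sub>F (n, N) in sequentially \<times>\<^sub>F sequentially.
        norm (of_nat (subset_count {1..N} n) * q ^ n) \<le> real (subset_count {1..} n) * norm q ^ n"
      by (intro always_eventually) auto
    show "summable (\<lambda>n. real (subset_count {1..} n) * norm q ^ n)"
      using assms by (intro summable_subset_count_real) auto
  qed simp
  then show ?thesis unfolding gf_def
    using sums_unique[OF subset_count_prod_sums[of _ q]] by simp
qed

text \<open>On the circle of radius \<open>norm w\<close>, the modulus of \<open>1 + w\<close> is largest at the positive real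
  point; the law of cosines makes the loss quantitative.\<close>

lemma norm_one_plus_le:
  fixes w :: complex
  assumes "norm w \<le> 1"
  shows "norm (1 + w) \<le> (1 + norm w) * exp (- (norm w - Re w) / 4)"
proof (rule power2_le_imp_le)
  define d where "d = norm w - Re w"
  have d: "0 \<le> d" using complex_Re_le_cmod[of w] by (simp add: d_def)
  \<comment> \<open>law of cosines\<close>
  have "(norm (1 + w))\<^sup>2 = (1 + norm w)\<^sup>2 - 2 * d"
    unfolding d_def cmod_power2 power2_sum by (simp add: cmod_def power2_eq_square algebra_simps)
  also have "\<dots> \<le> (1 + norm w)\<^sup>2 * (1 - d / 2)"
  proof -
    have "(1 + norm w)\<^sup>2 \<le> 2\<^sup>2" using assms by (intro power_mono) auto
    then have "(1 + norm w)\<^sup>2 * d \<le> 4 * d" using d by (intro mult_right_mono) auto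
    then show ?thesis by (simp add: algebra_simps)
  qed
  also have "\<dots> \<le> (1 + norm w)\<^sup>2 * exp (- d / 2)"
    using exp_ge_add_one_self[of "- d / 2"] by (intro mult_left_mono) auto
  also have "\<dots> = ((1 + norm w) * exp (- d / 4))\<^sup>2"
    by (simp add: power_mult_distrib flip: exp_double)
  finally show "(norm (1 + w))\<^sup>2 \<le> ((1 + norm w) * exp (- (norm w - Re w) / 4))\<^sup>2"
    by (simp add: d_def)
qed simp

lemma geometric_partial_sums_tendsto:
  fixes q :: "'a :: {real_normed_field, banach}"
  assumes "norm q < 1"
  shows "(\<lambda>N. \<Sum>k=1..N. q ^ k) \<longlonglongrightarrow> 1 / (1 - q) - 1"
proof -
  have "(\<lambda>k. q ^ Suc k) sums (1 / (1 - q) - 1)"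
    using geometric_sums[OF assms] by (subst sums_Suc_iff) simp
  then have "(\<lambda>N. \<Sum>k<N. q ^ Suc k) \<longlonglongrightarrow> 1 / (1 - q) - 1" by (simp add: sums_def)
  also have "(\<lambda>N. \<Sum>k<N. q ^ Suc k) = (\<lambda>N. \<Sum>k=1..N. q ^ k)"
    by (intro ext sum.reindex_bij_witness[of _ "\<lambda>k. k - 1" Suc]) auto
  finally show ?thesis .
qed

text \<open>The pointwise bounds for the factors multiply, and the losses add up to the difference of
  two geometric series.\<close>

lemma norm_distinct_gf_le:
  assumes q: "norm q < 1"
  shows "norm (distinct_gf q) \<le> norm (distinct_gf (of_real (norm q))) *
           exp (- (1 / (1 - norm q) - Re (1 / (1 - q))) / 4)"
proof (rule LIMSEQ_le)
  let ?r = "norm q"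
  show "(\<lambda>N. norm (\<Prod>k=1..N. 1 + q ^ k)) \<longlonglongrightarrow> norm (distinct_gf q)"
    by (intro tendsto_norm prod_tendsto_distinct_gf q)
  have "(\<lambda>N. (\<Sum>k=1..N. ?r ^ k) - Re (\<Sum>k=1..N. q ^ k)) \<longlonglongrightarrow> (1 / (1 - ?r) - 1) - Re (1 / (1 - q) - 1)"
    using q by (intro tendsto_diff tendsto_Re geometric_partial_sums_tendsto) auto
  then have "(\<lambda>N. exp (- ((\<Sum>k=1..N. ?r ^ k) - Re (\<Sum>k=1..N. q ^ k)) / 4))
      \<longlonglongrightarrow> exp (- ((1 / (1 - ?r) - 1) - Re (1 / (1 - q) - 1)) / 4)"
    by (intro tendsto_exp tendsto_divide tendsto_minus tendsto_const) auto
  moreover have "(\<lambda>N. norm (\<Prod>k=1..N. 1 + of_real ?r ^ k :: complex)) \<longlonglongrightarrow> norm (distinct_gf (of_real ?r))"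
    using q by (intro tendsto_norm prod_tendsto_distinct_gf) auto
  ultimately show "(\<lambda>N. norm (\<Prod>k=1..N. 1 + of_real ?r ^ k :: complex) *
        exp (- ((\<Sum>k=1..N. ?r ^ k) - Re (\<Sum>k=1..N. q ^ k)) / 4))
      \<longlonglongrightarrow> norm (distinct_gf (of_real ?r)) * exp (- (1 / (1 - ?r) - Re (1 / (1 - q))) / 4)"
    by (auto dest: tendsto_mult simp del: Re_divide)
  have "norm (\<Prod>k=1..N. 1 + q ^ k) \<le> norm (\<Prod>k=1..N. 1 + of_real ?r ^ k :: complex) *
      exp (- ((\<Sum>k=1..N. ?r ^ k) - Re (\<Sum>k=1..N. q ^ k)) / 4)" for N
  proof -
    have "norm (\<Prod>k=1..N. 1 + q ^ k) \<le> (\<Prod>k=1..N. (1 + ?r ^ k) * exp (- (?r ^ k - Re (q ^ k)) / 4))"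
      unfolding prod_norm[symmetric]
      using q norm_one_plus_le[of "q ^ k" for k] by (intro prod_mono) (auto simp: norm_power power_le_one)
    also have "\<dots> = (\<Prod>k=1..N. 1 + ?r ^ k) * exp (\<Sum>k=1..N. - (?r ^ k - Re (q ^ k)) / 4)"
      by (simp add: prod.distrib exp_sum)
    also have "(\<Sum>k=1..N. - (?r ^ k - Re (q ^ k)) / 4) = - ((\<Sum>k=1..N. ?r ^ k) - Re (\<Sum>k=1..N. q ^ k)) / 4"
      by (simp add: sum_subtractf sum_negf Re_sum flip: sum_divide_distrib)
    also have "(\<Prod>k=1..N. 1 + ?r ^ k) = norm (\<Prod>k=1..N. 1 + of_real ?r ^ k :: complex)"
    proof -
      have "(\<Prod>k=1..N. 1 + of_real ?r ^ k :: complex) = of_real (\<Prod>k=1..N. 1 + ?r ^ k)" by simp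
      moreover have "0 \<le> (\<Prod>k=1..N. 1 + ?r ^ k)" by (intro prod_nonneg) auto
      ultimately show ?thesis by (metis abs_of_nonneg norm_of_real)
    qed
    finally show ?thesis .
  qed
  then show "\<exists>N0. \<forall>N\<ge>N0. norm (\<Prod>k=1..N. 1 + q ^ k) \<le> norm (\<Prod>k=1..N. 1 + of_real ?r ^ k :: complex) *
      exp (- ((\<Sum>k=1..N. ?r ^ k) - Re (\<Sum>k=1..N. q ^ k)) / 4)" by blast
qed

text \<open>At angle at least \<open>t\<close> the distance from \<open>1\<close> to the point \<open>q\<close> on the circle exceeds the
  distance \<open>1 - exp (- t)\<close> to the circle by a constant factor, so the exponent of the previous bound
  is of order \<open>1 / t\<close>. This exponentially small factor makes the rest of the circle negligible.\<close>

lemma norm_distinct_gf_away_from_axis: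
  assumes t: "0 < t" "t \<le> 1/2" and \<theta>: "t \<le> \<bar>\<theta>\<bar>" "\<bar>\<theta>\<bar> \<le> pi"
  shows "norm (distinct_gf (exp (- Complex t \<theta>))) \<le> norm (distinct_gf (of_real (exp (- t)))) * exp (- 1 / (36 * t))"
proof -
  let ?q = "exp (- Complex t \<theta>)" and ?r = "exp (- t)"
  have q: "norm ?q = ?r" by simp
  have r: "?r < 1" "1 / 2 \<le> ?r" "1 - ?r \<le> t"
    using t exp_ge_add_one_self[of "- t"] by auto
  have "cos \<theta> \<le> cos t"
    using \<theta> t cos_monotone_0_pi_le[of t "\<bar>\<theta>\<bar>"] by simp
  also have "\<dots> \<le> 1 - 9/32 * t\<^sup>2"
  proof -
    have "cos t = 1 - 2 * (sin (t/2))\<^sup>2" using cos_double_sin[of "t/2"] by simp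
    moreover have "t/2 * (3/4) \<le> sin (t/2)"
    proof -
      obtain x where x: "0 < x" "x < t/2" "sin (t/2) - sin 0 = (t/2 - 0) * cos x"
        using MVT2[of 0 "t/2" sin cos] t by (auto intro: DERIV_sin)
      have "(sin (x/2))\<^sup>2 \<le> (1/8)\<^sup>2"
        using x t sin_x_le_x[of "x/2"] sin_ge_zero[of "x/2"] pi_gt3 by (intro power_mono) auto
      then have "3/4 \<le> cos x"
        using cos_double_sin[of "x/2"] by (simp add: power2_eq_square)
      then have "t/2 * (3/4) \<le> t/2 * cos x" using t by (intro mult_left_mono) auto
      moreover have "sin (t/2) = t/2 * cos x" using x(3) by simp
      ultimately show ?thesis by (simp only:)
    qed
    then have "(t/2 * (3/4))\<^sup>2 \<le> (sin (t/2))\<^sup>2" using t by (intro power_mono) auto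
    ultimately show ?thesis by (simp add: power2_eq_square algebra_simps)
  qed
  finally have cos: "9/32 * t\<^sup>2 \<le> 1 - cos \<theta>" by simp
  \<comment> \<open>\<open>(9/8)\<^sup>2 = 81/64\<close> is just below \<open>1 + 9/32 = 82/64\<close>\<close>
  have "(9/8 * (1 - ?r))\<^sup>2 \<le> (1 - ?r)\<^sup>2 + 9/32 * (1 - ?r)\<^sup>2"
    using zero_le_power2[of "1 - ?r"] unfolding power_mult_distrib by (simp add: power2_eq_square[of "9/8"])
  also have "\<dots> \<le> (1 - ?r)\<^sup>2 + 9/32 * t\<^sup>2"
    using r by (intro add_left_mono mult_left_mono power_mono) auto
  also have "\<dots> \<le> (1 - ?r)\<^sup>2 + (2 * ?r) * (1 - cos \<theta>)"
  proof -
    have "1 * (1 - cos \<theta>) \<le> (2 * ?r) * (1 - cos \<theta>)" using r by (intro mult_right_mono) auto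
    with cos have "9/32 * t\<^sup>2 \<le> (2 * ?r) * (1 - cos \<theta>)" unfolding mult_1 by (rule order_trans)
    then show ?thesis by (rule add_left_mono)
  qed
  also have "\<dots> = (norm (1 - ?q))\<^sup>2"
  proof -
    have "Re ?q = ?r * cos \<theta>" "Im ?q = - (?r * sin \<theta>)" by (simp_all add: Re_exp Im_exp)
    moreover have "(?r * sin \<theta>)\<^sup>2 = ?r\<^sup>2 - (?r * cos \<theta>)\<^sup>2"
      by (simp add: power_mult_distrib sin_squared_eq algebra_simps)
    ultimately show ?thesis unfolding cmod_power2 by (simp add: power2_eq_square algebra_simps)
  qed
  finally have "(9/8 * (1 - ?r))\<^sup>2 \<le> (norm (1 - ?q))\<^sup>2" .
  then have le: "9/8 * (1 - ?r) \<le> norm (1 - ?q)" by (rule power2_le_imp_le) simp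
  have "Re (1 / (1 - ?q)) \<le> norm (1 / (1 - ?q))" by (rule complex_Re_le_cmod)
  also have "\<dots> \<le> 1 / (9/8 * (1 - ?r))"
    unfolding norm_divide norm_one using le r by (intro divide_left_mono mult_pos_pos) auto
  finally have "1 / (1 - ?r) - Re (1 / (1 - ?q)) \<ge> 1 / (1 - ?r) - 1 / (9/8 * (1 - ?r))" by linarith
  also have "1 / (1 - ?r) - 1 / (9/8 * (1 - ?r)) = 1 / (9 * (1 - ?r))"
    using r by (simp add: field_simps)
  also have "1 / (9 * (1 - ?r)) \<ge> 1 / (9 * t)"
    using r t by (intro divide_left_mono mult_pos_pos) auto
  finally have "- (1 / (1 - ?r) - Re (1 / (1 - ?q))) / 4 \<le> - 1 / (36 * t)"
    by simp
  then show ?thesis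
    using norm_distinct_gf_le[of ?q] r q by (intro order_trans[OF norm_distinct_gf_le[of ?q]])
       (auto intro!: mult_left_mono simp del: Re_divide)
qed

section \<open>The generating function near the singularity at one\<close>

lemma alternating_inverse_squares_sums: "(\<lambda>n. (-1) ^ n / (real n)\<^sup>2) sums (- (pi\<^sup>2 / 12))"
proof -
  have "(\<lambda>n. 1 / (real (Suc n))\<^sup>2) sums (pi\<^sup>2 / 6 - 1 / (real 0)\<^sup>2)"
    using inverse_squares_sums by (simp add: add.commute)
  then have S: "(\<lambda>n. 1 / (real n)\<^sup>2) sums (pi\<^sup>2 / 6)"
    by (subst (asm) sums_Suc_iff) simp
  have "(\<lambda>n. (1/2) * (1 / (real n)\<^sup>2)) sums ((1/2) * (pi\<^sup>2 / 6))" by (rule sums_mult[OF S])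
  also have "(\<lambda>n. (1/2) * (1 / (real n)\<^sup>2)) = (\<lambda>n. (1 + (-1) ^ (2 * n)) / (real (2 * n))\<^sup>2)"
    by (auto simp: fun_eq_iff power2_eq_square)
  finally have "(\<lambda>n. (1 + (-1) ^ n) / (real n)\<^sup>2) sums ((1/2) * (pi\<^sup>2 / 6))"
  proof (subst (asm) sums_mono_reindex)
    show "strict_mono ((*) (2::nat))" by (auto simp: strict_mono_def)
    show "(1 + (-1) ^ n) / (real n)\<^sup>2 = 0" if "n \<notin> range ((*) 2)" for n
    proof -
      have "odd n" using that by (auto elim!: evenE)
      then show ?thesis by simp
    qed
  qed
  from sums_diff[OF this S] show ?thesis by (simp add: add_divide_distrib)
qed

definition dilog_coeff :: "nat \<Rightarrow> complex" where
  "dilog_coeff n = (-1) ^ n / (of_nat n)\<^sup>2"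

text \<open>This is the dilogarithm at \<open>- exp (- y)\<close>, a primitive of \<open>ln (1 + exp (- y))\<close> on the right
  half-plane that vanishes at infinity and stays continuous at \<open>0\<close>.\<close>

definition dilog_exp :: "complex \<Rightarrow> complex" where
  "dilog_exp y = (\<Sum>n. dilog_coeff n * exp (- y) ^ n)"

lemma summable_inverse_squares: "summable (\<lambda>n. 1 / (real n)\<^sup>2)"
  using inverse_squares_sums by (subst summable_Suc_iff[symmetric]) (auto simp: sums_iff add.commute)

lemma norm_dilog_coeff: "norm (dilog_coeff n) = 1 / (real n)\<^sup>2"
  by (simp add: dilog_coeff_def norm_divide norm_power)

lemma summable_dilog:
  assumes "norm w \<le> 1"
  shows "summable (\<lambda>n. dilog_coeff n * w ^ n)"
proof (rule summable_comparison_test'[OF summable_inverse_squares])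
  show "norm (dilog_coeff n * w ^ n) \<le> 1 / (real n)\<^sup>2" for n
    using assms by (simp add: norm_mult norm_dilog_coeff norm_power divide_right_mono power_le_one)
qed

lemma dilog_exp_0: "dilog_exp 0 = - complex_of_real (pi\<^sup>2 / 12)"
proof -
  have "(\<lambda>n. complex_of_real ((-1) ^ n / (real n)\<^sup>2)) sums complex_of_real (- (pi\<^sup>2 / 12))"
    using alternating_inverse_squares_sums by (subst sums_of_real_iff)
  then show ?thesis by (simp add: dilog_exp_def dilog_coeff_def sums_iff)
qed

lemma has_field_derivative_dilog_exp:
  assumes "0 < Re y"
  shows "(dilog_exp has_field_derivative ln (1 + exp (- y))) (at y)"
proof -
  define w where "w = exp (- y)"
  have w: "norm w < 1" "w \<noteq> 0" using assms by (simp_all add: w_def)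
  have diffs: "(\<lambda>n. of_nat n * dilog_coeff n * w ^ (n - Suc 0)) sums (\<Sum>n. diffs dilog_coeff n * w ^ n)"
    using w by (intro diffs_equiv termdiff_converges[of _ 1] summable_dilog) auto
  have "(\<lambda>n. - w * (of_nat n * dilog_coeff n * w ^ (n - Suc 0))) sums (- w * (\<Sum>n. diffs dilog_coeff n * w ^ n))"
    by (intro sums_mult diffs)
  also have "(\<lambda>n. - w * (of_nat n * dilog_coeff n * w ^ (n - Suc 0))) = (\<lambda>n. (-1) ^ Suc n / of_nat n * w ^ n)"
  proof
    fix n show "- w * (of_nat n * dilog_coeff n * w ^ (n - Suc 0)) = (-1) ^ Suc n / of_nat n * w ^ n"
    proof (cases n)
      case (Suc m)
      have "of_nat n * dilog_coeff n = (-1) ^ n / of_nat n"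
        using Suc by (simp add: dilog_coeff_def power2_eq_square del: of_nat_Suc)
      then show ?thesis using Suc by simp
    qed (simp add: dilog_coeff_def)
  qed
  finally have ln: "- w * (\<Sum>n. diffs dilog_coeff n * w ^ n) = ln (1 + w)"
    using Ln_series[OF w(1)] sums_unique2 by blast
  have "((\<lambda>x. \<Sum>n. dilog_coeff n * x ^ n) has_field_derivative (\<Sum>n. diffs dilog_coeff n * w ^ n)) (at w)"
    using w by (intro termdiffs_strong[of _ 1] summable_dilog) auto
  moreover have "((\<lambda>y. exp (- y)) has_field_derivative (- w)) (at y)"
    unfolding w_def by (auto intro!: derivative_eq_intros)
  ultimately have "((\<lambda>y. \<Sum>n. dilog_coeff n * exp (- y) ^ n) has_field_derivative
      (\<Sum>n. diffs dilog_coeff n * w ^ n) * (- w)) (at y)"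
    unfolding w_def by (rule DERIV_chain2)
  then show ?thesis using ln by (simp add: dilog_exp_def[abs_def] w_def mult.commute)
qed

text \<open>The series converges uniformly on the closed half-plane, where the radius of convergence alone
  would say nothing about the boundary point \<open>0\<close>.\<close>

lemma dilog_exp_tendsto_0:
  assumes "\<And>k. Re (y k) \<ge> 0" "y \<longlonglongrightarrow> 0"
  shows "(\<lambda>k. dilog_exp (y k)) \<longlonglongrightarrow> dilog_exp 0"
  unfolding dilog_exp_def
proof (rule tannerys_theorem[THEN conjunct2, THEN conjunct2])
  show "(\<lambda>k. dilog_coeff n * exp (- y k) ^ n) \<longlonglongrightarrow> dilog_coeff n * exp (- 0) ^ n" for n
    by (intro tendsto_intros assms)
  have "norm (dilog_coeff n * exp (- y k) ^ n) \<le> 1 / (real n)\<^sup>2" for n k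
    using assms(1)[of k]
    by (simp add: norm_mult norm_dilog_coeff norm_power divide_right_mono power_le_one)
  then show "\<forall>\<^sub>F (n, k) in sequentially \<times>\<^sub>F sequentially.
      norm (dilog_coeff n * exp (- y k) ^ n) \<le> 1 / (real n)\<^sup>2"
    by (intro always_eventually) auto
qed (auto intro: summable_inverse_squares)

lemma dilog_exp_tendsto_at_infinity:
  assumes "0 < Re z"
  shows "(\<lambda>N. dilog_exp (of_nat N * z)) \<longlonglongrightarrow> 0"
proof -
  have "isCont (\<lambda>x. \<Sum>n. dilog_coeff n * x ^ n) 0"
    by (intro isCont_powser[of _ 1] summable_dilog) auto
  moreover have "(\<lambda>N. exp (- z) ^ N) \<longlonglongrightarrow> 0"
    using assms by (intro LIMSEQ_power_zero) auto
  ultimately have "(\<lambda>N. \<Sum>n. dilog_coeff n * (exp (- z) ^ N) ^ n) \<longlonglongrightarrow> (\<Sum>n. dilog_coeff n * 0 ^ n)"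
    by (rule isCont_tendsto_compose)
  also have "(\<lambda>n. dilog_coeff n * 0 ^ n) = (\<lambda>n. 0)"
  proof
    fix n show "dilog_coeff n * 0 ^ n = 0" by (cases n) (auto simp: dilog_coeff_def)
  qed
  finally show ?thesis by (simp add: dilog_exp_def flip: exp_of_nat_mult)
qed

text \<open>In this sector \<open>norm z\<close> is comparable to \<open>Re z\<close>, and \<open>exp (- z)\<close> keeps away from \<open>- 1\<close>.\<close>

definition wedge :: "complex set" where
  "wedge = {y. 0 < Re y \<and> \<bar>Im y\<bar> \<le> Re y}"

lemma convex_wedge: "convex wedge"
proof (rule convexI)
  fix x y :: complex and u v :: real
  assume xy: "x \<in> wedge" "y \<in> wedge" and uv: "0 \<le> u" "0 \<le> v" "u + v = 1"
  have "0 < u * Re x + v * Re y"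
  proof (cases "u = 0")
    case False
    then have "0 < u * Re x" "0 \<le> v * Re y" using xy uv by (auto simp: wedge_def)
    then show ?thesis by linarith
  qed (use xy uv in \<open>auto simp: wedge_def\<close>)
  moreover have "u * \<bar>Im x\<bar> \<le> u * Re x" "v * \<bar>Im y\<bar> \<le> v * Re y"
    using xy uv by (auto simp: wedge_def intro!: mult_left_mono)
  then have "\<bar>u * Im x + v * Im y\<bar> \<le> u * Re x + v * Re y"
    using uv abs_triangle_ineq[of "u * Im x" "v * Im y"] by (simp add: abs_mult)
  ultimately show "u *\<^sub>R x + v *\<^sub>R y \<in> wedge" by (simp add: wedge_def)
qed

text \<open>Either the argument of \<open>exp (- y)\<close> is at most a right angle, or the wedge condition makes
  \<open>exp (- y)\<close> small.\<close>

lemma norm_one_plus_exp_ge: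
  assumes "0 \<le> Re y" "\<bar>Im y\<bar> \<le> Re y"
  shows "1/2 \<le> norm (1 + exp (- y))"
proof (cases "\<bar>Im y\<bar> \<le> pi / 2")
  case True
  then have "0 \<le> cos (Im y)" by (intro cos_ge_zero) auto
  then have "1 \<le> Re (1 + exp (- y))" by (simp add: Re_exp)
  also have "\<dots> \<le> norm (1 + exp (- y))" by (rule complex_Re_le_cmod)
  finally show ?thesis by simp
next
  case False
  then have "1 \<le> Re y" using assms pi_gt3 by simp
  then have "exp (- Re y) \<le> exp (- 1)" by simp
  also have "\<dots> \<le> 1/2" using exp_ge_add_one_self[of 1] by (simp add: exp_minus field_simps)
  finally have "norm (exp (- y)) \<le> 1/2" by simp
  moreover have "norm (1 :: complex) - norm (exp (- y)) \<le> norm (1 + exp (- y))" by (rule norm_diff_ineq)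
  ultimately show ?thesis by simp
qed

text \<open>The error of the trapezoidal rule is of third order in the step length, with a factor that is
  the second derivative of the integrand \<open>ln (1 + exp (- y))\<close>. It decays exponentially in \<open>Re a\<close>,
  so that the errors of infinitely many steps can be summed.\<close>

lemma trapezoid_dilog_exp:
  assumes a: "a \<in> wedge" and b: "b \<in> wedge" and ab: "Re a \<le> Re b"
  shows "norm (dilog_exp b - dilog_exp a - (ln (1 + exp (- a)) + ln (1 + exp (- b))) * (b - a) / 2)
    \<le> 4 * exp (- Re a) * norm (b - a) ^ 3"
proof -
  \<comment> \<open>the primitive, the integrand, and the first two derivatives of the integrand\<close>
  define f :: "nat \<Rightarrow> complex \<Rightarrow> complex" where "f = (\<lambda>i. case i of 0 \<Rightarrow> dilog_exp
     | Suc 0 \<Rightarrow> (\<lambda>y. ln (1 + exp (- y))) | Suc (Suc 0) \<Rightarrow> (\<lambda>y. - exp (- y) / (1 + exp (- y)))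
     | _ \<Rightarrow> (\<lambda>y. exp (- y) / (1 + exp (- y))\<^sup>2))"
  let ?S = "closed_segment a b"
  let ?B = "4 * exp (- Re a)"
  let ?h = "b - a"
  have wedge: "y \<in> wedge" "Re a \<le> Re y" if "y \<in> ?S" for y
  proof -
    show "y \<in> wedge" using closed_segment_subset[OF a b convex_wedge] that by blast
    have "?S \<subseteq> {y. Re a \<le> Re y}"
      using ab by (intro closed_segment_subset convex_halfspace_Re_ge) auto
    then show "Re a \<le> Re y" using that by blast
  qed
  have ne: "1 + exp (- y) \<noteq> 0" "1/2 \<le> norm (1 + exp (- y))" if "y \<in> ?S" for y
  proof -
    show "1/2 \<le> norm (1 + exp (- y))"
      using wedge(1)[OF that] by (intro norm_one_plus_exp_ge) (auto simp: wedge_def)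
    then show "1 + exp (- y) \<noteq> 0" by auto
  qed
  have D: "(f i has_field_derivative f (Suc i) y) (at y within ?S)" if "y \<in> ?S" "i \<le> 2" for i y
  proof -
    have y: "0 < Re y" using wedge(1)[OF that(1)] by (simp add: wedge_def)
    have nonpos: "1 + exp (- y) \<notin> \<real>\<^sub>\<le>\<^sub>0"
    proof -
      have "norm (exp (- y)) < 1" using y by simp
      then have "0 < Re (1 + exp (- y))" using abs_Re_le_cmod[of "exp (- y)"]
        by (simp only: plus_complex.sel one_complex.sel)
      then show ?thesis by (auto simp: complex_nonpos_Reals_iff)
    qed
    have "(f i has_field_derivative f (Suc i) y) (at y)"
    proof -
      consider "i = 0" | "i = 1" | "i = 2" using \<open>i \<le> 2\<close> by linarith
      then show ?thesis
      proof cases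
        case 1
        then show ?thesis using has_field_derivative_dilog_exp[OF y] by (simp add: f_def)
      next
        case 2
        have "((\<lambda>y. ln (1 + exp (- y))) has_field_derivative (- exp (- y) / (1 + exp (- y)))) (at y)"
          using nonpos by (auto intro!: derivative_eq_intros simp: field_simps)
        then show ?thesis using 2 by (simp add: f_def)
      next
        case 3
        have "((\<lambda>y. - exp (- y) / (1 + exp (- y))) has_field_derivative
            ((exp (- y) * (1 + exp (- y)) - (- exp (- y)) * (- exp (- y))) / ((1 + exp (- y)) * (1 + exp (- y))))) (at y)"
          using ne(1)[OF that(1)]
          by (auto intro!: derivative_eq_intros simp: minus_divide_left simp del: divide_minus_left)
        also have "(exp (- y) * (1 + exp (- y)) - (- exp (- y)) * (- exp (- y))) / ((1 + exp (- y)) * (1 + exp (- y)))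
            = exp (- y) / (1 + exp (- y))\<^sup>2"
          by (simp add: power2_eq_square algebra_simps)
        finally show ?thesis using 3 by (simp add: f_def numeral_2_eq_2)
      qed
    qed
    then show ?thesis by (rule has_field_derivative_at_within)
  qed
  have B: "norm (f 3 y) \<le> ?B" if "y \<in> ?S" for y
  proof -
    have "norm (f 3 y) = exp (- Re y) / (norm (1 + exp (- y)))\<^sup>2"
      by (simp add: f_def numeral_3_eq_3 norm_divide norm_power)
    also have "\<dots> \<le> exp (- Re a) / (1/2)\<^sup>2"
      using wedge(2)[OF that] ne[OF that] by (intro frac_le power_mono) auto
    finally show ?thesis by (simp add: power2_eq_square)
  qed
  have ends: "a \<in> ?S" "b \<in> ?S" by auto
  have 1: "norm (f 0 b - (\<Sum>i\<le>2. f i a * ?h ^ i / fact i)) \<le> ?B * norm ?h ^ Suc 2 / fact 2"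
    by (rule complex_Taylor[of ?S]) (use D B ends in \<open>auto simp: numeral_3_eq_3 numeral_2_eq_2\<close>)
  have 2: "norm (f (Suc 0) b - (\<Sum>i\<le>1. f (Suc i) a * ?h ^ i / fact i)) \<le> ?B * norm ?h ^ Suc 1 / fact 1"
    by (rule complex_Taylor[of ?S 1 "\<lambda>i. f (Suc i)"])
       (use D B ends in \<open>auto simp: numeral_3_eq_3 numeral_2_eq_2\<close>)
  \<comment> \<open>Taylor remainders at \<open>a\<close> of the primitive and of the integrand; the trapezoidal rule cancels all terms in between\<close>
  define X where "X = f 0 b - (\<Sum>i\<le>2. f i a * ?h ^ i / fact i)"
  define Y where "Y = f 1 b - (\<Sum>i\<le>1. f (Suc i) a * ?h ^ i / fact i)"
  have XY: "dilog_exp b - dilog_exp a - (ln (1 + exp (- a)) + ln (1 + exp (- b))) * ?h / 2 = X - Y * ?h / 2"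
  proof -
    have X: "X = f 0 b - (f 0 a + f 1 a * ?h + f 2 a * ?h\<^sup>2 / 2)"
      by (simp add: X_def numeral_2_eq_2)
    have Y: "Y = f 1 b - (f 1 a + f 2 a * ?h)"
      by (simp add: Y_def numeral_2_eq_2)
    have f01: "f 0 = dilog_exp" "f 1 = (\<lambda>y. ln (1 + exp (- y)))" by (simp_all add: f_def)
    show ?thesis unfolding X Y f01 by (simp add: field_simps power2_eq_square)
  qed
  have "norm (X - Y * ?h / 2) \<le> norm X + norm (Y * ?h / 2)" by (rule norm_triangle_ineq4)
  also have "norm (Y * ?h / 2) = norm Y * norm ?h / 2" by (simp add: norm_mult norm_divide)
  also have "norm X + norm Y * norm ?h / 2 \<le> ?B * norm ?h ^ 3 / 2 + (?B * norm ?h ^ 2) * norm ?h / 2"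
    using 1 2 unfolding X_def[symmetric] One_nat_def[symmetric] Y_def[symmetric]
    by (intro add_mono divide_right_mono mult_right_mono) (auto simp: numeral_3_eq_3 numeral_2_eq_2)
  also have "\<dots> = ?B * norm ?h ^ 3" by (simp add: power3_eq_cube power2_eq_square)
  finally show ?thesis unfolding XY .
qed

text \<open>The primitive is not known to be differentiable at \<open>0\<close>, so the first step of the rule is a
  limit of steps that start inside the wedge.\<close>

lemma trapezoid_dilog_exp_0:
  assumes z: "z \<in> wedge"
  shows "norm (dilog_exp z - dilog_exp 0 - (ln 2 + ln (1 + exp (- z))) * z / 2) \<le> 4 * norm z ^ 3"
proof (rule LIMSEQ_le)
  define a where "a = (\<lambda>m. z * of_real (inverse (real (Suc m))))"
  have Re: "Re (a m) = Re z * inverse (real (Suc m))" and Im: "Im (a m) = Im z * inverse (real (Suc m))" for m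
    by (simp_all only: a_def times_complex.sel Re_complex_of_real Im_complex_of_real
        mult_zero_right diff_zero add_0_left)
  have a_wedge: "a m \<in> wedge" for m
    using z unfolding wedge_def mem_Collect_eq Re Im by (simp add: abs_mult)
  have a_le: "Re (a m) \<le> Re z" for m
    using z unfolding Re wedge_def by (intro mult_left_le) (auto simp: inverse_le_1_iff)
  have "(\<lambda>m. z * of_real (inverse (real (Suc m)))) \<longlonglongrightarrow> z * of_real 0"
    by (intro tendsto_intros LIMSEQ_inverse_real_of_nat)
  then have lim: "a \<longlonglongrightarrow> 0" by (simp add: a_def)
  have nonpos: "1 + exp (- 0 :: complex) \<notin> \<real>\<^sub>\<le>\<^sub>0" by (simp add: complex_nonpos_Reals_iff)
  have "(\<lambda>m. norm (dilog_exp z - dilog_exp (a m) - (ln (1 + exp (- a m)) + ln (1 + exp (- z))) * (z - a m) / 2))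
      \<longlonglongrightarrow> norm (dilog_exp z - dilog_exp 0 - (ln (1 + exp (- 0)) + ln (1 + exp (- z))) * (z - 0) / 2)"
    by (intro tendsto_intros tendsto_Ln[OF _ nonpos] dilog_exp_tendsto_0 lim)
       (use a_wedge in \<open>auto simp: wedge_def intro: less_imp_le\<close>)
  then show "(\<lambda>m. norm (dilog_exp z - dilog_exp (a m) - (ln (1 + exp (- a m)) + ln (1 + exp (- z))) * (z - a m) / 2))
      \<longlonglongrightarrow> norm (dilog_exp z - dilog_exp 0 - (ln 2 + ln (1 + exp (- z))) * z / 2)" by simp
  have "(\<lambda>m. 4 * exp (- Re (a m)) * norm (z - a m) ^ 3) \<longlonglongrightarrow> 4 * exp (- Re 0) * norm (z - 0) ^ 3"
    by (intro tendsto_intros lim)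
  then show "(\<lambda>m. 4 * exp (- Re (a m)) * norm (z - a m) ^ 3) \<longlonglongrightarrow> 4 * norm z ^ 3" by simp
  show "\<exists>N. \<forall>m\<ge>N. norm (dilog_exp z - dilog_exp (a m) - (ln (1 + exp (- a m)) + ln (1 + exp (- z))) * (z - a m) / 2)
      \<le> 4 * exp (- Re (a m)) * norm (z - a m) ^ 3"
    using trapezoid_dilog_exp[OF a_wedge z a_le] by blast
qed

lemma one_minus_exp_ge:
  fixes t :: real
  assumes "0 \<le> t" "t \<le> 1"
  shows "t / 2 \<le> 1 - exp (- t)"
proof -
  have "exp (- t) \<le> 1 / (1 + t)"
    using exp_ge_add_one_self[of t] assms by (simp add: exp_minus field_simps)
  also have "\<dots> \<le> 1 - t / 2"
  proof -
    have "t * t \<le> t * 1" using assms by (intro mult_left_mono) auto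
    then show ?thesis using assms by (simp add: field_simps)
  qed
  finally show ?thesis by simp
qed

text \<open>The logarithm of the product is the sum of \<open>ln (1 + exp (- k * z))\<close> over \<open>k\<close>, and the
  trapezoidal rule with step \<open>z\<close> compares it with the integral from \<open>0\<close> to infinity divided by \<open>z\<close>.
  The integral is \<open>pi\<^sup>2 / 12\<close>, half of the value \<open>ln 2\<close> at \<open>0\<close> is the boundary term, and the errors
  add up to order \<open>(norm z)\<^sup>2 / Re z\<close>, which is of order \<open>Re z\<close> inside the wedge.\<close>

theorem distinct_gf_asymptotics:
  assumes z: "z \<in> wedge" and Re1: "Re z \<le> 1"
  obtains E where "norm E \<le> 16 * Re z"
    "distinct_gf (exp (- z)) = exp (complex_of_real (pi\<^sup>2 / 12) / z - ln 2 / 2 + E)"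
proof -
  let ?t = "Re z"
  have t: "0 < ?t" "\<bar>Im z\<bar> \<le> ?t" using z by (auto simp: wedge_def)
  have z0: "z \<noteq> 0" using t by auto
  have normz: "(norm z)\<^sup>2 \<le> 2 * ?t\<^sup>2"
    using t abs_le_square_iff[of "Im z" ?t] unfolding cmod_power2 by simp
  define f where "f = (\<lambda>k. ln (1 + exp (- (of_nat k * z))))"
  define F where "F = (\<lambda>k. dilog_exp (of_nat k * z))"
  define e where "e = (\<lambda>k. (F (Suc k) - F k) / z - (f k + f (Suc k)) / 2)"
  have e: "norm (e k) \<le> 4 * (norm z)\<^sup>2 * exp (- ?t) ^ k" for k
  proof -
    have *: "norm (F (Suc k) - F k - (f k + f (Suc k)) * z / 2) \<le> 4 * exp (- ?t) ^ k * norm z ^ 3"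
    proof (cases "k = 0")
      case True
      then show ?thesis using trapezoid_dilog_exp_0[OF z] by (simp add: F_def f_def)
    next
      case False
      have wedge: "of_nat m * z \<in> wedge" if "m \<noteq> 0" for m
        using that t by (auto simp: wedge_def abs_mult mult_left_mono)
      have diff: "of_nat (Suc k) * z - of_nat k * z = z" by (simp add: algebra_simps)
      have mono: "Re (of_nat k * z) \<le> Re (of_nat (Suc k) * z)" using t by (simp add: mult_right_mono)
      have exp: "exp (- Re (of_nat k * z)) = exp (- ?t) ^ k" by (simp flip: exp_of_nat_mult)
      show ?thesis
        using trapezoid_dilog_exp[OF wedge[OF False] wedge[OF Suc_not_Zero] mono]
        by (simp only: F_def f_def diff exp)
    qed
    have "e k = (F (Suc k) - F k - (f k + f (Suc k)) * z / 2) / z"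
      using z0 by (simp add: e_def field_simps)
    then have "norm (e k) = norm (F (Suc k) - F k - (f k + f (Suc k)) * z / 2) / norm z"
      by (simp add: norm_divide)
    also have "\<dots> \<le> 4 * exp (- ?t) ^ k * norm z ^ 3 / norm z"
      by (intro divide_right_mono *) auto
    also have "\<dots> = 4 * (norm z)\<^sup>2 * exp (- ?t) ^ k"
      using z0 by (simp add: power3_eq_cube power2_eq_square)
    finally show ?thesis .
  qed
  have geo: "(\<lambda>k. 4 * (norm z)\<^sup>2 * exp (- ?t) ^ k) sums (4 * (norm z)\<^sup>2 * (1 / (1 - exp (- ?t))))"
    using t by (intro sums_mult geometric_sums) auto
  have sum_e: "summable e"
    by (rule summable_comparison_test'[OF sums_summable[OF geo] e])
  have "norm (\<Sum>k. e k) \<le> 4 * (norm z)\<^sup>2 * (1 / (1 - exp (- ?t)))"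
    using norm_suminf_le[of e, OF e sums_summable[OF geo]] sums_unique[OF geo] by simp
  also have "\<dots> \<le> 4 * (2 * ?t\<^sup>2) * (1 / (?t / 2))"
    using normz one_minus_exp_ge[of ?t] t Re1
    by (intro mult_mono divide_left_mono mult_left_mono mult_pos_pos) auto
  also have "\<dots> = 16 * ?t" using t by (simp add: power2_eq_square)
  finally have E: "norm (- (\<Sum>k. e k)) \<le> 16 * ?t" by simp
  \<comment> \<open>the integral terms telescope, and the trapezoidal weights count the two ends by one half\<close>
  have partial: "(\<Sum>k=1..N. f k) = (F N - F 0) / z - f 0 / 2 + f N / 2 - (\<Sum>k<N. e k)" for N
  proof (induction N)
    case (Suc N)
    define g where "g = (\<lambda>k. f k / 2)"
    have f: "f k = g k + g k" for k by (simp add: g_def)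
    have e': "e k = F (Suc k) / z - F k / z - (g k + g (Suc k))" for k
      by (simp add: e_def g_def diff_divide_distrib add_divide_distrib)
    show ?case
      using Suc.IH unfolding g_def[symmetric, THEN fun_cong]
      by (simp add: f e' diff_divide_distrib algebra_simps)
  qed simp
  have F_lim: "F \<longlonglongrightarrow> 0" unfolding F_def by (rule dilog_exp_tendsto_at_infinity[OF t(1)])
  have f_lim: "f \<longlonglongrightarrow> 0"
  proof -
    have "(\<lambda>N. exp (- z) ^ N) \<longlonglongrightarrow> 0" using t by (intro LIMSEQ_power_zero) auto
    then have "(\<lambda>N. ln (1 + exp (- z) ^ N)) \<longlonglongrightarrow> ln (1 + 0)"
      by (intro tendsto_Ln tendsto_add tendsto_const) (auto simp: complex_nonpos_Reals_iff)
    then show ?thesis by (simp add: f_def flip: exp_of_nat_mult)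
  qed
  have "(\<lambda>N. \<Sum>k=1..N. f k) \<longlonglongrightarrow> (0 - F 0) / z - f 0 / 2 + 0 / 2 - (\<Sum>k. e k)"
    unfolding partial by (intro tendsto_intros F_lim f_lim z0 summable_LIMSEQ sum_e) auto
  then have "(\<lambda>N. exp (\<Sum>k=1..N. f k)) \<longlonglongrightarrow> exp ((0 - F 0) / z - f 0 / 2 + 0 / 2 - (\<Sum>k. e k))"
    by (rule tendsto_exp)
  moreover have "exp (\<Sum>k=1..N. f k) = (\<Prod>k=1..N. 1 + exp (- z) ^ k)" for N
    unfolding exp_sum[OF finite_atLeastAtMost]
  proof (rule prod.cong[OF refl])
    fix k assume "k \<in> {1..N}"
    then have "norm (exp (- z) ^ k) < 1" using t by (auto simp: norm_power power_less_one_iff)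
    then have "1 + exp (- z) ^ k \<noteq> 0"
      by (metis add_eq_0_iff norm_minus_cancel norm_one order_less_irrefl)
    then show "exp (f k) = 1 + exp (- z) ^ k" by (simp add: f_def flip: exp_of_nat_mult)
  qed
  ultimately have "(\<lambda>N. \<Prod>k=1..N. 1 + exp (- z) ^ k) \<longlonglongrightarrow> exp ((0 - F 0) / z - f 0 / 2 + 0 / 2 - (\<Sum>k. e k))"
    by simp
  moreover have "(\<lambda>N. \<Prod>k=1..N. 1 + exp (- z) ^ k) \<longlonglongrightarrow> distinct_gf (exp (- z))"
    using t by (intro prod_tendsto_distinct_gf) auto
  ultimately have "distinct_gf (exp (- z)) = exp ((0 - F 0) / z - f 0 / 2 + 0 / 2 - (\<Sum>k. e k))"
    using LIMSEQ_unique by blast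
  also have "(0 - F 0) / z - f 0 / 2 + 0 / 2 - (\<Sum>k. e k) =
      complex_of_real (pi\<^sup>2 / 12) / z - ln 2 / 2 + (- (\<Sum>k. e k))"
    by (simp add: F_def f_def dilog_exp_0)
  finally show ?thesis using that E by blast
qed

section \<open>Coefficient extraction and the Gaussian integral\<close>

lemma integral_exp_int:
  fixes k :: int
  shows "(\<integral>\<theta>. indicator {-pi..pi} \<theta> *\<^sub>R exp (\<i> * of_int k * of_real \<theta>) \<partial>lborel) = (if k = 0 then 2 * pi else 0)"
proof (cases "k = 0")
  case False
  have "(\<integral>\<theta>. indicator {-pi..pi} \<theta> *\<^sub>R exp (\<i> * of_int k * of_real \<theta>) \<partial>lborel)
      = exp (\<i> * of_int k * of_real pi) / (\<i> * of_int k) - exp (\<i> * of_int k * of_real (-pi)) / (\<i> * of_int k)"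
  proof (rule integral_FTC_atLeastAtMost)
    show "((\<lambda>\<theta>. exp (\<i> * of_int k * of_real \<theta>) / (\<i> * of_int k)) has_vector_derivative exp (\<i> * of_int k * of_real \<theta>))
        (at \<theta> within {-pi..pi})" for \<theta>
      using False
      by (intro has_vector_derivative_real_field[THEN has_vector_derivative_at_within])
         (auto intro!: derivative_eq_intros)
    show "continuous_on {-pi..pi} (\<lambda>\<theta>. exp (\<i> * of_int k * of_real \<theta>))"
      by (intro continuous_intros)
  qed simp
  also have "exp (\<i> * of_int k * of_real pi) = exp (\<i> * of_int k * of_real (-pi))"
    by (subst exp_eq) (auto intro!: exI[of _ k] simp: algebra_simps)
  finally show ?thesis using False by simp
qed (simp add: scaleR_conv_of_real)

text \<open>Cauchy's formula on the circle of radius \<open>exp (- t)\<close>, with the variable written as \<open>exp (- z)\<close>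
  for \<open>z\<close> on the vertical segment with real part \<open>t\<close>. Inside the disc of convergence the series may
  be integrated termwise.\<close>

lemma
  fixes c :: "nat \<Rightarrow> complex"
  assumes sums: "\<And>q. norm q < 1 \<Longrightarrow> (\<lambda>m. c m * q ^ m) sums G q" and t: "0 < t"
  shows integrable_coefficient: "integrable lborel (\<lambda>\<theta>. indicator {-pi..pi} \<theta> *\<^sub>R
      (G (exp (- Complex t \<theta>)) * exp (of_nat n * Complex t \<theta>)))" (is "integrable _ ?g")
    and integral_coefficient: "(\<integral>\<theta>. indicator {-pi..pi} \<theta> *\<^sub>R
      (G (exp (- Complex t \<theta>)) * exp (of_nat n * Complex t \<theta>)) \<partial>lborel) = 2 * pi * c n"
proof -
  define f where "f = (\<lambda>m \<theta>. (c m * of_real (exp ((real n - real m) * t))) *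
      (indicator {-pi..pi} \<theta> *\<^sub>R exp (\<i> * of_int (int n - int m) * of_real \<theta>)))"
  have f_eq: "f m \<theta> = indicator {-pi..pi} \<theta> *\<^sub>R exp (of_nat n * Complex t \<theta>) * (c m * exp (- Complex t \<theta>) ^ m)" for m \<theta>
  proof -
    have "exp (of_nat n * Complex t \<theta>) * exp (- Complex t \<theta>) ^ m = exp ((of_nat n - of_nat m) * Complex t \<theta>)"
      by (simp add: algebra_simps flip: exp_add exp_of_nat_mult)
    also have "(of_nat n - of_nat m) * Complex t \<theta> =
        of_real ((real n - real m) * t) + \<i> * of_int (int n - int m) * of_real \<theta>"
      by (simp add: complex_eq_iff)
    finally show ?thesis
      by (simp add: f_def exp_add scaleR_conv_of_real mult_ac flip: exp_of_real)
  qed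
  have int: "integrable lborel (f m)" for m
  proof -
    have "set_integrable lborel {-pi..pi} (\<lambda>\<theta>. exp (\<i> * of_int (int n - int m) * of_real \<theta>))"
      by (intro borel_integrable_atLeastAtMost' continuous_intros)
    then show ?thesis unfolding f_def set_integrable_def by (rule integrable_mult_right)
  qed
  have norm_f: "norm (f m \<theta>) = indicator {-pi..pi} \<theta> * (norm (c m * of_real (exp (- t)) ^ m) * exp (real n * t))" for m \<theta>
    by (simp add: f_eq norm_mult norm_power algebra_simps norm_exp_eq_Re indicator_def)
  have sum1: "summable (\<lambda>m. norm (c m * of_real (exp (- t)) ^ m))"
  proof (rule powser_insidea)
    have "exp (- t) < 1" using t by simp
    then have "norm (of_real ((1 + exp (- t)) / 2) :: complex) < 1" by (simp add: norm_of_real del: of_real_divide of_real_add)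
    then show "summable (\<lambda>m. c m * of_real ((1 + exp (- t)) / 2) ^ m)"
      using sums sums_summable by blast
    show "norm (of_real (exp (- t)) :: complex) < norm (of_real ((1 + exp (- t)) / 2) :: complex)"
      using \<open>exp (- t) < 1\<close> by (simp add: norm_of_real del: of_real_divide of_real_add)
  qed
  have sum2: "summable (\<lambda>m. norm (f m \<theta>))" for \<theta>
    unfolding norm_f by (intro summable_mult summable_mult2 sum1)
  have sum3: "summable (\<lambda>m. \<integral>\<theta>. norm (f m \<theta>) \<partial>lborel)"
    unfolding norm_f by (simp add: summable_mult summable_mult2 sum1)
  have suminf: "(\<Sum>m. f m \<theta>) = ?g \<theta>" for \<theta>
  proof -
    have "norm (exp (- Complex t \<theta>)) < 1" using t by simp
    from sums_mult[OF sums[OF this]] show ?thesis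
      unfolding f_eq by (subst sums_unique[symmetric], assumption) (simp add: mult_ac)
  qed
  note facts = int AE_I2[OF sum2] sum3
  show "integrable lborel ?g"
    using integrable_suminf[OF facts] unfolding suminf .
  have "(\<lambda>m. \<integral>\<theta>. f m \<theta> \<partial>lborel) sums (\<integral>\<theta>. ?g \<theta> \<partial>lborel)"
    using sums_integral[OF facts] unfolding suminf .
  moreover have "(\<integral>\<theta>. f m \<theta> \<partial>lborel) = (if m = n then 2 * pi * c n else 0)" for m
    unfolding f_def by (subst integral_mult_right_zero) (simp add: integral_exp_int del: of_int_diff)
  ultimately show "(\<integral>\<theta>. ?g \<theta> \<partial>lborel) = 2 * pi * c n"
    using sums_single[of n "\<lambda>_. 2 * pi * c n"] sums_unique2 by (auto simp: eq_commute)
qed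

text \<open>A rescaled normal density of variance \<open>1 / (2 * a)\<close>.\<close>

lemma gaussian_integral:
  fixes a :: real
  assumes a: "0 < a"
  shows "has_bochner_integral lborel (\<lambda>x. exp (- (a * x\<^sup>2))) (sqrt (pi / a))"
proof -
  define \<sigma> where "\<sigma> = sqrt (1 / (2 * a))"
  have \<sigma>: "0 < \<sigma>" "2 * \<sigma>\<^sup>2 = 1 / a" using a by (simp_all add: \<sigma>_def)
  have "has_bochner_integral lborel (\<lambda>x. sqrt (pi / a) * normal_density 0 \<sigma> x) (sqrt (pi / a) * 1)"
    using integrable_normal_density[OF \<sigma>(1)] integral_normal_density[OF \<sigma>(1)]
    by (intro has_bochner_integral_mult_right) (simp add: has_bochner_integral_iff)
  also have "(\<lambda>x. sqrt (pi / a) * normal_density 0 \<sigma> x) = (\<lambda>x. exp (- (a * x\<^sup>2)))"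
  proof
    fix x
    have "2 * pi * \<sigma>\<^sup>2 = pi / a" using \<sigma>(2) by (simp add: field_simps)
    then show "sqrt (pi / a) * normal_density 0 \<sigma> x = exp (- (a * x\<^sup>2))"
      using a \<sigma> by (simp add: normal_density_def)
  qed
  finally show ?thesis by simp
qed

section \<open>The saddle point\<close>

text \<open>The positive minimum of \<open>pi\<^sup>2 / (12 * t) + n * t\<close>, which is the exponent of
  \<open>distinct_gf (exp (- t)) * exp (n * t)\<close> to leading order. The value there is \<open>2 * n * saddle n\<close>.\<close>

definition saddle :: "nat \<Rightarrow> real" where
  "saddle n = pi / sqrt (12 * real n)"

text \<open>The vertical line through the saddle point, in units of the width \<open>saddle n powr (3/2)\<close> of the
  peak of the integrand.\<close>

definition saddle_arc :: "nat \<Rightarrow> real \<Rightarrow> complex" where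
  "saddle_arc n u = Complex (saddle n) (u * (saddle n * sqrt (saddle n)))"

lemma saddle_pos: "4 \<le> n \<Longrightarrow> 0 < saddle n"
  by (simp add: saddle_def)

lemma saddle_le_half:
  assumes "4 \<le> n"
  shows "saddle n \<le> 1 / 2"
proof -
  have "(2 * pi)\<^sup>2 \<le> (2 * 3.2)\<^sup>2" using pi_less_4 pi_approx by (intro power_mono) auto
  also have "\<dots> \<le> 12 * real n" using assms by (simp add: power2_eq_square)
  finally have "2 * pi \<le> sqrt (12 * real n)" by (rule real_le_rsqrt)
  then show ?thesis using assms by (simp add: saddle_def field_simps)
qed

lemma of_nat_eq_saddle: "4 \<le> n \<Longrightarrow> real n = pi\<^sup>2 / (12 * (saddle n)\<^sup>2)"
  by (simp add: saddle_def power_divide)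

lemma saddle_tendsto_0: "saddle \<longlonglongrightarrow> 0"
  unfolding saddle_def by real_asymp

lemma saddle_arc_tendsto: "(\<lambda>n. saddle_arc n u / of_real (saddle n)) \<longlonglongrightarrow> 1"
proof -
  have "(\<lambda>n. 1 + \<i> * of_real (u * sqrt (saddle n))) \<longlonglongrightarrow> 1 + \<i> * of_real (u * sqrt 0)"
    by (intro tendsto_intros saddle_tendsto_0)
  moreover have "\<forall>\<^sub>F n in sequentially. 1 + \<i> * of_real (u * sqrt (saddle n)) = saddle_arc n u / of_real (saddle n)"
    using eventually_ge_at_top[of 4]
  proof eventually_elim
    case (elim n)
    then show ?case using saddle_pos[of n]
      by (simp add: saddle_arc_def complex_eq_iff Re_divide_of_real Im_divide_of_real)
  qed
  ultimately show ?thesis by (simp add: filterlim_cong[OF refl refl] Lim_transform_eventually)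
qed

text \<open>Since \<open>n = pi\<^sup>2 / (12 * (saddle n)\<^sup>2)\<close>, completing the square leaves no linear term.\<close>

lemma saddle_exponent:
  assumes n: "4 \<le> n" and z: "z \<noteq> 0"
  shows "complex_of_real (pi\<^sup>2 / 12) / z + of_nat n * z - of_real (2 * real n * saddle n) =
    of_real (pi\<^sup>2 / 12) * ((z - of_real (saddle n)) / of_real (saddle n))\<^sup>2 / z"
proof -
  let ?t = "complex_of_real (saddle n)"
  have t: "?t \<noteq> 0" using saddle_pos[OF n] by simp
  have n': "of_nat n = complex_of_real (pi\<^sup>2 / 12) / ?t\<^sup>2"
  proof -
    have "complex_of_real (real n) = complex_of_real (pi\<^sup>2 / (12 * (saddle n)\<^sup>2))"
      using of_nat_eq_saddle[OF n] by (rule arg_cong)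
    then show ?thesis by simp
  qed
  have "complex_of_real (pi\<^sup>2 / 12) / z + of_nat n * z - of_real (2 * real n * saddle n) =
      complex_of_real (pi\<^sup>2 / 12) / z + of_nat n * z - 2 * of_nat n * ?t" by simp
  also have "\<dots> = of_real (pi\<^sup>2 / 12) * ((z - ?t) / ?t)\<^sup>2 / z"
    unfolding n' using z t by (simp only: power_divide) (simp add: divide_simps, simp add: power2_eq_square algebra_simps)
  finally show ?thesis .
qed

lemma saddle_exponent_arc:
  assumes n: "4 \<le> n"
  shows "complex_of_real (pi\<^sup>2 / 12) / saddle_arc n u + of_nat n * saddle_arc n u - of_real (2 * real n * saddle n) =
    - of_real (pi\<^sup>2 / 12 * u\<^sup>2) / (saddle_arc n u / of_real (saddle n))"
proof -
  have t: "0 < saddle n" by (rule saddle_pos[OF n])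
  have z: "saddle_arc n u \<noteq> 0" using t by (auto simp: saddle_arc_def complex_eq_iff)
  have "(saddle_arc n u - of_real (saddle n)) / of_real (saddle n) = \<i> * of_real (u * sqrt (saddle n))"
    using t by (simp add: saddle_arc_def complex_eq_iff Re_divide_of_real Im_divide_of_real)
  also have "\<dots>\<^sup>2 = - of_real (u\<^sup>2 * saddle n)"
    using t by (simp add: power_mult_distrib flip: of_real_power)
  finally have "((saddle_arc n u - of_real (saddle n)) / of_real (saddle n))\<^sup>2 = - of_real (u\<^sup>2 * saddle n)" .
  then show ?thesis
    unfolding saddle_exponent[OF n z] by simp
qed

text \<open>For angles up to \<open>saddle n\<close> the quotient \<open>saddle_arc n u / saddle n\<close> has real part \<open>1\<close> and
  imaginary part at most \<open>1\<close> in absolute value, so the Gaussian decay loses at most a factor \<open>2\<close> in the exponent. This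
  is the integrable bound for dominated convergence.\<close>

lemma Re_saddle_exponent_arc_le:
  assumes n: "4 \<le> n" and u: "\<bar>u\<bar> * sqrt (saddle n) \<le> 1"
  shows "Re (- of_real (pi\<^sup>2 / 12 * u\<^sup>2) / (saddle_arc n u / of_real (saddle n))) \<le> - (pi\<^sup>2 / 24 * u\<^sup>2)"
proof -
  let ?t = "saddle n"
  have t: "0 < ?t" by (rule saddle_pos[OF n])
  define v where "v = u * sqrt ?t"
  have "\<bar>v\<bar> \<le> 1" using u t by (simp add: v_def abs_mult)
  then have v: "v\<^sup>2 \<le> 1" by (simp add: abs_square_le_1)
  have "saddle_arc n u / of_real ?t = Complex 1 v"
    using t by (simp add: v_def saddle_arc_def complex_eq_iff Re_divide_of_real Im_divide_of_real)
  moreover have "Re (- of_real A / Complex 1 v) = - A / (1 + v\<^sup>2)" for A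
    by (simp add: Re_divide)
  ultimately have "Re (- of_real (pi\<^sup>2 / 12 * u\<^sup>2) / (saddle_arc n u / of_real ?t)) = - (pi\<^sup>2 / 12 * u\<^sup>2) / (1 + v\<^sup>2)"
    by (simp only:)
  also have "\<dots> \<le> - (pi\<^sup>2 / 12 * u\<^sup>2) / 2"
  proof -
    have "(pi\<^sup>2 / 12 * u\<^sup>2) / 2 \<le> (pi\<^sup>2 / 12 * u\<^sup>2) / (1 + v\<^sup>2)"
      using v by (intro divide_left_mono) (auto intro: add_pos_nonneg)
    then show ?thesis by (simp only: minus_divide_left[symmetric] neg_le_iff_le)
  qed
  finally show ?thesis by simp
qed

lemma distinct_gf_saddle_arc:
  assumes n: "4 \<le> n" and u: "\<bar>u\<bar> * sqrt (saddle n) \<le> 1"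
  obtains E where "norm E \<le> 16 * saddle n"
    "distinct_gf (exp (- saddle_arc n u)) * exp (of_nat n * saddle_arc n u) * exp (- of_real (2 * real n * saddle n)) =
      exp (- of_real (pi\<^sup>2 / 12 * u\<^sup>2) / (saddle_arc n u / of_real (saddle n)) - ln 2 / 2 + E)"
proof -
  let ?t = "saddle n" and ?z = "saddle_arc n u"
  have t: "0 < ?t" "?t \<le> 1/2" using saddle_pos[OF n] saddle_le_half[OF n] by auto
  have Re: "Re ?z = ?t" by (simp add: saddle_arc_def)
  have "?t * (\<bar>u\<bar> * sqrt ?t) \<le> ?t * 1" using u t by (intro mult_left_mono) auto
  then have wedge: "?z \<in> wedge" using t by (simp add: wedge_def saddle_arc_def abs_mult mult_ac)
  obtain E where E: "norm E \<le> 16 * Re ?z"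
    "distinct_gf (exp (- ?z)) = exp (complex_of_real (pi\<^sup>2 / 12) / ?z - ln 2 / 2 + E)"
    by (rule distinct_gf_asymptotics[OF wedge]) (use Re t in auto)
  have "distinct_gf (exp (- ?z)) * exp (of_nat n * ?z) * exp (- of_real (2 * real n * ?t)) =
      exp (complex_of_real (pi\<^sup>2 / 12) / ?z + of_nat n * ?z - of_real (2 * real n * ?t) - ln 2 / 2 + E)"
    unfolding E(2) exp_add[symmetric] by (rule arg_cong[of _ _ exp]) simp
  also have "\<dots> = exp (- of_real (pi\<^sup>2 / 12 * u\<^sup>2) / (?z / of_real ?t) - ln 2 / 2 + E)"
    unfolding saddle_exponent_arc[OF n] ..
  finally show ?thesis using that E(1) Re by simp
qed

lemma norm_distinct_gf_saddle_arc_le: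
  assumes n: "4 \<le> n" and u: "\<bar>u\<bar> * sqrt (saddle n) \<le> 1"
  shows "norm (distinct_gf (exp (- saddle_arc n u)) * exp (of_nat n * saddle_arc n u)) * exp (- 2 * real n * saddle n)
    \<le> exp 8 * exp (- (pi\<^sup>2 / 24 * u\<^sup>2))"
proof -
  let ?t = "saddle n" and ?z = "saddle_arc n u"
  have t: "?t \<le> 1/2" by (rule saddle_le_half[OF n])
  obtain E where E: "norm E \<le> 16 * ?t"
    "distinct_gf (exp (- ?z)) * exp (of_nat n * ?z) * exp (- of_real (2 * real n * ?t)) =
      exp (- of_real (pi\<^sup>2 / 12 * u\<^sup>2) / (?z / of_real ?t) - ln 2 / 2 + E)"
    by (rule distinct_gf_saddle_arc[OF n u])
  from E(2) have "norm (distinct_gf (exp (- ?z)) * exp (of_nat n * ?z) * exp (- of_real (2 * real n * ?t))) =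
      exp (Re (- of_real (pi\<^sup>2 / 12 * u\<^sup>2) / (?z / of_real ?t)) - Re (ln 2 / 2) + Re E)"
    by (simp only: norm_exp_eq_Re plus_complex.sel minus_complex.sel)
  also have "\<dots> \<le> exp (- (pi\<^sup>2 / 24 * u\<^sup>2) - 0 + 8)"
  proof -
    have "Re (ln 2 / 2 :: complex) \<ge> 0" using Ln_of_real[of 2] by simp
    moreover have "Re E \<le> 8" using complex_Re_le_cmod[of E] E(1) t by linarith
    ultimately show ?thesis
      unfolding exp_le_cancel_iff using Re_saddle_exponent_arc_le[OF n u] by linarith
  qed
  also have "\<dots> = exp 8 * exp (- (pi\<^sup>2 / 24 * u\<^sup>2))" by (simp add: mult.commute flip: exp_add)
  finally show ?thesis by (simp add: norm_mult norm_exp_eq_Re)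
qed

lemma distinct_gf_saddle_arc_tendsto:
  "(\<lambda>n. distinct_gf (exp (- saddle_arc n u)) * exp (of_nat n * saddle_arc n u) * exp (- of_real (2 * real n * saddle n)))
     \<longlonglongrightarrow> exp (- of_real (pi\<^sup>2 / 12 * u\<^sup>2) - ln 2 / 2)"
proof -
  have "(\<lambda>n. \<bar>u\<bar> * sqrt (saddle n)) \<longlonglongrightarrow> \<bar>u\<bar> * sqrt 0"
    by (intro tendsto_intros saddle_tendsto_0)
  then have "\<forall>\<^sub>F n in sequentially. \<bar>u\<bar> * sqrt (saddle n) < 1"
    by (intro order_tendstoD) auto
  then have ev: "\<forall>\<^sub>F n in sequentially. 4 \<le> n \<and> \<bar>u\<bar> * sqrt (saddle n) \<le> 1"
    using eventually_ge_at_top[of 4] by eventually_elim auto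
  have "\<forall>n. \<exists>E. 4 \<le> n \<and> \<bar>u\<bar> * sqrt (saddle n) \<le> 1 \<longrightarrow> norm E \<le> 16 * saddle n \<and>
      distinct_gf (exp (- saddle_arc n u)) * exp (of_nat n * saddle_arc n u) * exp (- of_real (2 * real n * saddle n)) =
      exp (- of_real (pi\<^sup>2 / 12 * u\<^sup>2) / (saddle_arc n u / of_real (saddle n)) - ln 2 / 2 + E)"
    using distinct_gf_saddle_arc by blast
  from choice[OF this] obtain E where E: "\<And>n. 4 \<le> n \<and> \<bar>u\<bar> * sqrt (saddle n) \<le> 1 \<longrightarrow> norm (E n) \<le> 16 * saddle n \<and>
      distinct_gf (exp (- saddle_arc n u)) * exp (of_nat n * saddle_arc n u) * exp (- of_real (2 * real n * saddle n)) =
      exp (- of_real (pi\<^sup>2 / 12 * u\<^sup>2) / (saddle_arc n u / of_real (saddle n)) - ln 2 / 2 + E n)"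
    by blast
  have "E \<longlonglongrightarrow> 0"
  proof (rule Lim_null_comparison)
    show "\<forall>\<^sub>F n in sequentially. norm (E n) \<le> 16 * saddle n"
      using ev by eventually_elim (use E in auto)
    show "(\<lambda>n. 16 * saddle n) \<longlonglongrightarrow> 0"
      using tendsto_mult_right_zero[OF saddle_tendsto_0] by simp
  qed
  then have lim: "(\<lambda>n. exp (- of_real (pi\<^sup>2 / 12 * u\<^sup>2) / (saddle_arc n u / of_real (saddle n)) - ln 2 / 2 + E n)) \<longlonglongrightarrow>
      exp (- of_real (pi\<^sup>2 / 12 * u\<^sup>2) / 1 - ln 2 / 2 + 0)"
    by (intro tendsto_exp tendsto_add tendsto_diff tendsto_divide tendsto_const saddle_arc_tendsto) auto
  have "\<forall>\<^sub>F n in sequentially. exp (- of_real (pi\<^sup>2 / 12 * u\<^sup>2) / (saddle_arc n u / of_real (saddle n)) - ln 2 / 2 + E n)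
      = distinct_gf (exp (- saddle_arc n u)) * exp (of_nat n * saddle_arc n u) * exp (- of_real (2 * real n * saddle n))"
    using ev by eventually_elim (use E in simp)
  from Lim_transform_eventually[OF lim this] show ?thesis by (simp only: div_by_1 add_0_right)
qed

text \<open>The bound off the axis is relative to the value at the saddle point itself, which is the case
  \<open>u = 0\<close> of the estimate on the arc.\<close>

lemma norm_distinct_gf_off_arc_le:
  assumes n: "4 \<le> n" and \<theta>: "saddle n \<le> \<bar>\<theta>\<bar>" "\<bar>\<theta>\<bar> \<le> pi"
  shows "norm (distinct_gf (exp (- Complex (saddle n) \<theta>)) * exp (of_nat n * Complex (saddle n) \<theta>)) * exp (- 2 * real n * saddle n)
    \<le> exp 8 * exp (- 1 / (36 * saddle n))"
proof -
  let ?t = "saddle n"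
  have t: "0 < ?t" "?t \<le> 1/2" using saddle_pos[OF n] saddle_le_half[OF n] by auto
  have arc: "saddle_arc n 0 = of_real ?t" by (simp add: saddle_arc_def complex_eq_iff)
  have "norm (distinct_gf (of_real (exp (- ?t)))) * exp (real n * ?t) * exp (- 2 * real n * ?t) \<le> exp 8"
    using norm_distinct_gf_saddle_arc_le[OF n, of 0]
    by (simp add: arc norm_mult norm_exp_eq_Re exp_of_real flip: of_real_minus)
  then have "(norm (distinct_gf (of_real (exp (- ?t)))) * exp (real n * ?t) * exp (- 2 * real n * ?t)) * exp (- 1 / (36 * ?t))
      \<le> exp 8 * exp (- 1 / (36 * ?t))"
    by (rule mult_right_mono) simp
  moreover have "norm (distinct_gf (exp (- Complex ?t \<theta>)) * exp (of_nat n * Complex ?t \<theta>)) * exp (- 2 * real n * ?t) \<le>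
      (norm (distinct_gf (of_real (exp (- ?t)))) * exp (- 1 / (36 * ?t))) * exp (real n * ?t) * exp (- 2 * real n * ?t)"
    unfolding norm_mult
    using norm_distinct_gf_away_from_axis[OF t \<theta>] by (intro mult_right_mono) (auto simp: norm_exp_eq_Re)
  ultimately show ?thesis by (simp only: mult_ac)
qed

text \<open>The generating function of the coefficients \<open>c n\<close> is the peaked factor \<open>distinct_gf\<close> times a
  weight that varies slowly at the scale of the peak and grows at most polynomially in \<open>1 / saddle n\<close>.
  For angles up to \<open>saddle n\<close> the rescaled integrand converges to \<open>L\<close> times a Gaussian under a
  Gaussian bound; for larger angles the exponentially small factor of \<open>distinct_gf\<close> beats the weight.
  The weight may depend on \<open>n\<close>, which allows sums truncated at \<open>n\<close>. The condition \<open>4 \<le> n\<close> only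
  serves to have \<open>saddle n \<le> 1 / 2\<close>.\<close>

theorem saddle_point_asymptotics:
  fixes c :: "nat \<Rightarrow> nat \<Rightarrow> complex" and W :: "nat \<Rightarrow> complex \<Rightarrow> complex"
  assumes sums: "\<And>n q. norm q < 1 \<Longrightarrow> (\<lambda>m. c n m * q ^ m) sums (distinct_gf q * W n q)"
    and near: "\<And>n z. 4 \<le> n \<Longrightarrow> z \<in> wedge \<Longrightarrow> Re z = saddle n \<Longrightarrow> norm (W n (exp (- z))) \<le> C / saddle n"
    and far: "\<And>n z. 4 \<le> n \<Longrightarrow> Re z = saddle n \<Longrightarrow> norm (W n (exp (- z))) \<le> C / saddle n ^ 5"
    and lim: "\<And>u. (\<lambda>n. of_real (saddle n) * W n (exp (- saddle_arc n u))) \<longlonglongrightarrow> L"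
  shows "(\<lambda>n. c n n * of_real (exp (- 2 * real n * saddle n) / sqrt (saddle n))) \<longlonglongrightarrow> L * of_real (sqrt (6 / pi) / (2 * pi))"
proof -
  define H where "H = (\<lambda>n z. of_real (saddle n) * (distinct_gf (exp (- z)) * W n (exp (- z)) * exp (of_nat n * z)) *
      of_real (exp (- 2 * real n * saddle n)))"
  \<comment> \<open>the substitution \<open>\<theta> = u * saddle n powr (3/2)\<close> in the coefficient integral, normalised by the peak value\<close>
  define K where "K = (\<lambda>n u. indicator {-pi..pi} (u * (saddle n * sqrt (saddle n))) *\<^sub>R H n (saddle_arc n u))"
  \<comment> \<open>the part of the arc with angle at most \<open>saddle n\<close>\<close>
  define A where "A = (\<lambda>n. {u. \<bar>u\<bar> * sqrt (saddle n) \<le> 1})"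
  have A[measurable, simp]: "A n \<in> sets borel" for n unfolding A_def by measurable
  then have A_compl[simp]: "- A n \<in> sets borel" for n by (rule borel_comp)
  have K_int: "integrable lborel (K n)"
    and K_integral: "(\<integral>u. K n u \<partial>lborel) = 2 * pi * (c n n * of_real (exp (- 2 * real n * saddle n) / sqrt (saddle n)))"
    if n: "4 \<le> n" for n
  proof -
    let ?t = "saddle n"
    have t: "0 < ?t" by (rule saddle_pos[OF n])
    define G where "G = (\<lambda>\<theta>. indicator {-pi..pi} \<theta> *\<^sub>R
      (distinct_gf (exp (- Complex ?t \<theta>)) * W n (exp (- Complex ?t \<theta>)) * exp (of_nat n * Complex ?t \<theta>)))"
    have G: "integrable lborel G" "(\<integral>\<theta>. G \<theta> \<partial>lborel) = 2 * pi * c n n"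
      unfolding G_def
      using integrable_coefficient[of "c n" "\<lambda>q. distinct_gf q * W n q" ?t n]
        integral_coefficient[of "c n" "\<lambda>q. distinct_gf q * W n q" ?t n] sums t by auto
    have ts: "?t * sqrt ?t \<noteq> 0" using t by simp
    have K: "K n u = (of_real ?t * of_real (exp (- 2 * real n * ?t))) * G (0 + ?t * sqrt ?t * u)" for u
      by (simp add: K_def H_def G_def saddle_arc_def mult_ac scaleR_conv_of_real)
    show "integrable lborel (K n)" unfolding K
      by (intro integrable_mult_right lborel_integrable_real_affine G ts)
    have "(\<integral>u. K n u \<partial>lborel) = (of_real ?t * of_real (exp (- 2 * real n * ?t))) *
        (\<integral>u. G (0 + ?t * sqrt ?t * u) \<partial>lborel)"
      unfolding K by (rule integral_mult_right_zero)
    also have "(\<integral>u. G (0 + ?t * sqrt ?t * u) \<partial>lborel) = 2 * pi * c n n / of_real (?t * sqrt ?t)"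
      using lborel_integral_real_affine[OF ts, of G 0] t unfolding G(2)
      by (simp add: scaleR_conv_of_real field_simps)
    finally show "(\<integral>u. K n u \<partial>lborel) = 2 * pi * (c n n * of_real (exp (- 2 * real n * saddle n) / sqrt (saddle n)))"
      using t by (simp add: field_simps)
  qed
  have C: "0 \<le> C"
  proof -
    have t: "0 < saddle 4" by (rule saddle_pos) simp
    have "norm (W 4 (exp (- of_real (saddle 4)))) \<le> C / saddle 4"
      by (rule near) (use t in \<open>auto simp: wedge_def\<close>)
    then have "0 \<le> C / saddle 4" using norm_ge_zero order_trans by blast
    then show ?thesis using t by (simp add: zero_le_divide_iff)
  qed
  have in_A: "Complex (saddle n) (u * (saddle n * sqrt (saddle n))) \<in> wedge" "u * (saddle n * sqrt (saddle n)) \<in> {-pi..pi}"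
    if "4 \<le> n" "u \<in> A n" for n u
  proof -
    have t: "0 < saddle n" "saddle n \<le> 1 / 2" using saddle_pos saddle_le_half that by auto
    have "saddle n * (\<bar>u\<bar> * sqrt (saddle n)) \<le> saddle n * 1"
      using that t by (intro mult_left_mono) (auto simp: A_def)
    then have *: "\<bar>u * (saddle n * sqrt (saddle n))\<bar> \<le> saddle n" using t by (simp add: abs_mult mult_ac)
    then show "Complex (saddle n) (u * (saddle n * sqrt (saddle n))) \<in> wedge" using t by (simp add: wedge_def)
    show "u * (saddle n * sqrt (saddle n)) \<in> {-pi..pi}" using * t pi_gt3 by auto
  qed
  define gauss where "gauss = (\<lambda>u. exp (- complex_of_real (pi\<^sup>2 / 12 * u\<^sup>2) - ln 2 / 2))"
  define w where "w = (\<lambda>u. C * exp 8 * exp (- (pi\<^sup>2 / 24 * u\<^sup>2)))"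
  have inner_bound: "norm (indicator (A n) u *\<^sub>R K n u) \<le> w u" if n: "4 \<le> n" for n u
  proof -
    have t: "0 < saddle n" by (rule saddle_pos[OF n])
    show ?thesis
      proof (cases "u \<in> A n")
        case True
        let ?z = "saddle_arc n u"
        have "norm (K n u) = (saddle n * norm (W n (exp (- ?z)))) *
            (norm (distinct_gf (exp (- ?z)) * exp (of_nat n * ?z)) * exp (- 2 * real n * saddle n))"
          using in_A(2)[OF n True] t by (simp add: K_def H_def norm_mult)
        also have "\<dots> \<le> C * (exp 8 * exp (- (pi\<^sup>2 / 24 * u\<^sup>2)))"
        proof (rule mult_mono)
          have "norm (W n (exp (- ?z))) \<le> C / saddle n"
            using in_A(1)[OF n True] by (intro near n) (auto simp: saddle_arc_def)
          then show "saddle n * norm (W n (exp (- ?z))) \<le> C" using t by (simp add: field_simps)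
          show "norm (distinct_gf (exp (- ?z)) * exp (of_nat n * ?z)) * exp (- 2 * real n * saddle n) \<le> exp 8 * exp (- (pi\<^sup>2 / 24 * u\<^sup>2))"
            using True by (intro norm_distinct_gf_saddle_arc_le n) (auto simp: A_def)
        qed (use C in auto)
        finally show ?thesis using True by (simp add: w_def)
      qed (use C in \<open>simp add: w_def\<close>)
  qed
  \<comment> \<open>the shift by \<open>4\<close> makes the bounds hold for all members of the sequence\<close>
  have inner: "(\<lambda>n. \<integral>u. indicator (A (n + 4)) u *\<^sub>R K (n + 4) u \<partial>lborel) \<longlonglongrightarrow> (\<integral>u. L * gauss u \<partial>lborel)"
  proof (rule integral_dominated_convergence[where w = w])
    show "integrable lborel w" unfolding w_def
      using gaussian_integral[of "pi\<^sup>2 / 24"] by (intro integrable_mult_right) (auto simp: has_bochner_integral_iff)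
    show "AE u in lborel. norm (indicator (A (n + 4)) u *\<^sub>R K (n + 4) u) \<le> w u" for n
      by (rule AE_I2) (rule inner_bound, simp)
    show "AE u in lborel. (\<lambda>n. indicator (A (n + 4)) u *\<^sub>R K (n + 4) u) \<longlonglongrightarrow> L * gauss u"
    proof (rule AE_I2)
      fix u
      have "(\<lambda>n. \<bar>u\<bar> * sqrt (saddle n)) \<longlonglongrightarrow> \<bar>u\<bar> * sqrt 0"
        by (intro tendsto_intros saddle_tendsto_0)
      then have "\<forall>\<^sub>F n in sequentially. \<bar>u\<bar> * sqrt (saddle n) < 1"
        by (intro order_tendstoD) auto
      then have ev: "\<forall>\<^sub>F n in sequentially. (of_real (saddle n) * W n (exp (- saddle_arc n u))) *
          (distinct_gf (exp (- saddle_arc n u)) * exp (of_nat n * saddle_arc n u) * exp (- of_real (2 * real n * saddle n)))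
          = indicator (A n) u *\<^sub>R K n u"
        using eventually_ge_at_top[of 4]
      proof eventually_elim
        case (elim n)
        then have u: "u \<in> A n" by (simp add: A_def)
        show ?case using in_A(2)[OF elim(2) u] u by (simp add: K_def H_def mult_ac flip: exp_of_real)
      qed
      have "(\<lambda>n. (of_real (saddle n) * W n (exp (- saddle_arc n u))) *
          (distinct_gf (exp (- saddle_arc n u)) * exp (of_nat n * saddle_arc n u) * exp (- of_real (2 * real n * saddle n))))
          \<longlonglongrightarrow> L * gauss u"
        unfolding gauss_def by (intro tendsto_mult[OF lim distinct_gf_saddle_arc_tendsto])
      from Lim_transform_eventually[OF this ev]
      show "(\<lambda>n. indicator (A (n + 4)) u *\<^sub>R K (n + 4) u) \<longlonglongrightarrow> L * gauss u"
        by (rule LIMSEQ_ignore_initial_segment)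
    qed
    show "(\<lambda>u. L * gauss u) \<in> borel_measurable lborel" unfolding gauss_def by measurable
    show "(\<lambda>u. indicator (A (n + 4)) u *\<^sub>R K (n + 4) u) \<in> borel_measurable lborel" for n
      using borel_measurable_integrable[OF K_int[of "n + 4"]] by simp
  qed
  have gauss: "(\<integral>u. L * gauss u \<partial>lborel) = L * of_real (sqrt (6 / pi))"
  proof -
    have "has_bochner_integral lborel (\<lambda>u. complex_of_real (exp (- (pi\<^sup>2 / 12 * u\<^sup>2)))) (of_real (sqrt (pi / (pi\<^sup>2 / 12))))"
      by (intro has_bochner_integral_of_real gaussian_integral) auto
    then have "has_bochner_integral lborel (\<lambda>u. (L * of_real (1 / sqrt 2)) * complex_of_real (exp (- (pi\<^sup>2 / 12 * u\<^sup>2))))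
        ((L * of_real (1 / sqrt 2)) * of_real (sqrt (pi / (pi\<^sup>2 / 12))))"
      by (intro has_bochner_integral_mult_right) auto
    also have "(\<lambda>u. (L * of_real (1 / sqrt 2)) * complex_of_real (exp (- (pi\<^sup>2 / 12 * u\<^sup>2)))) = (\<lambda>u. L * gauss u)"
    proof
      fix u
      have "exp (- ln 2 / 2 :: complex) = of_real (exp (- ln 2 / 2))"
        using Ln_of_real[of 2] by (simp flip: exp_of_real)
      also have "exp (- ln 2 / 2 :: real) = 1 / sqrt 2"
        by (simp add: exp_minus inverse_eq_divide ln_sqrt[symmetric] flip: ln_sqrt)
      finally have "exp (- ln 2 / 2 :: complex) = of_real (1 / sqrt 2)" .
      moreover have "gauss u = exp (- of_real (pi\<^sup>2 / 12 * u\<^sup>2)) * exp (- ln 2 / 2)"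
        unfolding gauss_def exp_add[symmetric] by (rule arg_cong[of _ _ exp]) simp
      ultimately show "(L * of_real (1 / sqrt 2)) * complex_of_real (exp (- (pi\<^sup>2 / 12 * u\<^sup>2))) = L * gauss u"
        by (simp add: mult_ac flip: exp_of_real)
    qed
    also have "(L * of_real (1 / sqrt 2)) * of_real (sqrt (pi / (pi\<^sup>2 / 12))) = L * of_real (sqrt (6 / pi))"
    proof -
      have "1 / sqrt 2 * sqrt (pi / (pi\<^sup>2 / 12)) = sqrt ((1 / 2) * (pi / (pi\<^sup>2 / 12)))"
      proof -
        have "1 / sqrt 2 = sqrt (1 / 2)" by (simp add: real_sqrt_divide)
        then show ?thesis by (simp only: real_sqrt_mult)
      qed
      also have "(1 / 2) * (pi / (pi\<^sup>2 / 12)) = 6 / pi" by (simp add: power2_eq_square)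
      finally show ?thesis by (simp only: mult.assoc of_real_mult[symmetric])
    qed
    finally show ?thesis by (simp add: has_bochner_integral_iff)
  qed
  have outer: "(\<lambda>n. \<integral>u. indicator (- A n) u *\<^sub>R K n u \<partial>lborel) \<longlonglongrightarrow> 0"
  proof (rule Lim_null_comparison)
    show "(\<lambda>n. 2 * (pi / (saddle n * sqrt (saddle n))) * (C / saddle n ^ 4 * exp 8 * exp (- 1 / (36 * saddle n)))) \<longlonglongrightarrow> 0"
      unfolding saddle_def by real_asymp
    show "\<forall>\<^sub>F n in sequentially. norm (\<integral>u. indicator (- A n) u *\<^sub>R K n u \<partial>lborel) \<le>
        2 * (pi / (saddle n * sqrt (saddle n))) * (C / saddle n ^ 4 * exp 8 * exp (- 1 / (36 * saddle n)))"
      using eventually_ge_at_top[of 4]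
    proof eventually_elim
      case (elim n)
      let ?t = "saddle n" and ?a = "pi / (saddle n * sqrt (saddle n))"
      let ?B = "C / ?t ^ 4 * exp 8 * exp (- 1 / (36 * ?t))"
      have t: "0 < ?t" by (rule saddle_pos[OF elim])
      have "norm (\<integral>u. indicator (- A n) u *\<^sub>R K n u \<partial>lborel) \<le> (\<integral>u. norm (indicator (- A n) u *\<^sub>R K n u) \<partial>lborel)"
        by (rule integral_norm_bound)
      also have "\<dots> \<le> (\<integral>u. indicator {-?a..?a} u *\<^sub>R ?B \<partial>lborel)"
      proof (rule integral_mono)
        show "integrable lborel (\<lambda>u. norm (indicator (- A n) u *\<^sub>R K n u))"
          by (intro integrable_norm integrable_mult_indicator K_int elim) auto
        show "integrable lborel (\<lambda>u. indicator {-?a..?a} u *\<^sub>R ?B)"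
          by (rule integrable_scaleR_left, rule integrable_real_indicator) (auto simp: emeasure_lborel_Icc_eq)
        fix u
        let ?z = "saddle_arc n u" and ?\<theta> = "u * (?t * sqrt ?t)"
        show "norm (indicator (- A n) u *\<^sub>R K n u) \<le> indicator {-?a..?a} u *\<^sub>R ?B"
        proof (cases "u \<notin> A n \<and> ?\<theta> \<in> {-pi..pi}")
          case True
          have "\<bar>?\<theta>\<bar> \<le> pi" using True by auto
          then have "\<bar>u\<bar> \<le> ?a" using t by (simp add: field_simps abs_mult)
          then have u: "u \<in> {-?a..?a}" by auto
          have "?t * 1 \<le> ?t * (\<bar>u\<bar> * sqrt ?t)" using True t by (intro mult_left_mono) (auto simp: A_def)
          then have \<theta>: "?t \<le> \<bar>?\<theta>\<bar>" using t by (simp add: abs_mult mult_ac)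
          have "norm (K n u) = (?t * norm (W n (exp (- ?z)))) *
              (norm (distinct_gf (exp (- ?z)) * exp (of_nat n * ?z)) * exp (- 2 * real n * ?t))"
            using True t by (simp add: K_def H_def norm_mult)
          also have "\<dots> \<le> (C / ?t ^ 4) * (exp 8 * exp (- 1 / (36 * ?t)))"
          proof (rule mult_mono)
            have "norm (W n (exp (- ?z))) \<le> C / ?t ^ 5"
              by (rule far[OF elim]) (simp add: saddle_arc_def)
            then have "?t * norm (W n (exp (- ?z))) \<le> ?t * (C / ?t ^ 5)" using t by (intro mult_left_mono) auto
            also have "\<dots> = C / ?t ^ 4" using t by (simp add: eval_nat_numeral)
            finally show *: "?t * norm (W n (exp (- ?z))) \<le> C / ?t ^ 4" .
            have "0 \<le> ?t * norm (W n (exp (- ?z)))" using t by simp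
            with * show "0 \<le> C / ?t ^ 4" by linarith
            show "norm (distinct_gf (exp (- ?z)) * exp (of_nat n * ?z)) * exp (- 2 * real n * ?t) \<le> exp 8 * exp (- 1 / (36 * ?t))"
              unfolding saddle_arc_def by (rule norm_distinct_gf_off_arc_le[OF elim \<theta> \<open>\<bar>?\<theta>\<bar> \<le> pi\<close>])
          qed auto
          finally show ?thesis using True u by simp
        next
          case False
          then show ?thesis using C t by (auto simp: K_def indicator_def)
        qed
      qed
      also have "\<dots> = 2 * ?a * ?B"
        using t by simp
      finally show ?case .
    qed
  qed
  have "(\<lambda>n. (\<integral>u. indicator (A (n + 4)) u *\<^sub>R K (n + 4) u \<partial>lborel) + (\<integral>u. indicator (- A (n + 4)) u *\<^sub>R K (n + 4) u \<partial>lborel))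
      \<longlonglongrightarrow> L * of_real (sqrt (6 / pi)) + 0"
    using inner unfolding gauss by (rule tendsto_add[OF _ LIMSEQ_ignore_initial_segment[OF outer]])
  also have "(\<lambda>n. (\<integral>u. indicator (A (n + 4)) u *\<^sub>R K (n + 4) u \<partial>lborel) + (\<integral>u. indicator (- A (n + 4)) u *\<^sub>R K (n + 4) u \<partial>lborel))
      = (\<lambda>n. \<integral>u. K (n + 4) u \<partial>lborel)"
  proof
    fix n
    have int: "integrable lborel (K (n + 4))" by (rule K_int) simp
    have "(\<integral>u. indicator (A (n + 4)) u *\<^sub>R K (n + 4) u \<partial>lborel) + (\<integral>u. indicator (- A (n + 4)) u *\<^sub>R K (n + 4) u \<partial>lborel)
        = (\<integral>u. indicator (A (n + 4)) u *\<^sub>R K (n + 4) u + indicator (- A (n + 4)) u *\<^sub>R K (n + 4) u \<partial>lborel)"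
      by (intro Bochner_Integration.integral_add[symmetric] integrable_mult_indicator int) auto
    also have "(\<lambda>u. indicator (A (n + 4)) u *\<^sub>R K (n + 4) u + indicator (- A (n + 4)) u *\<^sub>R K (n + 4) u) = K (n + 4)"
      by (auto simp: indicator_def)
    finally show "(\<integral>u. indicator (A (n + 4)) u *\<^sub>R K (n + 4) u \<partial>lborel) + (\<integral>u. indicator (- A (n + 4)) u *\<^sub>R K (n + 4) u \<partial>lborel)
        = (\<integral>u. K (n + 4) u \<partial>lborel)" .
  qed
  finally have "(\<lambda>n. \<integral>u. K (n + 4) u \<partial>lborel) \<longlonglongrightarrow> L * of_real (sqrt (6 / pi))" by simp
  then have "(\<lambda>n. (\<integral>u. K (n + 4) u \<partial>lborel) / (2 * pi)) \<longlonglongrightarrow> L * of_real (sqrt (6 / pi)) / (2 * pi)"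
    by (intro tendsto_intros) auto
  then have "(\<lambda>n. (\<lambda>n. c n n * of_real (exp (- 2 * real n * saddle n) / sqrt (saddle n))) (n + 4)) \<longlonglongrightarrow> L * of_real (sqrt (6 / pi) / (2 * pi))"
    by (simp add: K_integral)
  then show ?thesis by (rule LIMSEQ_offset)
qed

section \<open>Riemann sums over a half-line\<close>

lemma has_bochner_integral_FTC_greaterThan_0:
  fixes f F :: "real \<Rightarrow> real"
  assumes f: "f \<in> borel_measurable borel" "\<And>x. 0 \<le> x \<Longrightarrow> (F has_real_derivative f x) (at x)" "\<And>x. 0 \<le> x \<Longrightarrow> 0 \<le> f x"
    and lim: "(F \<longlongrightarrow> T) at_top"
  shows "has_bochner_integral lborel (\<lambda>x. indicator {0<..} x * f x) (T - F 0)"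
    and has_bochner_integral_FTC_greaterThan_0_complex: "has_bochner_integral lborel (\<lambda>x. indicator {0<..} x *\<^sub>R complex_of_real (f x)) (of_real (T - F 0))"
proof -
  have nn: "(\<integral>\<^sup>+x. ennreal (f x) * indicator {0..} x \<partial>lborel) = T - F 0"
    by (rule nn_integral_FTC_atLeast[OF f lim])
  have nonneg: "0 \<le> T - F 0"
  proof -
    have "F 0 \<le> F x" if "0 \<le> x" for x
      using that by (intro DERIV_nonneg_imp_nondecreasing[of 0 x F]) (auto intro: f)
    then have "F 0 \<le> T" by (intro tendsto_lowerbound[OF lim]) (auto intro: eventually_at_top_linorderI[of 0])
    then show ?thesis by simp
  qed
  have "has_bochner_integral lborel (\<lambda>x. indicator {0..} x * f x) (T - F 0)"
  proof (rule has_bochner_integral_nn_integral)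
    show "(\<lambda>x. indicator {0..} x * f x) \<in> borel_measurable lborel" using f(1) by simp
    show "AE x in lborel. 0 \<le> indicator {0..} x * f x" using f(3) by (auto simp: indicator_def)
    show "(\<integral>\<^sup>+x. ennreal (indicator {0..} x * f x) \<partial>lborel) = ennreal (T - F 0)"
      unfolding nn[symmetric] by (intro nn_integral_cong) (auto simp: indicator_def)
  qed (use nonneg in auto)
  then show "has_bochner_integral lborel (\<lambda>x. indicator {0<..} x * f x) (T - F 0)"
    by (rule has_bochner_integral_discrete_difference[where X="{0}", THEN iffD1, rotated 4]) (auto simp: indicator_def)
  then have "has_bochner_integral lborel (\<lambda>x. complex_of_real (indicator {0<..} x * f x)) (of_real (T - F 0))"
    by (rule has_bochner_integral_of_real)
  then show "has_bochner_integral lborel (\<lambda>x. indicator {0<..} x *\<^sub>R complex_of_real (f x)) (of_real (T - F 0))" by (rule has_bochner_integral_cong[THEN iffD1, rotated -1]) (auto simp: indicator_def)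
qed

text \<open>The sum is the integral of a step function with steps of length \<open>t n\<close>, to which dominated
  convergence applies. The summands may depend on \<open>n\<close> beyond the mesh; convergence is only required
  along indices \<open>\<kappa> n\<close> with \<open>\<kappa> n * t n\<close> tending to \<open>x\<close>.\<close>

lemma riemann_sum_tendsto:
  fixes g :: "nat \<Rightarrow> nat \<Rightarrow> complex" and t :: "nat \<Rightarrow> real" and \<phi> :: "real \<Rightarrow> complex"
  assumes a: "0 < a"
    and t: "t \<longlonglongrightarrow> 0" "\<forall>\<^sub>F n in sequentially. 0 < t n" "filterlim (\<lambda>n. real n * t n) at_top sequentially"
    and bound: "\<forall>\<^sub>F n in sequentially. \<forall>k\<ge>1. norm (g n k) \<le> C * exp (- (a * (real k * t n)))"
    and lim: "\<And>\<kappa> x. 0 < x \<Longrightarrow> (\<And>n. 1 \<le> \<kappa> n) \<Longrightarrow> (\<lambda>n. real (\<kappa> n) * t n) \<longlonglongrightarrow> x \<Longrightarrow> (\<lambda>n. g n (\<kappa> n)) \<longlonglongrightarrow> \<phi> x"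
    and \<phi>[measurable]: "\<phi> \<in> borel_measurable borel"
  shows "(\<lambda>n. of_real (t n) * (\<Sum>k=1..n. g n k)) \<longlonglongrightarrow> (\<integral>x. indicator {0<..} x *\<^sub>R \<phi> x \<partial>lborel)"
proof -
  \<comment> \<open>the value on the interval that ends at \<open>k * t n\<close> is the \<open>k\<close>-th summand\<close>
  define s where "s = (\<lambda>n x. \<Sum>k=1..n. indicator {real (k - 1) * t n<..real k * t n} x *\<^sub>R g n k)"
  obtain N where N: "\<And>n. N \<le> n \<Longrightarrow> 0 < t n"
    "\<And>n k. N \<le> n \<Longrightarrow> 1 \<le> k \<Longrightarrow> norm (g n k) \<le> C * exp (- (a * (real k * t n)))"
    using eventually_conj[OF t(2) bound] unfolding eventually_sequentially by blast
  have C: "0 \<le> C"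
  proof -
    have "0 \<le> C * exp (- (a * (real 1 * t N)))"
      using N(2)[of N 1] norm_ge_zero[of "g N 1"] by linarith
    then show ?thesis by (simp add: zero_le_mult_iff)
  qed
  have s_integral: "(\<integral>x. s n x \<partial>lborel) = of_real (t n) * (\<Sum>k=1..n. g n k)" if n: "N \<le> n" for n
  proof -
    have le: "real (k - 1) * t n \<le> real k * t n" for k using N(1)[OF n] by (intro mult_right_mono) auto
    have "(\<integral>x. s n x \<partial>lborel) = (\<Sum>k=1..n. \<integral>x. indicator {real (k - 1) * t n<..real k * t n} x *\<^sub>R g n k \<partial>lborel)"
    proof -
      have "integrable lborel (\<lambda>x. indicator {real (k - 1) * t n<..real k * t n} x *\<^sub>R g n k)" for k
        by (intro integrable_scaleR_left integrable_real_indicator)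
           (use le[of k] in \<open>simp_all add: emeasure_lborel_Ioc del: of_nat_diff\<close>)
      then show ?thesis unfolding s_def by (intro Bochner_Integration.integral_sum)
    qed
    also have "\<dots> = (\<Sum>k=1..n. of_real (t n) * g n k)"
    proof (rule sum.cong[OF refl])
      fix k assume "k \<in> {1..n}"
      then have "real k * t n - real (k - 1) * t n = t n" by (simp add: of_nat_diff algebra_simps)
      then show "(\<integral>x. indicator {real (k - 1) * t n<..real k * t n} x *\<^sub>R g n k \<partial>lborel) = of_real (t n) * g n k"
        using le[of k] by (simp add: scaleR_conv_of_real)
    qed
    finally show ?thesis by (simp add: sum_distrib_left)
  qed
  \<comment> \<open>the index of the interval that contains \<open>x\<close>\<close>
  define \<kappa> where "\<kappa> = (\<lambda>n x. nat \<lceil>x / t n\<rceil>)"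
  have \<kappa>: "1 \<le> \<kappa> n x" "real (\<kappa> n x - 1) * t n < x" "x \<le> real (\<kappa> n x) * t n"
    and \<kappa>_unique: "real (k - 1) * t n < x \<Longrightarrow> x \<le> real k * t n \<Longrightarrow> k = \<kappa> n x"
    if "0 < x" "0 < t n" for n x k
  proof -
    define y where "y = x / t n"
    have y: "0 < y" "x = y * t n" using that by (auto simp: y_def)
    have c: "0 < \<lceil>y\<rceil>" using y by (simp add: zero_less_ceiling)
    have "1 \<le> nat \<lceil>y\<rceil>" using c by linarith
    then show "1 \<le> \<kappa> n x" by (simp only: \<kappa>_def y_def)
    have "real (\<kappa> n x) = of_int \<lceil>y\<rceil>" using c by (simp add: \<kappa>_def y_def[symmetric])
    then have r: "real (\<kappa> n x - 1) < y" "y \<le> real (\<kappa> n x)"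
      using \<open>1 \<le> \<kappa> n x\<close> ceiling_correct[of y] by (simp_all add: of_nat_diff)
    then show "real (\<kappa> n x - 1) * t n < x" "x \<le> real (\<kappa> n x) * t n"
      unfolding y(2) using that by (auto intro: mult_strict_right_mono mult_right_mono)
    assume "real (k - 1) * t n < x" "x \<le> real k * t n"
    then have k: "real (k - 1) < y" "y \<le> real k"
      unfolding y(2) using that by auto
    then show "k = \<kappa> n x" using r y(1) by linarith
  qed
  have s_eq: "s n x = (if x \<le> real n * t n then g n (\<kappa> n x) else 0)" if "0 < x" "0 < t n" for n x
  proof -
    have mem: "x \<in> {real (k - 1) * t n<..real k * t n} \<longleftrightarrow> k = \<kappa> n x" for k
      using \<kappa>[OF that] \<kappa>_unique[OF that, of k] by auto
    have "s n x = (\<Sum>k=1..n. if k = \<kappa> n x then g n k else 0)"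
    proof -
      have "indicator {real (k - 1) * t n<..real k * t n} x = (if k = \<kappa> n x then 1 else 0 :: real)" for k
        unfolding indicator_def mem by simp
      then show ?thesis unfolding s_def by (simp only:) (intro sum.cong refl, simp)
    qed
    also have "\<dots> = (if \<kappa> n x \<in> {1..n} then g n (\<kappa> n x) else 0)" by simp
    also have "\<kappa> n x \<in> {1..n} \<longleftrightarrow> x \<le> real n * t n"
    proof
      assume "\<kappa> n x \<in> {1..n}"
      then have "real (\<kappa> n x) * t n \<le> real n * t n" using that by (intro mult_right_mono) auto
      then show "x \<le> real n * t n" using \<kappa>(3)[OF that] by simp
    next
      assume "x \<le> real n * t n"
      with \<kappa>(2)[OF that] have "real (\<kappa> n x - 1) * t n < real n * t n" by simp
      then have "\<kappa> n x - 1 < n" using that by simp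
      then show "\<kappa> n x \<in> {1..n}" using \<kappa>(1)[OF that] by auto
    qed
    finally show ?thesis .
  qed
  have s_0: "s n x = 0" if "x \<le> 0" "0 < t n" for n x
  proof -
    have "\<not> real (k - 1) * t n < x" for k
      using that by (metis mult_nonneg_nonneg not_less of_nat_0_le_iff order_less_imp_le order_trans)
    then have "indicator {real (k - 1) * t n<..real k * t n} x = (0 :: real)" for k
      unfolding indicator_def greaterThanAtMost_iff by simp
    then show ?thesis unfolding s_def by (simp only: scaleR_zero_left sum.neutral_const)
  qed
  have "(\<lambda>n. \<integral>x. s (n + N) x \<partial>lborel) \<longlonglongrightarrow> (\<integral>x. indicator {0<..} x *\<^sub>R \<phi> x \<partial>lborel)"
  proof (rule integral_dominated_convergence[where w = "\<lambda>x. C * (exp (- (a * x)) * indicator {0<..} x)"])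
    show "(\<lambda>x. indicator {0<..} x *\<^sub>R \<phi> x) \<in> borel_measurable lborel" by measurable
    show "s (n + N) \<in> borel_measurable lborel" for n unfolding s_def by measurable
    show "integrable lborel (\<lambda>x. C * (exp (- (a * x)) * indicator {0<..} x))"
    proof -
      have "has_bochner_integral lborel (\<lambda>x. indicator {0<..} x * exp (- (a * x))) (0 - (- exp (- (a * 0)) / a))"
      proof (rule has_bochner_integral_FTC_greaterThan_0)
        show "((\<lambda>x. - exp (- (a * x)) / a) has_real_derivative exp (- (a * x))) (at x)" for x
          using a by (auto intro!: derivative_eq_intros)
        show "((\<lambda>x. - exp (- (a * x)) / a) \<longlongrightarrow> 0) at_top"
          using a by real_asymp
      qed auto
      then show ?thesis
        by (intro integrable_mult_right) (simp add: has_bochner_integral_iff mult.commute)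
    qed
    show "AE x in lborel. (\<lambda>n. s (n + N) x) \<longlonglongrightarrow> indicator {0<..} x *\<^sub>R \<phi> x"
    proof (rule AE_I2)
      fix x :: real
      show "(\<lambda>n. s (n + N) x) \<longlonglongrightarrow> indicator {0<..} x *\<^sub>R \<phi> x"
      proof (cases "0 < x")
        case True
        \<comment> \<open>the maximum only matters for the finitely many \<open>n\<close> where \<open>t n\<close> may fail to be positive\<close>
        have "(\<lambda>n. real (max 1 (\<kappa> n x)) * t n) \<longlonglongrightarrow> x"
        proof (rule tendsto_sandwich)
          show "\<forall>\<^sub>F n in sequentially. x \<le> real (max 1 (\<kappa> n x)) * t n"
            using t(2) by eventually_elim (use \<kappa>(1,3)[OF True] in \<open>simp add: max_def\<close>)
          show "\<forall>\<^sub>F n in sequentially. real (max 1 (\<kappa> n x)) * t n \<le> x + t n"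
            using t(2)
          proof eventually_elim
            case (elim n)
            then show ?case using \<kappa>(1,2)[OF True elim]
              by (simp add: max_def of_nat_diff algebra_simps)
          qed
          show "(\<lambda>n. x + t n) \<longlonglongrightarrow> x" using tendsto_add[OF tendsto_const t(1), of x] by simp
        qed simp
        then have "(\<lambda>n. g n (max 1 (\<kappa> n x))) \<longlonglongrightarrow> \<phi> x" by (intro lim True) auto
        moreover have "\<forall>\<^sub>F n in sequentially. g n (max 1 (\<kappa> n x)) = s n x"
          using t(2) filterlim_at_top[THEN iffD1, OF t(3), rule_format, of x]
          by eventually_elim (use \<kappa>(1)[OF True] in \<open>simp add: s_eq[OF True] max_def\<close>)
        ultimately have "(\<lambda>n. s n x) \<longlonglongrightarrow> \<phi> x" by (rule Lim_transform_eventually)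
        from LIMSEQ_ignore_initial_segment[OF this, of N] show ?thesis using True by simp
      qed (simp add: s_0 N)
    qed
    show "AE x in lborel. norm (s (n + N) x) \<le> C * (exp (- (a * x)) * indicator {0<..} x)" for n
    proof (rule AE_I2)
      fix x :: real
      have n: "N \<le> n + N" by simp
      show "norm (s (n + N) x) \<le> C * (exp (- (a * x)) * indicator {0<..} x)"
      proof (cases "0 < x")
        case True
        note k = \<kappa>[OF True N(1)[OF n]]
        have "norm (s (n + N) x) \<le> norm (g (n + N) (\<kappa> (n + N) x))"
          by (simp add: s_eq[OF True N(1)[OF n]])
        also have "\<dots> \<le> C * exp (- (a * (real (\<kappa> (n + N) x) * t (n + N))))"
          by (rule N(2)[OF n k(1)])
        also have "\<dots> \<le> C * exp (- (a * x))"
          using k(3) a C by (intro mult_left_mono) auto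
        finally show ?thesis using True by simp
      qed (simp add: s_0 N)
    qed
  qed
  then have "(\<lambda>n. (\<lambda>n. of_real (t n) * (\<Sum>k=1..n. g n k)) (n + N)) \<longlonglongrightarrow> (\<integral>x. indicator {0<..} x *\<^sub>R \<phi> x \<partial>lborel)"
    by (simp add: s_integral)
  then show ?thesis by (rule LIMSEQ_offset)
qed

section \<open>From saddle point limits to asymptotic equivalence\<close>

text \<open>The arc is asymptotic to the real number \<open>saddle n\<close>, so the phase of a power whose exponent is of
  order \<open>1 / saddle n\<close> disappears in the limit.\<close>

lemma power_saddle_arc_tendsto:
  assumes "(\<lambda>n. real (m n) * saddle n) \<longlonglongrightarrow> y"
  shows "(\<lambda>n. exp (- saddle_arc n u) ^ m n) \<longlonglongrightarrow> of_real (exp (- y))"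
proof -
  have "(\<lambda>n. exp (- (of_real (real (m n) * saddle n) * (saddle_arc n u / of_real (saddle n))))) \<longlonglongrightarrow> exp (- (of_real y * 1))"
    by (intro tendsto_intros saddle_arc_tendsto assms)
  moreover have "\<forall>\<^sub>F n in sequentially. exp (- (of_real (real (m n) * saddle n) * (saddle_arc n u / of_real (saddle n))))
      = exp (- saddle_arc n u) ^ m n"
    using eventually_ge_at_top[of 4]
  proof eventually_elim
    case (elim n)
    then show ?case using saddle_pos[OF elim] by (simp flip: exp_of_nat_mult)
  qed
  ultimately have "(\<lambda>n. exp (- saddle_arc n u) ^ m n) \<longlonglongrightarrow> exp (- (of_real y * 1))"
    by (rule Lim_transform_eventually)
  then show ?thesis by (simp flip: exp_of_real)
qed

lemma saddle_shift_tendsto: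
  assumes "(\<lambda>n. real (\<kappa> n) * saddle n) \<longlonglongrightarrow> x" "\<And>n. real (m n) = a * real (\<kappa> n) + b"
  shows "(\<lambda>n. real (m n) * saddle n) \<longlonglongrightarrow> a * x"
proof -
  have "(\<lambda>n. a * (real (\<kappa> n) * saddle n) + b * saddle n) \<longlonglongrightarrow> a * x + b * 0"
    by (intro tendsto_intros assms saddle_tendsto_0)
  then show ?thesis by (simp add: assms(2) algebra_simps)
qed

lemma norm_sum_geometric_le:
  fixes g :: "nat \<Rightarrow> complex"
  assumes "0 < t" "t \<le> 1" "0 \<le> D" "\<And>k. 1 \<le> k \<Longrightarrow> norm (g k) \<le> D * exp (- t) ^ k"
  shows "norm (\<Sum>k=1..n. g k) \<le> 2 * D / t"
proof -
  have "norm (\<Sum>k=1..n. g k) \<le> (\<Sum>k=1..n. D * exp (- t) ^ k)"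
    using assms by (intro sum_norm_le) auto
  also have "\<dots> \<le> (\<Sum>k. D * exp (- t) ^ k)"
    using assms by (intro sum_le_suminf summable_mult summable_geometric) auto
  also have "\<dots> = D * (1 / (1 - exp (- t)))"
    using assms by (subst suminf_mult) (auto intro!: summable_geometric simp: suminf_geometric)
  also have "\<dots> \<le> D * (1 / (t / 2))"
    using assms one_minus_exp_ge[of t] by (intro mult_left_mono divide_left_mono) auto
  finally show ?thesis by (simp add: mult.commute)
qed

lemma saddle_times_n_at_top: "filterlim (\<lambda>n. real n * saddle n) at_top sequentially"
  unfolding saddle_def by real_asymp

text \<open>Limits of weights along the arc are integrals over the half-line, evaluated here through a
  primitive \<open>F\<close> of the limit profile. For fixed \<open>u\<close> the arc lies in the wedge from some \<open>n\<close> on, where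
  the bound on the summands applies.\<close>

lemma saddle_riemann_sum_tendsto:
  fixes g :: "nat \<Rightarrow> complex \<Rightarrow> complex" and \<phi> :: "real \<Rightarrow> real"
  assumes bound: "\<And>k z. 1 \<le> k \<Longrightarrow> z \<in> wedge \<Longrightarrow> norm (g k (exp (- z))) \<le> D * exp (- Re z) ^ k"
    and lim: "\<And>\<kappa> x u. 0 < x \<Longrightarrow> (\<And>n. 1 \<le> \<kappa> n) \<Longrightarrow> (\<lambda>n. real (\<kappa> n) * saddle n) \<longlonglongrightarrow> x \<Longrightarrow>
      (\<lambda>n. g (\<kappa> n) (exp (- saddle_arc n u))) \<longlonglongrightarrow> of_real (\<phi> x)"
    and F: "\<phi> \<in> borel_measurable borel" "\<And>x. 0 \<le> x \<Longrightarrow> (F has_real_derivative \<phi> x) (at x)" "\<And>x. 0 \<le> x \<Longrightarrow> 0 \<le> \<phi> x"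
      "(F \<longlongrightarrow> T) at_top"
  shows "(\<lambda>n. of_real (saddle n) * (\<Sum>k=1..n. g k (exp (- saddle_arc n u)))) \<longlonglongrightarrow> of_real (T - F 0)"
proof -
  have int: "(\<integral>x. indicator {0<..} x *\<^sub>R complex_of_real (\<phi> x) \<partial>lborel) = of_real (T - F 0)"
    using has_bochner_integral_FTC_greaterThan_0_complex[OF F] by (simp add: has_bochner_integral_iff)
  have "(\<lambda>n. \<bar>u\<bar> * sqrt (saddle n)) \<longlonglongrightarrow> \<bar>u\<bar> * sqrt 0"
    by (intro tendsto_intros saddle_tendsto_0)
  then have "\<forall>\<^sub>F n in sequentially. \<bar>u\<bar> * sqrt (saddle n) < 1"
    by (intro order_tendstoD) auto
  then have ev: "\<forall>\<^sub>F n in sequentially. \<forall>k\<ge>1. norm (g k (exp (- saddle_arc n u))) \<le> D * exp (- (1 * (real k * saddle n)))"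
    using eventually_ge_at_top[of 4]
  proof eventually_elim
    case (elim n)
    have t: "0 < saddle n" by (rule saddle_pos[OF elim(2)])
    have "saddle n * (\<bar>u\<bar> * sqrt (saddle n)) \<le> saddle n * 1" using elim t by (intro mult_left_mono) auto
    then have wedge: "saddle_arc n u \<in> wedge" using t by (simp add: wedge_def saddle_arc_def abs_mult mult_ac)
    show ?case
    proof (intro allI impI)
      fix k :: nat assume "1 \<le> k"
      from bound[OF this wedge]
      show "norm (g k (exp (- saddle_arc n u))) \<le> D * exp (- (1 * (real k * saddle n)))"
        by (simp add: saddle_arc_def flip: exp_of_nat_mult)
    qed
  qed
  have "(\<lambda>n. of_real (saddle n) * (\<Sum>k=1..n. g k (exp (- saddle_arc n u)))) \<longlonglongrightarrow> (\<integral>x. indicator {0<..} x *\<^sub>R complex_of_real (\<phi> x) \<partial>lborel)"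
  proof (rule riemann_sum_tendsto[OF _ saddle_tendsto_0 _ saddle_times_n_at_top ev])
    show "\<forall>\<^sub>F n in sequentially. 0 < saddle n"
      using eventually_ge_at_top[of 4] by eventually_elim (rule saddle_pos)
    show "(\<lambda>n. g (\<kappa> n) (exp (- saddle_arc n u))) \<longlonglongrightarrow> complex_of_real (\<phi> x)"
      if "0 < x" "\<And>n. 1 \<le> \<kappa> n" "(\<lambda>n. real (\<kappa> n) * saddle n) \<longlonglongrightarrow> x" for \<kappa> x
      using that by (rule lim)
    show "(\<lambda>x. complex_of_real (\<phi> x)) \<in> borel_measurable borel" using F(1) by measurable
  qed simp
  then show ?thesis unfolding int .
qed

text \<open>Here \<open>2 * n * saddle n = pi * sqrt (n / 3)\<close>, and \<open>sqrt (saddle n) * sqrt (6 / pi)\<close> is the fourth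
  root of \<open>3 / n\<close>.\<close>

lemma asymp_equiv_of_saddle_limit:
  fixes a :: "nat \<Rightarrow> real"
  assumes "(\<lambda>n. complex_of_real (a n) * of_real (exp (- 2 * real n * saddle n) / sqrt (saddle n))) \<longlonglongrightarrow>
      of_real L * of_real (sqrt (6 / pi) / (2 * pi))" and L: "L \<noteq> 0"
  shows "a \<sim>[at_top] (\<lambda>n. L * (3 powr (1/4) / (2 * pi * real n powr (1/4))) * exp (pi * sqrt (real n / 3)))"
proof -
  define l where "l = L * (sqrt (6 / pi) / (2 * pi))"
  have l: "l \<noteq> 0" using L by (simp add: l_def)
  have "(\<lambda>n. complex_of_real (a n * (exp (- 2 * real n * saddle n) / sqrt (saddle n)))) \<longlonglongrightarrow> of_real l"
    using assms(1) by (simp add: l_def)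
  then have "(\<lambda>n. a n * (exp (- 2 * real n * saddle n) / sqrt (saddle n))) \<longlonglongrightarrow> l"
    by (simp only: tendsto_of_real_iff)
  then have lim: "(\<lambda>n. a n * (exp (- 2 * real n * saddle n) / sqrt (saddle n)) / l) \<longlonglongrightarrow> 1"
    using l tendsto_divide[OF _ tendsto_const[of l]] by fastforce
  have ev: "\<forall>\<^sub>F n in sequentially. a n * (exp (- 2 * real n * saddle n) / sqrt (saddle n)) / l =
      a n / (L * (3 powr (1/4) / (2 * pi * real n powr (1/4))) * exp (pi * sqrt (real n / 3)))"
    using eventually_ge_at_top[of 4]
  proof eventually_elim
    case (elim n)
    then have n: "0 < real n" by simp
    have "2 * real n * saddle n = pi * sqrt (real n / 3)"
    proof -
      have s12: "sqrt (12 * real n) = 2 * sqrt 3 * sqrt (real n)"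
        using real_sqrt_mult[of 4 "3 * real n"] by (simp add: real_sqrt_mult)
      have "2 * real n * saddle n = pi * ((real n / sqrt (real n)) / sqrt 3)"
        unfolding saddle_def s12 using n by (simp add: mult_ac)
      also have "real n / sqrt (real n) = sqrt (real n)" using n by (rule real_div_sqrt[OF less_imp_le])
      finally show ?thesis by (simp add: real_sqrt_divide)
    qed
    moreover have "sqrt (saddle n) * l = L * (3 powr (1/4) / (2 * pi * real n powr (1/4)))"
    proof -
      have "sqrt (saddle n) * sqrt (6 / pi) = sqrt (6 / sqrt (12 * real n))"
        by (simp add: saddle_def flip: real_sqrt_mult)
      also have "6 / sqrt (12 * real n) = sqrt (3 / real n)"
      proof -
        have "6 / sqrt (12 * real n) = sqrt 36 / sqrt (12 * real n)" by simp
        also have "\<dots> = sqrt (36 / (12 * real n))" by (simp only: real_sqrt_divide)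
        finally show ?thesis by simp
      qed
      also have "sqrt (sqrt (3 / real n)) = 3 powr (1/4) / real n powr (1/4)"
        using n by (simp add: powr_half_sqrt[symmetric] powr_powr powr_divide)
      finally have "sqrt (saddle n) * sqrt (6 / pi) = 3 powr (1/4) / real n powr (1/4)" .
      then show ?thesis by (simp add: l_def field_simps)
    qed
    ultimately have eq: "L * (3 powr (1/4) / (2 * pi * real n powr (1/4))) * exp (pi * sqrt (real n / 3)) =
        sqrt (saddle n) * l * exp (2 * real n * saddle n)" by simp
    have "exp (- 2 * real n * saddle n) = inverse (exp (2 * real n * saddle n))"
      by (simp flip: exp_minus)
    then show ?case unfolding eq by (simp add: divide_simps)
  qed
  show ?thesis
    by (rule asymp_equivI', rule Lim_transform_eventually[OF lim ev])
qed

section \<open>The two hook weights\<close>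

text \<open>The exponents are the sizes of the multisets that occur in the hook conditions for odd
  parts: three parts \<open>2 * k - 1\<close>; one part \<open>2 * k + 1\<close>, minus the case where \<open>2 * k - 1\<close> occurs as well;
  two parts \<open>2 * k + 1\<close>.\<close>

definition a_weight :: "nat \<Rightarrow> complex \<Rightarrow> complex" where
  "a_weight k q = q ^ (6*k-3) + q ^ (2*k+1) - q ^ (4*k) + q ^ (4*k+2)"

text \<open>For distinct parts, column \<open>j\<close> has a hook with arm \<open>2\<close> if \<open>j + 2\<close> is a part while \<open>j\<close> and
  \<open>j + 1\<close> are not, and a hook with arm \<open>1\<close> if \<open>j\<close> and \<open>j + 1\<close> are both parts. Each
  constrained part \<open>s\<close> divides the generating function by \<open>1 + q ^ s\<close>, and each prescribed part adds
  its size to the exponent of the numerator.\<close>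

definition b_weight :: "nat \<Rightarrow> complex \<Rightarrow> complex" where
  "b_weight j q = q ^ (j+2) / ((1 + q ^ j) * (1 + q ^ (j+1)) * (1 + q ^ (j+2)))
     + q ^ (2*j+1) / ((1 + q ^ j) * (1 + q ^ (j+1)))"

lemma norm_a_weight_le:
  assumes "1 \<le> k" "0 < Re z"
  shows "norm (a_weight k (exp (- z))) \<le> 4 * exp (- Re z) ^ k"
proof -
  let ?r = "exp (- Re z)"
  have le: "norm (exp (- z) ^ m) \<le> ?r ^ k" if "k \<le> m" for m
    using power_decreasing[OF that, of ?r] assms by (simp add: norm_power)
  have "norm (a_weight k (exp (- z))) \<le> norm (exp (- z) ^ (6*k-3)) + norm (exp (- z) ^ (2*k+1))
      + norm (exp (- z) ^ (4*k)) + norm (exp (- z) ^ (4*k+2))"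
    unfolding a_weight_def by (intro norm_triangle_le norm_triangle_le_diff add_mono order_refl)
  also have "\<dots> \<le> ?r ^ k + ?r ^ k + ?r ^ k + ?r ^ k"
    using assms by (intro add_mono le) auto
  finally show ?thesis by simp
qed

lemma norm_b_weight_le:
  assumes d: "0 < d" "d \<le> 1" "\<And>m. 1 \<le> m \<Longrightarrow> d \<le> norm (1 + exp (- z) ^ m)" and j: "1 \<le> j" and z: "0 < Re z"
  shows "norm (b_weight j (exp (- z))) \<le> 2 / d ^ 3 * exp (- Re z) ^ j"
proof -
  let ?r = "exp (- Re z)" and ?q = "exp (- z)"
  have le: "norm (?q ^ m) \<le> ?r ^ j" if "j \<le> m" for m
    using power_decreasing[OF that, of ?r] z by (simp add: norm_power)
  have ge: "d \<le> norm (1 + ?q ^ j)" "d \<le> norm (1 + ?q ^ (j+1))" "d \<le> norm (1 + ?q ^ (j+2))"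
    using d(3)[of j] d(3)[of "j+1"] d(3)[of "j+2"] j by auto
  have d3: "d ^ 3 \<le> norm ((1 + ?q ^ j) * (1 + ?q ^ (j+1)) * (1 + ?q ^ (j+2)))"
    unfolding norm_mult power3_eq_cube by (intro mult_mono ge) (use d in auto)
  have d2: "d ^ 3 \<le> norm ((1 + ?q ^ j) * (1 + ?q ^ (j+1)))"
  proof -
    have "d * d * d \<le> norm (1 + ?q ^ j) * norm (1 + ?q ^ (j+1)) * 1"
      by (intro mult_mono ge) (use d in auto)
    then show ?thesis by (simp add: norm_mult power3_eq_cube)
  qed
  have "norm (?q ^ (j+2) / ((1 + ?q ^ j) * (1 + ?q ^ (j+1)) * (1 + ?q ^ (j+2)))) \<le> ?r ^ j / d ^ 3"
    unfolding norm_divide by (rule frac_le[OF _ le _ d3]) (use d in auto)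
  moreover have "norm (?q ^ (2*j+1) / ((1 + ?q ^ j) * (1 + ?q ^ (j+1)))) \<le> ?r ^ j / d ^ 3"
    unfolding norm_divide by (rule frac_le[OF _ le _ d2]) (use d in auto)
  ultimately have "norm (b_weight j ?q) \<le> ?r ^ j / d ^ 3 + ?r ^ j / d ^ 3"
    unfolding b_weight_def by (intro norm_triangle_le add_mono)
  then show ?thesis by simp
qed

lemma norm_b_weight_wedge_le:
  assumes "1 \<le> j" "z \<in> wedge"
  shows "norm (b_weight j (exp (- z))) \<le> 16 * exp (- Re z) ^ j"
proof -
  have "1/2 \<le> norm (1 + exp (- z) ^ m)" for m
  proof -
    have "1/2 \<le> norm (1 + exp (- (of_nat m * z)))"
      using assms(2) by (intro norm_one_plus_exp_ge) (auto simp: wedge_def abs_mult mult_left_mono)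
    then show ?thesis by (simp flip: exp_of_nat_mult)
  qed
  then have "norm (b_weight j (exp (- z))) \<le> 2 / (1/2) ^ 3 * exp (- Re z) ^ j"
    using assms by (intro norm_b_weight_le) (auto simp: wedge_def)
  then show ?thesis by (simp add: power3_eq_cube)
qed

text \<open>Off the wedge the denominators can be as small as \<open>1 - exp (- Re z)\<close>, which still leaves a bound
  polynomial in \<open>1 / Re z\<close>.\<close>

lemma norm_b_weight_far_le:
  assumes "1 \<le> j" "0 < Re z" "Re z \<le> 1"
  shows "norm (b_weight j (exp (- z))) \<le> 16 / Re z ^ 3 * exp (- Re z) ^ j"
proof -
  let ?t = "Re z"
  have "?t / 2 \<le> norm (1 + exp (- z) ^ m)" if "1 \<le> m" for m
  proof -
    have "norm (exp (- z) ^ m) \<le> exp (- ?t) ^ 1"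
      using assms that power_decreasing[of 1 m "exp (- ?t)"] by (simp add: norm_power)
    moreover have "norm (1 :: complex) - norm (exp (- z) ^ m) \<le> norm (1 + exp (- z) ^ m)" by (rule norm_diff_ineq)
    ultimately show ?thesis using one_minus_exp_ge[of ?t] assms by simp
  qed
  then have "norm (b_weight j (exp (- z))) \<le> 2 / (?t / 2) ^ 3 * exp (- ?t) ^ j"
    using assms by (intro norm_b_weight_le) auto
  then show ?thesis by (simp add: power3_eq_cube)
qed

lemma a_weight_sums:
  assumes "norm q < 1"
  shows "(\<lambda>m. (\<Sum>k=1..n. of_nat (shifted (6*k-3) (subset_count {1..}) m) + of_nat (shifted (2*k+1) (subset_count {1..}) m)
      - of_nat (shifted (4*k) (subset_count {1..}) m) + of_nat (shifted (4*k+2) (subset_count {1..}) m)) * q ^ m)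
    sums (distinct_gf q * (\<Sum>k=1..n. a_weight k q))"
proof -
  have S: "(\<lambda>m. of_nat (shifted s (subset_count {1..}) m) * q ^ m) sums (q ^ s * distinct_gf q)" for s
    by (intro sums_shifted gf_subset_count_sums assms) simp
  have "(\<lambda>m. \<Sum>k=1..n. of_nat (shifted (6*k-3) (subset_count {1..}) m) * q ^ m + of_nat (shifted (2*k+1) (subset_count {1..}) m) * q ^ m
      - of_nat (shifted (4*k) (subset_count {1..}) m) * q ^ m + of_nat (shifted (4*k+2) (subset_count {1..}) m) * q ^ m)
    sums (\<Sum>k=1..n. q ^ (6*k-3) * distinct_gf q + q ^ (2*k+1) * distinct_gf q - q ^ (4*k) * distinct_gf q + q ^ (4*k+2) * distinct_gf q)"
    by (intro sums_sum sums_add sums_diff S)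
  then show ?thesis
    by (simp only: a_weight_def sum_distrib_left sum_distrib_right ring_distribs mult.commute[of "distinct_gf q"])
qed

lemma b_weight_sums:
  assumes q: "norm q < 1"
  shows "(\<lambda>m. of_nat (\<Sum>j=1..n. shifted (j+2) (subset_count ({1..} - {j,j+1} - {j+2})) m
      + shifted (2*j+1) (subset_count ({1..} - {j,j+1})) m) * q ^ m)
    sums (distinct_gf q * (\<Sum>j=1..n. b_weight j q))"
proof -
  have ne: "1 + q ^ m \<noteq> 0" if "1 \<le> m" for m
  proof
    assume "1 + q ^ m = 0"
    then have "norm (q ^ m) = 1" by (metis add_eq_0_iff norm_minus_cancel norm_one)
    moreover have "norm (q ^ m) < 1" using q that by (simp add: norm_power power_less_one_iff)
    ultimately show False by simp
  qed
  have D: "distinct_gf q = (1 + q ^ j) * ((1 + q ^ (j+1)) * gf (subset_count ({1..} - {j,j+1})) q)"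
    "gf (subset_count ({1..} - {j,j+1})) q = (1 + q ^ (j+2)) * gf (subset_count ({1..} - {j,j+1} - {j+2})) q"
    if "1 \<le> j" for j
  proof -
    have "{1..} - {j} - {j+1} = {1..} - {j,j+1}" by auto
    then show "distinct_gf q = (1 + q ^ j) * ((1 + q ^ (j+1)) * gf (subset_count ({1..} - {j,j+1})) q)"
      using gf_subset_count_remove[OF q, of "{1..}" j] gf_subset_count_remove[OF q, of "{1..} - {j}" "j+1"] that
      by auto
    show "gf (subset_count ({1..} - {j,j+1})) q = (1 + q ^ (j+2)) * gf (subset_count ({1..} - {j,j+1} - {j+2})) q"
      using that by (intro gf_subset_count_remove[OF q]) auto
  qed
  have "(\<lambda>m. \<Sum>j=1..n. of_nat (shifted (j+2) (subset_count ({1..} - {j,j+1} - {j+2})) m) * q ^ m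
      + of_nat (shifted (2*j+1) (subset_count ({1..} - {j,j+1})) m) * q ^ m)
    sums (\<Sum>j=1..n. q ^ (j+2) * gf (subset_count ({1..} - {j,j+1} - {j+2})) q + q ^ (2*j+1) * gf (subset_count ({1..} - {j,j+1})) q)"
    by (intro sums_sum sums_add sums_shifted gf_subset_count_sums q) auto
  also have "(\<Sum>j=1..n. q ^ (j+2) * gf (subset_count ({1..} - {j,j+1} - {j+2})) q + q ^ (2*j+1) * gf (subset_count ({1..} - {j,j+1})) q)
      = (\<Sum>j=1..n. distinct_gf q * b_weight j q)"
  proof (rule sum.cong[OF refl])
    fix j assume "j \<in> {1..n}"
    then have j: "1 \<le> j" by simp
    define G where "G = gf (subset_count ({1..} - {j,j+1} - {j+2})) q"
    define A B E where "A = 1 + q ^ j" "B = 1 + q ^ (j+1)" "E = 1 + q ^ (j+2)"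
    have ABE: "A \<noteq> 0" "B \<noteq> 0" "E \<noteq> 0" unfolding A_B_E_def using j ne[of j] ne[of "j+1"] ne[of "j+2"] by auto
    have gfs: "distinct_gf q = A * (B * (E * G))" "gf (subset_count ({1..} - {j,j+1})) q = E * G"
      using D[OF j] by (simp_all only: A_B_E_def G_def)
    have bw: "b_weight j q = q ^ (j+2) / (A * B * E) + q ^ (2*j+1) / (A * B)"
      by (simp only: b_weight_def A_B_E_def)
    show "q ^ (j+2) * gf (subset_count ({1..} - {j,j+1} - {j+2})) q + q ^ (2*j+1) * gf (subset_count ({1..} - {j,j+1})) q
        = distinct_gf q * b_weight j q"
      unfolding G_def[symmetric] gfs bw using ABE by (simp add: field_simps)
  qed
  finally show ?thesis by (simp only: of_nat_sum of_nat_add sum_distrib_left sum_distrib_right distrib_right)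
qed

lemma saddle_bound_far:
  assumes "4 \<le> n" "0 \<le> D" "k \<le> 5"
  shows "D / saddle n ^ k \<le> D / saddle n ^ 5"
proof -
  have "0 < saddle n" "saddle n \<le> 1" using saddle_pos saddle_le_half assms by force+
  then show ?thesis using assms by (intro divide_left_mono power_decreasing mult_pos_pos) auto
qed

section \<open>The asymptotics of both hook totals\<close>

text \<open>The limit profile is \<open>exp (- 6 * x) + exp (- 2 * x)\<close>, because the two terms with exponent near
  \<open>4 * k\<close> cancel in the limit; its integral is \<open>2 / 3\<close>.\<close>

theorem a_hooks_3_asymptotics:
  "(\<lambda>n. real (a_hooks 3 n)) \<sim>[at_top] (\<lambda>n. 2/3 * (3 powr (1/4) / (2 * pi * real n powr (1/4))) * exp (pi * sqrt (real n / 3)))"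
proof (rule asymp_equiv_of_saddle_limit)
  define c where "c = (\<lambda>n m. \<Sum>k=1..n. complex_of_nat (shifted (6*k-3) (subset_count {1..}) m)
      + of_nat (shifted (2*k+1) (subset_count {1..}) m)
      - of_nat (shifted (4*k) (subset_count {1..}) m) + of_nat (shifted (4*k+2) (subset_count {1..}) m))"
  define W where "W = (\<lambda>n q. \<Sum>k=1..n. a_weight k q)"
  have "complex_of_real (real (a_hooks 3 n)) = c n n" for n
    unfolding a_hooks_3_eq c_def by simp
  moreover have "(\<lambda>n. c n n * of_real (exp (- 2 * real n * saddle n) / sqrt (saddle n)))
      \<longlonglongrightarrow> of_real (2/3) * of_real (sqrt (6 / pi) / (2 * pi))"
  proof (rule saddle_point_asymptotics[where c = c and W = W and C = 8])
    show "(\<lambda>m. c n m * q ^ m) sums (distinct_gf q * W n q)" if "norm q < 1" for n q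
      unfolding c_def W_def by (rule a_weight_sums[OF that])
    have bound: "norm (W n (exp (- z))) \<le> 8 / saddle n" if "4 \<le> n" "Re z = saddle n" for n z
      using norm_sum_geometric_le[of "saddle n" 4 "\<lambda>k. a_weight k (exp (- z))" n] that
        saddle_pos[of n] saddle_le_half[of n] norm_a_weight_le[of _ z] by (simp add: W_def)
    then show "norm (W n (exp (- z))) \<le> 8 / saddle n" if "4 \<le> n" "z \<in> wedge" "Re z = saddle n" for n z
      using that by blast
    show "norm (W n (exp (- z))) \<le> 8 / saddle n ^ 5" if "4 \<le> n" "Re z = saddle n" for n z
      using bound[OF that] saddle_bound_far[of n 8 1] that by simp
    show "(\<lambda>n. of_real (saddle n) * W n (exp (- saddle_arc n u))) \<longlonglongrightarrow> of_real (2/3)" for u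
    proof -
      let ?F = "\<lambda>x::real. - exp (- (6 * x)) / 6 - exp (- (2 * x)) / 2"
      have "(\<lambda>n. of_real (saddle n) * (\<Sum>k=1..n. a_weight k (exp (- saddle_arc n u)))) \<longlonglongrightarrow> of_real (0 - ?F 0)"
      proof (rule saddle_riemann_sum_tendsto[where \<phi> = "\<lambda>x. exp (- (6 * x)) + exp (- (2 * x))"])
        show "norm (a_weight k (exp (- z))) \<le> 4 * exp (- Re z) ^ k" if "1 \<le> k" "z \<in> wedge" for k z
          using that by (intro norm_a_weight_le) (auto simp: wedge_def)
        fix \<kappa> :: "nat \<Rightarrow> nat" and x u :: real
        assume \<kappa>: "\<And>n. 1 \<le> \<kappa> n" "(\<lambda>n. real (\<kappa> n) * saddle n) \<longlonglongrightarrow> x"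
        have "(\<lambda>n. a_weight (\<kappa> n) (exp (- saddle_arc n u))) \<longlonglongrightarrow>
            of_real (exp (- (6 * x))) + of_real (exp (- (2 * x))) - of_real (exp (- (4 * x))) + of_real (exp (- (4 * x)))"
          unfolding a_weight_def
        proof (intro tendsto_add tendsto_diff power_saddle_arc_tendsto)
          have "3 \<le> 6 * \<kappa> n" for n using \<kappa>(1)[of n] by simp
          then show "(\<lambda>n. real (6 * \<kappa> n - 3) * saddle n) \<longlonglongrightarrow> 6 * x"
            by (intro saddle_shift_tendsto[OF \<kappa>(2), of _ 6 "-3"]) (simp add: of_nat_diff)
          show "(\<lambda>n. real (2 * \<kappa> n + 1) * saddle n) \<longlonglongrightarrow> 2 * x"
            by (intro saddle_shift_tendsto[OF \<kappa>(2), of _ 2 1]) simp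
          show "(\<lambda>n. real (4 * \<kappa> n) * saddle n) \<longlonglongrightarrow> 4 * x"
            by (intro saddle_shift_tendsto[OF \<kappa>(2), of _ 4 0]) simp
          show "(\<lambda>n. real (4 * \<kappa> n + 2) * saddle n) \<longlonglongrightarrow> 4 * x"
            by (intro saddle_shift_tendsto[OF \<kappa>(2), of _ 4 2]) simp
        qed
        then show "(\<lambda>n. a_weight (\<kappa> n) (exp (- saddle_arc n u))) \<longlonglongrightarrow> of_real (exp (- (6 * x)) + exp (- (2 * x)))"
          by simp
      next
        show "(?F has_real_derivative exp (- (6 * x)) + exp (- (2 * x))) (at x)" for x
          by (auto intro!: derivative_eq_intros)
        show "(?F \<longlongrightarrow> 0) at_top" by real_asymp
      qed auto
      then show ?thesis by (simp add: W_def)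
    qed
  qed
  ultimately show "(\<lambda>n. complex_of_real (real (a_hooks 3 n)) * of_real (exp (- 2 * real n * saddle n) / sqrt (saddle n)))
      \<longlonglongrightarrow> of_real (2/3) * of_real (sqrt (6 / pi) / (2 * pi))" by simp
qed simp

text \<open>With \<open>y = exp (- x)\<close> the limit profile is \<open>y / (1 + y) ^ 3 + y\<^sup>2 / (1 + y)\<^sup>2\<close>, whose integral over
  the half-line is the integral of \<open>1 / (1 + y) ^ 3 + y / (1 + y)\<^sup>2\<close> over the unit interval,
  namely \<open>3 / 8 + (ln 2 - 1 / 2)\<close>.\<close>

theorem b_hooks_3_asymptotics:
  "(\<lambda>n. real (b_hooks 3 n)) \<sim>[at_top] (\<lambda>n. (ln 2 - 1/8) * (3 powr (1/4) / (2 * pi * real n powr (1/4))) * exp (pi * sqrt (real n / 3)))"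
proof (rule asymp_equiv_of_saddle_limit)
  define c where "c = (\<lambda>n m. complex_of_nat (\<Sum>j=1..n. shifted (j+2) (subset_count ({1..} - {j,j+1} - {j+2})) m
      + shifted (2*j+1) (subset_count ({1..} - {j,j+1})) m))"
  define W where "W = (\<lambda>n q. \<Sum>k=1..n. b_weight k q)"
  have "complex_of_real (real (b_hooks 3 n)) = c n n" for n
    unfolding b_hooks_3_eq c_def by simp
  moreover have "(\<lambda>n. c n n * of_real (exp (- 2 * real n * saddle n) / sqrt (saddle n)))
      \<longlonglongrightarrow> of_real (ln 2 - 1/8) * of_real (sqrt (6 / pi) / (2 * pi))"
  proof (rule saddle_point_asymptotics[where c = c and W = W and C = 32])
    show "(\<lambda>m. c n m * q ^ m) sums (distinct_gf q * W n q)" if "norm q < 1" for n q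
      unfolding c_def W_def by (rule b_weight_sums[OF that])
    show "norm (W n (exp (- z))) \<le> 32 / saddle n" if "4 \<le> n" "z \<in> wedge" "Re z = saddle n" for n z
      using norm_sum_geometric_le[of "saddle n" 16 "\<lambda>k. b_weight k (exp (- z))" n] that
        saddle_pos[of n] saddle_le_half[of n] norm_b_weight_wedge_le[of _ z] by (simp add: W_def)
    show "norm (W n (exp (- z))) \<le> 32 / saddle n ^ 5" if "4 \<le> n" "Re z = saddle n" for n z
    proof -
      have t: "0 < saddle n" "saddle n \<le> 1" using saddle_pos saddle_le_half that by force+
      have "norm (W n (exp (- z))) \<le> 2 * (16 / saddle n ^ 3) / saddle n"
        unfolding W_def using t norm_b_weight_far_le[of _ z] that
        by (intro norm_sum_geometric_le) auto
      also have "\<dots> = 32 / saddle n ^ 4" by (simp add: eval_nat_numeral)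
      finally show ?thesis using saddle_bound_far[of n 32 4] that by simp
    qed
    show "(\<lambda>n. of_real (saddle n) * W n (exp (- saddle_arc n u))) \<longlonglongrightarrow> of_real (ln 2 - 1/8)" for u
    proof -
      let ?f = "\<lambda>x::real. exp (- x) / (1 + exp (- x)) ^ 3 + exp (- (2 * x)) / (1 + exp (- x)) ^ 2"
      let ?F = "\<lambda>x::real. 1 / (2 * (1 + exp (- x)) ^ 2) - ln (1 + exp (- x)) - 1 / (1 + exp (- x))"
      have pos: "0 < 1 + exp (- x)" for x :: real by (simp add: add_pos_pos)
      have "(\<lambda>n. of_real (saddle n) * (\<Sum>k=1..n. b_weight k (exp (- saddle_arc n u)))) \<longlonglongrightarrow> of_real (- 1/2 - ?F 0)"
      proof (rule saddle_riemann_sum_tendsto[where \<phi> = ?f])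
        show "norm (b_weight k (exp (- z))) \<le> 16 * exp (- Re z) ^ k" if "1 \<le> k" "z \<in> wedge" for k z
          using that by (rule norm_b_weight_wedge_le)
        fix \<kappa> :: "nat \<Rightarrow> nat" and x u :: real
        assume \<kappa>: "(\<lambda>n. real (\<kappa> n) * saddle n) \<longlonglongrightarrow> x"
        have ne: "1 + complex_of_real (exp (- x)) \<noteq> 0"
          using pos[of x] by (metis less_irrefl of_real_1 of_real_add of_real_eq_0_iff)
        have shift: "(\<lambda>n. exp (- saddle_arc n u) ^ (\<kappa> n + b)) \<longlonglongrightarrow> of_real (exp (- x))" for b
          using saddle_shift_tendsto[OF \<kappa>, of "\<lambda>n. \<kappa> n + b" 1 b] by (intro power_saddle_arc_tendsto) simp
        have shift2: "(\<lambda>n. exp (- saddle_arc n u) ^ (2 * \<kappa> n + 1)) \<longlonglongrightarrow> of_real (exp (- (2 * x)))"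
          by (intro power_saddle_arc_tendsto saddle_shift_tendsto[OF \<kappa>, of _ 2 1]) simp
        let ?e = "complex_of_real (exp (- x))"
        have "(\<lambda>n. b_weight (\<kappa> n) (exp (- saddle_arc n u))) \<longlonglongrightarrow>
            ?e / ((1 + ?e) * (1 + ?e) * (1 + ?e)) + of_real (exp (- (2 * x))) / ((1 + ?e) * (1 + ?e))"
          unfolding b_weight_def using ne shift[of 0]
          by (intro tendsto_add tendsto_divide tendsto_mult tendsto_const shift shift2) auto
        then show "(\<lambda>n. b_weight (\<kappa> n) (exp (- saddle_arc n u))) \<longlonglongrightarrow> of_real (?f x)"
          by (simp add: power3_eq_cube power2_eq_square)
      next
        show "(?F has_real_derivative ?f x) (at x)" for x
        proof -
          define p where "p = 1 + exp (- x)"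
          have p: "0 < p" using pos[of x] by (simp add: p_def)
          have outer: "((\<lambda>p. 1 / (2 * p ^ 2) - ln p - 1 / p) has_real_derivative (- 1 / p ^ 3 - 1 / p + 1 / p ^ 2)) (at p)"
            using p by (auto intro!: derivative_eq_intros)
              (simp add: divide_simps, simp add: eval_nat_numeral algebra_simps)
          have inner: "((\<lambda>x. 1 + exp (- x)) has_real_derivative - exp (- x)) (at x)"
            by (auto intro!: derivative_eq_intros)
          have "(?F has_real_derivative (- 1 / p ^ 3 - 1 / p + 1 / p ^ 2) * (- exp (- x))) (at x)"
            using DERIV_chain2[OF outer[unfolded p_def] inner] by (simp only: p_def)
          also have "(- 1 / p ^ 3 - 1 / p + 1 / p ^ 2) * (- exp (- x)) = ?f x"
          proof -
            have e: "exp (- x) = p - 1" "exp (- (2 * x)) = (p - 1)\<^sup>2"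
              by (simp_all add: p_def power2_eq_square flip: exp_add)
            have "1 / p = p / p ^ 2" using p by (simp add: power2_eq_square)
            then show ?thesis unfolding e
              by (simp add: power2_eq_square algebra_simps add_divide_distrib diff_divide_distrib)
          qed
          finally show ?thesis .
        qed
        show "(?F \<longlongrightarrow> - 1/2) at_top" by real_asymp
        show "0 \<le> ?f x" for x using pos[of x] by simp
      qed measurable
      also have "- 1/2 - ?F 0 = ln 2 - 1/8" by (simp add: power2_eq_square)
      finally show ?thesis by (simp only: W_def)
    qed
  qed
  ultimately show "(\<lambda>n. complex_of_real (real (b_hooks 3 n)) * of_real (exp (- 2 * real n * saddle n) / sqrt (saddle n)))
      \<longlonglongrightarrow> of_real (ln 2 - 1/8) * of_real (sqrt (6 / pi) / (2 * pi))" by simp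
next
  have "exp (1 / 2) \<le> (2 :: real)"
    using exp_bound[of "1 / 2"] by (simp add: power2_eq_square)
  then have "1 / 2 \<le> ln (2 :: real)" by (subst ln_ge_iff) auto
  then show "ln 2 - 1/8 \<noteq> (0 :: real)" by linarith
qed

theorem theorem5p2:
  shows "(\<lambda>n. real (a_hooks 3 n)) \<sim>[at_top]
           (\<lambda>n. 3 powr (1/4) / (3 * pi * real n powr (1/4)) * exp (pi * sqrt (real n / 3)))
         \<and> (\<lambda>n. real (b_hooks 3 n)) \<sim>[at_top]
           (\<lambda>n. (ln 2 - 1/8) * (3 powr (1/4) / (2 * pi * real n powr (1/4)))
                 * exp (pi * sqrt (real n / 3)))"
proof
  have "(\<lambda>n. 2/3 * (3 powr (1/4) / (2 * pi * real n powr (1/4))) * exp (pi * sqrt (real n / 3))) =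
      (\<lambda>n. 3 powr (1/4) / (3 * pi * real n powr (1/4)) * exp (pi * sqrt (real n / 3)))"
    by (simp add: mult.assoc)
  then show "(\<lambda>n. real (a_hooks 3 n)) \<sim>[at_top]
      (\<lambda>n. 3 powr (1/4) / (3 * pi * real n powr (1/4)) * exp (pi * sqrt (real n / 3)))"
    using a_hooks_3_asymptotics by simp
qed (rule b_hooks_3_asymptotics)

end
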